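(* For every $n\ge1$, $\widehat{\mathrm{P}}^{\mathrm{UVAL}_n}=\widehat{\mathrm{P}}^{\mathrm{USAT}_n}$.
   Context: $\Sigma=\{0,1\}$, $\Sigma^*$ the finite nonempty binary strings; for $x\in\Sigma^m$, $\pi_1(x)=x_1$. $\mathbb{P}_+\Sigma=\{\{0\},\{1\},\Sigma\}$. A promise problem is $\phi:\Sigma^*\to\mathbb{P}_+\Sigma$. A $\phi$-oracle Turing machine may, given $x$, obtain in unit time some $y\in\phi(x)$; when $\phi(x)=\Sigma$ the returned value is nondeterministic (adversarial), independently on each call. $\phi_1\propto_T\phi_2$ means there is a $\phi_2$-oracle Turing machine $M$ and a polynomial $p$ such that on every input $x$ every possible computation path halts within $p(|x|)$ steps and outputs an element of $\phi_1(x)$. $\widehat{\mathrm{P}}^{\phi}=\{\phi_1:\phi_1\propto_T\phi\}$. Level-$n$ problems: the input encodes (e.g. as a Boolean formula) $f:\Sigma^{m_1}\times\dots\times\Sigma^{m_n}\to\Sigma$, written $f(x,\dots)$ with $x\in\Sigma^{m_1}$; $f_x$ is $f$ with $x$ fixed. For a constant $c$, $\mathrm{SAT}_0(c)=\overline{\mathrm{SAT}}_0(c)=c$; for $n\ge1$, $\mathrm{SAT}_n(f)=1\iff\exists x:\overline{\mathrm{SAT}}_{n-1}(f_x)=1$, $\overline{\mathrm{SAT}}_n(f)=1\iff\forall x,\ \mathrm{SAT}_{n-1}(f_x)=1$; $\mathrm{USAT}_n(f)=\{\mathrm{SAT}_n(f)\}$ if $|\{x:\overline{\mathrm{SAT}}_{n-1}(f_x)=1\}|\le1$,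 else $\Sigma$; $\mathrm{UVAL}_n(f)=\{\pi_1x:\overline{\mathrm{SAT}}_{n-1}(f_x)=1\}$ if there is exactly one $x$ with $\overline{\mathrm{SAT}}_{n-1}(f_x)=1$, else $\Sigma$. *)

theory Defs
  imports "HOL-Computational_Algebra.Polynomial"
begin

text \<open>Binary strings are bool lists (False = 0, True = 1). Sigma-star is the set of
  nonempty such lists. A promise problem maps strings to one of {0}, {1}, Sigma.\<close>

definition promise_problem :: "(bool list \<Rightarrow> bool set) \<Rightarrow> bool" where
  "promise_problem \<phi> \<longleftrightarrow> (\<forall>x. \<phi> x \<in> {{False}, {True}, UNIV})"

text \<open>Single-tape oracle Turing machine. States and tape symbols are natural numbers
  below the bounds nst and nsym. Symbol 0 = blank, 1 = bit 0, 2 = bit 1.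
  Special states: 0 start, 1 halt with output 0, 2 halt with output 1,
  3 query, 4 oracle answered 0, 5 oracle answered 1.
  In the query state, the query string is the maximal run of bit symbols starting
  at the head position; the oracle step takes one unit of time and its answer is
  any element of the oracle's value (nondeterministic / adversarial).\<close>

record otm =
  nst  :: nat
  nsym :: nat
  tr   :: "nat \<Rightarrow> nat \<Rightarrow> nat \<times> nat \<times> int"

definition wf_otm :: "otm \<Rightarrow> bool" where
  "wf_otm M \<longleftrightarrow> 6 \<le> nst M \<and> 3 \<le> nsym M \<and>
     (\<forall>q < nst M. \<forall>s < nsym M. case tr M q s of (q', w, d) \<Rightarrow>
        q' < nst M \<and> w < nsym M \<and> d \<in> {-1, 0, 1})"

type_synonym config = "nat \<times> (int \<Rightarrow> nat) \<times> int"

definition query_string :: "(int \<Rightarrow> nat) \<Rightarrow> int \<Rightarrow> bool list" where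
  "query_string t p =
     map (\<lambda>i. t (p + int i) = 2) [0..<(LEAST k. t (p + int k) \<notin> {1, 2})]"

inductive step :: "(bool list \<Rightarrow> bool set) \<Rightarrow> otm \<Rightarrow> config \<Rightarrow> config \<Rightarrow> bool"
  for \<phi> :: "bool list \<Rightarrow> bool set" and M :: otm where
  query: "b \<in> \<phi> (query_string t p) \<Longrightarrow>
          step \<phi> M (3, t, p) (if b then 5 else 4, t, p)"
| move: "q \<notin> {1, 2, 3} \<Longrightarrow> tr M q (t p) = (q', w, d) \<Longrightarrow>
          step \<phi> M (q, t, p) (q', t(p := w), p + d)"

definition init_config :: "bool list \<Rightarrow> config" where
  "init_config x =
     (0, \<lambda>i. if 0 \<le> i \<and> i < int (length x) then (if x ! nat i then 2 else 1) else 0, 0)"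

text \<open>phi1 is polynomial-time Turing reducible to phi2: some phi2-oracle machine M and
  polynomial p such that on every (nonempty) input x every computation path halts
  within p(|x|) steps with an output in phi1 x. A path that gets stuck without halting
  counts as failure.\<close>

definition reduces :: "(bool list \<Rightarrow> bool set) \<Rightarrow> (bool list \<Rightarrow> bool set) \<Rightarrow> bool"
  (infix "\<propto>\<^sub>T" 50) where
  "\<phi>1 \<propto>\<^sub>T \<phi>2 \<longleftrightarrow> (\<exists>M (p :: nat poly). wf_otm M \<and>
     (\<forall>x. x \<noteq> [] \<longrightarrow>
        (\<forall>k c. (step \<phi>2 M ^^ k) (init_config x) c \<longrightarrow> k \<le> poly p (length x)) \<and>
        (\<forall>k c. (step \<phi>2 M ^^ k) (init_config x) c \<longrightarrow> \<not> (\<exists>c'. step \<phi>2 M c c') \<longrightarrow>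
             fst c \<in> {1, 2} \<and> (fst c = 2) \<in> \<phi>1 x)))"

definition hatP :: "(bool list \<Rightarrow> bool set) \<Rightarrow> (bool list \<Rightarrow> bool set) set" where
  "hatP \<phi> = {\<phi>1. promise_problem \<phi>1 \<and> \<phi>1 \<propto>\<^sub>T \<phi>}"

text \<open>A function f : Sigma^m1 x ... x Sigma^mn -> Sigma is represented by the block sizes
  ms = [m1,...,mn] and a function g on lists of blocks.\<close>

fun sat :: "nat list \<Rightarrow> (bool list list \<Rightarrow> bool) \<Rightarrow> bool"
and csat :: "nat list \<Rightarrow> (bool list list \<Rightarrow> bool) \<Rightarrow> bool" where
  "sat [] g = g []"
| "sat (m # ms) g = (\<exists>x. length x = m \<and> csat ms (\<lambda>xs. g (x # xs)))"
| "csat [] g = g []"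
| "csat (m # ms) g = (\<forall>x. length x = m \<longrightarrow> sat ms (\<lambda>xs. g (x # xs)))"

definition witnesses :: "nat list \<Rightarrow> (bool list list \<Rightarrow> bool) \<Rightarrow> bool list set" where
  "witnesses ms g = {x. length x = hd ms \<and> csat (tl ms) (\<lambda>xs. g (x # xs))}"

definition usat_fun :: "nat list \<Rightarrow> (bool list list \<Rightarrow> bool) \<Rightarrow> bool set" where
  "usat_fun ms g = (if card (witnesses ms g) \<le> 1 then {sat ms g} else UNIV)"

definition uval_fun :: "nat list \<Rightarrow> (bool list list \<Rightarrow> bool) \<Rightarrow> bool set" where
  "uval_fun ms g = (if \<exists>!x. x \<in> witnesses ms g
                    then {hd (THE x. x \<in> witnesses ms g)} else UNIV)"

datatype bform = BVar nat | BConst bool | BNot bform | BAnd bform bform | BOr bform bform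

fun beval :: "(nat \<Rightarrow> bool) \<Rightarrow> bform \<Rightarrow> bool" where
  "beval v (BVar i) = v i"
| "beval v (BConst b) = b"
| "beval v (BNot a) = (\<not> beval v a)"
| "beval v (BAnd a b) = (beval v a \<and> beval v b)"
| "beval v (BOr a b) = (beval v a \<or> beval v b)"

fun bvars :: "bform \<Rightarrow> nat set" where
  "bvars (BVar i) = {i}"
| "bvars (BConst b) = {}"
| "bvars (BNot a) = bvars a"
| "bvars (BAnd a b) = bvars a \<union> bvars b"
| "bvars (BOr a b) = bvars a \<union> bvars b"

definition unary :: "nat \<Rightarrow> bool list" where
  "unary k = replicate k True @ [False]"

fun enc_form :: "bform \<Rightarrow> bool list" where
  "enc_form (BVar i) = [False, False, False] @ unary i"
| "enc_form (BConst b) = [False, False, True, b]"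
| "enc_form (BNot a) = [False, True, False] @ enc_form a"
| "enc_form (BAnd a b) = [False, True, True] @ enc_form a @ enc_form b"
| "enc_form (BOr a b) = [True, False, False] @ enc_form a @ enc_form b"

definition enc_inst :: "nat list \<Rightarrow> bform \<Rightarrow> bool list" where
  "enc_inst ms \<phi> = concat (map (\<lambda>m. True # unary m) ms) @ [False] @ enc_form \<phi>"

text \<open>Valid level-n instance: n blocks, each of positive length, and the formula only
  mentions variables 0..m1+...+mn-1 (variables numbered along the concatenation).\<close>

definition valid_inst :: "nat \<Rightarrow> nat list \<Rightarrow> bform \<Rightarrow> bool" where
  "valid_inst n ms \<phi> \<longleftrightarrow> length ms = n \<and> (\<forall>m \<in> set ms. 0 < m) \<and> bvars \<phi> \<subseteq> {..< sum_list ms}"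

definition form_fun :: "bform \<Rightarrow> bool list list \<Rightarrow> bool" where
  "form_fun \<phi> xs = beval (\<lambda>i. i < length (concat xs) \<and> concat xs ! i) \<phi>"

definition decode :: "bool list \<Rightarrow> nat list \<times> bform" where
  "decode s = (THE d. enc_inst (fst d) (snd d) = s)"

definition encodes_level :: "nat \<Rightarrow> bool list \<Rightarrow> bool" where
  "encodes_level n s \<longleftrightarrow> (\<exists>ms \<phi>. s = enc_inst ms \<phi> \<and> valid_inst n ms \<phi>)"

definition USAT :: "nat \<Rightarrow> bool list \<Rightarrow> bool set" where
  "USAT n s = (if encodes_level n s
               then usat_fun (fst (decode s)) (form_fun (snd (decode s))) else UNIV)"

definition UVAL :: "nat \<Rightarrow> bool list \<Rightarrow> bool set" where
  "UVAL n s = (if encodes_level n s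
               then uval_fun (fst (decode s)) (form_fun (snd (decode s))) else UNIV)"

end

theory Submission
  imports Defs
begin

text \<open>
  To answer \<open>UVAL\<close> from \<open>USAT\<close>, one query suffices: if \<open>f\<close> has a unique witness \<open>x\<close>, then
  \<open>x\<^sub>0 \<and> f\<close> has at most one witness, and it has one iff the first bit of \<open>x\<close> is 1.

  To answer \<open>USAT\<close> from \<open>UVAL\<close>, eliminate the variables of \<open>f\<close> one by one, in the order of
  quantification, always substituting a constant for the current variable. In the first block \<open>UVAL\<close> itself
  supplies the next bit of the only possible witness. In block \<open>j \<ge> 2\<close> the current variable is moved to
  the front as a one-bit first block, the blocks \<open>2, \<dots>, j - 1\<close> are dummies, and a dummy variable is added to
  block \<open>j\<close>. If exactly one value of the bit makes the rest of the game true, it is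
  the unique witness, so that \<open>UVAL\<close> reveals it. Substituting the answer (\<open>j\<close> odd, existential block) or its
  negation (\<open>j\<close> even, universal block) then preserves the truth value of the game; if both values
  agree, any choice does. What is left is a formula \<open>f\<close> without
  variables, and \<open>b \<longleftrightarrow> f\<close> has a unique witness \<open>b\<close>, the answer. All queries arise from the encoding of the
  current instance by finite-state transductions, so no formula ever has to be parsed into a tree.

  Both procedures have to run as subroutines of an arbitrary oracle machine on one tape. They are
  written in a small language of commands on stacks, which is compiled to single-tape machines.
\<close>

section \<open>Bounded inevitability\<close>

text \<open>The first block needs its own treatment because no place is free in front of it: a
  level-\<open>n\<close> query has exactly \<open>n\<close> blocks, and a bit that is moved to the
  front fills a block alone. Once the blocks before block \<open>j\<close> are eliminated, one of
  their places takes the bit, and the others keep block \<open>j\<close> at position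
  \<open>j\<close>, so that it is quantified as before. In the first block the promise does this
  work: if there is a witness, it is the only one and the reply is its next bit; if there is none,
  no substitution creates one. From the second block on, the plain truth value suffices as
  invariant. The dummy variable fills the place of the moved bit. It keeps block \<open>j\<close>
  nonempty, as a valid instance demands, and leaves its size in the header unchanged. An oracle may
  contradict itself on equal queries. A subroutine therefore has to return only some element of the
  oracle's value: this is a reply that the oracle could have given, so that each simulated run is a
  genuine one. Its time bound must cover all words, since the simulated machine may also ask words
  that encode nothing.\<close>

text \<open>\<open>AF R n P c\<close>: every path from \<open>c\<close> meets \<open>P\<close> within \<open>n\<close> steps and does not get stuck before.\<close>

fun AF :: "('c \<Rightarrow> 'c \<Rightarrow> bool) \<Rightarrow> nat \<Rightarrow> ('c \<Rightarrow> bool) \<Rightarrow> 'c \<Rightarrow> bool" where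
  "AF R 0 P c = P c"
| "AF R (Suc n) P c = (P c \<or> (\<exists>c'. R c c') \<and> (\<forall>c'. R c c' \<longrightarrow> AF R n P c'))"

lemma AF_now: "P c \<Longrightarrow> AF R n P c"
  by (cases n) auto

lemma AF_mono: "AF R n P c \<Longrightarrow> n \<le> m \<Longrightarrow> (\<And>c. P c \<Longrightarrow> Q c) \<Longrightarrow> AF R m Q c"
proof (induction n arbitrary: m c)
  case 0
  then show ?case by (simp add: AF_now)
next
  case (Suc n)
  then obtain m' where [simp]: "m = Suc m'" by (cases m) auto
  show ?case using Suc by auto
qed

lemma AF_step: "R c c' \<Longrightarrow> (\<And>c'. R c c' \<Longrightarrow> AF R n P c') \<Longrightarrow> AF R (Suc n) P c"
  by auto

text \<open>Targets are dead ends, as halting configurations are. Otherwise a path could run on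
  beyond its target, and \<open>n\<close> would not bound its length.\<close>

lemma AF_paths:
  assumes "AF R n P c" and "\<And>c. P c \<Longrightarrow> \<not> (\<exists>c'. R c c')" and "(R ^^ k) c c'"
  shows "k \<le> n" and "\<not> (\<exists>c''. R c' c'') \<Longrightarrow> P c'"
proof -
  have "k \<le> n \<and> (\<not> (\<exists>c''. R c' c'') \<longrightarrow> P c')"
    using assms(1,3)
  proof (induction n arbitrary: k c)
    case 0
    then have "\<not> (\<exists>c'. R c c')" using assms(2) by simp
    then have "k = 0"
      using 0(2) by (cases k) (blast elim: relpowp_Suc_E2)+
    with 0 show ?case by simp
  next
    case (Suc n)
    show ?case
    proof (cases k)
      case 0
      then show ?thesis using Suc.prems by auto
    next
      case (Suc k')
      with Suc.prems obtain d where d: "R c d" "(R ^^ k') d c'"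
        by (meson relpowp_Suc_E2)
      then have "AF R n P d" using Suc.prems(1) assms(2) by auto
      from Suc.IH[OF this d(2)] show ?thesis using Suc by simp
    qed
  qed
  then show "k \<le> n" "\<not> (\<exists>c''. R c' c'') \<Longrightarrow> P c'" by auto
qed

text \<open>Induction on the bound: with bound 0 no step is possible, so the start is itself a dead
  end and satisfies \<open>P\<close>. This brings the path conditions of a given reduction into the
  form \<open>AF\<close>.\<close>

lemma AF_if_bounded:
  assumes "\<And>k c. (R ^^ k) c0 c \<Longrightarrow> k \<le> n"
    and "\<And>k c. (R ^^ k) c0 c \<Longrightarrow> \<not> (\<exists>c'. R c c') \<Longrightarrow> P c"
  shows "AF R n P c0"
  using assms
proof (induction n arbitrary: c0)
  case 0
  have "\<not> (\<exists>c'. R c0 c')"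
    using 0(1)[of 1] by auto
  then show ?case using 0(2)[of 0] by simp
next
  case (Suc n)
  show ?case
  proof (cases "\<exists>c'. R c0 c'")
    case True
    have "AF R n P c'" if "R c0 c'" for c'
    proof (rule Suc.IH)
      fix k c assume "(R ^^ k) c' c"
      then have p: "(R ^^ Suc k) c0 c" using that by (metis relpowp_Suc_I2)
      show "k \<le> n" using Suc.prems(1)[OF p] by simp
      show "\<not> (\<exists>c'. R c c') \<Longrightarrow> P c" using Suc.prems(2)[OF p] by simp
    qed
    then show ?thesis using True by auto
  next
    case False
    then show ?thesis using Suc.prems(2)[of 0 c0] by simp
  qed
qed

declare AF.simps [simp del]

section \<open>A command language on stacks\<close>

text \<open>
  A configuration is a list of commands still to be executed, together with the stacks. \<open>Pop\<close> of an
  empty stack yields 0, and \<open>While r f\<close> pops \<open>r\<close> and stops at 0. Stack 0 holds bits only and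
  is the query string of \<open>Ask\<close>.
\<close>

datatype com = Skip | Halt bool | Seq com com | Push nat nat | Pop nat "nat \<Rightarrow> com"
  | While nat "nat \<Rightarrow> com" | Ask "bool \<Rightarrow> com"

type_synonym store = "nat \<Rightarrow> nat list"

definition hd0 :: "nat list \<Rightarrow> nat" where
  "hd0 xs = (case xs of [] \<Rightarrow> 0 | a # _ \<Rightarrow> a)"

lemma hd0_simps [simp]: "hd0 [] = 0" "hd0 (a # xs) = a"
  by (simp_all add: hd0_def)

inductive cstep :: "(bool list \<Rightarrow> bool set) \<Rightarrow> com list \<times> store \<Rightarrow> com list \<times> store \<Rightarrow> bool"
  for \<phi> where
  "cstep \<phi> (Skip # k, s) (k, s)"
| "cstep \<phi> (Seq a b # k, s) (a # b # k, s)"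
| "cstep \<phi> (Push r a # k, s) (k, s(r := a # s r))"
| "cstep \<phi> (Pop r f # k, s) (f (hd0 (s r)) # k, s(r := tl (s r)))"
| "hd0 (s r) = 0 \<Longrightarrow> cstep \<phi> (While r f # k, s) (k, s(r := tl (s r)))"
| "hd0 (s r) \<noteq> 0 \<Longrightarrow>
     cstep \<phi> (While r f # k, s) (f (hd0 (s r)) # While r f # k, s(r := tl (s r)))"
| "b \<in> \<phi> (map (\<lambda>a. a = 2) (s 0)) \<Longrightarrow> cstep \<phi> (Ask f # k, s) (f b # k, s)"

primrec wfc :: "nat \<Rightarrow> nat \<Rightarrow> com \<Rightarrow> bool" where
  "wfc K A Skip = True"
| "wfc K A (Halt b) = True"
| "wfc K A (Seq c d) = (wfc K A c \<and> wfc K A d)"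
| "wfc K A (Push r a) = (r < K \<and> a < A \<and> (r = 0 \<longrightarrow> a \<in> {1, 2}))"
| "wfc K A (Pop r f) = (r < K \<and> (\<forall>a<A. wfc K A (f a)))"
| "wfc K A (While r f) = (r < K \<and> (\<forall>a<A. wfc K A (f a)))"
| "wfc K A (Ask f) = (\<forall>b. wfc K A (f b))"

text \<open>
  The continuations that occur in a run of \<open>c\<close> followed by \<open>k\<close>. They become the control states of
  the compiled machine, hence their finiteness matters.
\<close>

primrec conts :: "nat \<Rightarrow> com \<Rightarrow> com list \<Rightarrow> com list set" where
  "conts A Skip k = {Skip # k}"
| "conts A (Halt b) k = {Halt b # k}"
| "conts A (Seq c d) k = insert (Seq c d # k) (conts A c (d # k) \<union> conts A d k)"
| "conts A (Push r a) k = {Push r a # k}"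
| "conts A (Pop r f) k = insert (Pop r f # k) (\<Union>a<A. conts A (f a) k)"
| "conts A (While r f) k = insert (While r f # k) (\<Union>a<A. conts A (f a) (While r f # k))"
| "conts A (Ask f) k = insert (Ask f # k) (\<Union>b. conts A (f b) k)"

lemma finite_conts: "finite (conts A c k)"
  by (induction c arbitrary: k) auto

lemma self_conts: "c # k \<in> conts A c k"
  by (cases c) auto

lemma wfc_conts:
  "wfc K A c \<Longrightarrow> \<forall>d\<in>set k. wfc K A d \<Longrightarrow> k' \<in> conts A c k \<Longrightarrow> \<forall>d\<in>set k'. wfc K A d"
proof (induction c arbitrary: k)
  case (Seq c1 c2)
  from Seq.prems(3) consider "k' = Seq c1 c2 # k" | "k' \<in> conts A c1 (c2 # k)" | "k' \<in> conts A c2 k"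
    by auto
  then show ?case
  proof cases
    case 2
    show ?thesis by (rule Seq.IH(1)[OF _ _ 2]) (use Seq.prems in auto)
  next
    case 3
    show ?thesis by (rule Seq.IH(2)[OF _ _ 3]) (use Seq.prems in auto)
  qed (use Seq.prems in auto)
next
  case (Pop r f)
  from Pop.prems(3) consider "k' = Pop r f # k" | b where "b < A" "k' \<in> conts A (f b) k" by auto
  then show ?case
  proof cases
    case 2
    show ?thesis by (rule Pop.IH[OF rangeI _ _ 2(2)]) (use Pop.prems 2 in auto)
  qed (use Pop.prems in auto)
next
  case (While r f)
  from While.prems(3) consider "k' = While r f # k"
    | b where "b < A" "k' \<in> conts A (f b) (While r f # k)" by auto
  then show ?case
  proof cases
    case 2
    show ?thesis by (rule While.IH[OF rangeI _ _ 2(2)]) (use While.prems 2 in auto)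
  qed (use While.prems in auto)
next
  case (Ask f)
  from Ask.prems(3) consider "k' = Ask f # k" | b where "k' \<in> conts A (f b) k" by auto
  then show ?case
  proof cases
    case 2
    show ?thesis by (rule Ask.IH[OF rangeI _ _ 2]) (use Ask.prems in auto)
  qed (use Ask.prems in auto)
qed auto

text \<open>The answer to a query arrives as the bit symbol 2 or 1, so that queries and pops share
  one argument. For a push the compiled machine passes 0.\<close>

fun nx :: "com list \<Rightarrow> nat \<Rightarrow> com list" where
  "nx (Skip # k) a = k"
| "nx (Seq c d # k) a = c # d # k"
| "nx (Push r b # k) a = k"
| "nx (Pop r f # k) a = f a # k"
| "nx (While r f # k) a = (if a = 0 then k else f a # While r f # k)"
| "nx (Ask f # k) a = f (a = 2) # k"
| "nx k a = []"

text \<open>A finite set can be closed because a loop is never unrolled: its body runs in front of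
  \<open>While r f # k\<close>, and the end of the body leads back to this member of the set. The
  list \<open>k\<close> is the regular exit, and \<open>Halt\<close> leads to the empty
  list.\<close>

lemma nx_conts: "k' \<in> conts A c k \<Longrightarrow> a < A \<Longrightarrow> nx k' a \<in> conts A c k \<union> {k, []}"
proof (induction c arbitrary: k)
  case (Seq c1 c2)
  from Seq.prems(1) consider "k' = Seq c1 c2 # k" | "k' \<in> conts A c1 (c2 # k)" | "k' \<in> conts A c2 k"
    by auto
  then show ?case
  proof cases
    case 1
    then show ?thesis by (simp add: self_conts)
  next
    case 2
    from Seq.IH(1)[OF this Seq.prems(2)] show ?thesis by (auto simp: self_conts)
  next
    case 3
    from Seq.IH(2)[OF this Seq.prems(2)] show ?thesis by auto
  qed
next
  case (Pop r f)
  from Pop.prems(1) consider "k' = Pop r f # k" | b where "b < A" "k' \<in> conts A (f b) k" by auto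
  then show ?case
  proof cases
    case 1
    then show ?thesis using Pop.prems(2) self_conts[of "f a" k A] by auto
  next
    case 2
    from Pop.IH[OF rangeI 2(2) Pop.prems(2)] 2(1) show ?thesis by auto
  qed
next
  case (While r f)
  then consider "k' = While r f # k" | b where "b < A" "k' \<in> conts A (f b) (While r f # k)" by auto
  then show ?case
  proof cases
    case 1
    then show ?thesis using While.prems(2) self_conts[of "f a" "While r f # k" A] by auto
  next
    case 2
    from While.IH[OF rangeI 2(2) While.prems(2)] 2(1) show ?thesis by auto
  qed
next
  case (Ask f)
  from Ask.prems(1) consider "k' = Ask f # k" | b where "k' \<in> conts A (f b) k" by auto
  then show ?case
  proof cases
    case 1
    then show ?thesis using self_conts[of "f (a = 2)" k A] by auto
  next
    case 2
    from Ask.IH[OF rangeI 2 Ask.prems(2)] show ?thesis by auto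
  qed
qed auto

text \<open>Oracle machines reserve the states 0 to 5 and the symbols 0 to 2, so the numbering of a
  finite set must put given elements first.\<close>

lemma indexing_exists:
  assumes "finite S" "distinct xs" "set xs \<subseteq> S"
  obtains e :: "'a \<Rightarrow> nat" where "bij_betw e S {..<card S}" "\<And>i. i < length xs \<Longrightarrow> e (xs ! i) = i"
proof -
  obtain ys where ys: "set ys = S - set xs" "distinct ys"
    using finite_distinct_list[OF finite_Diff[OF assms(1)]] by blast
  define zs where "zs = xs @ ys"
  have zs: "distinct zs" "set zs = S" using ys assms(2,3) by (auto simp: zs_def)
  have len: "length zs = card S" using distinct_card[OF zs(1)] zs(2) by simp
  have b: "bij_betw ((!) zs) {..<card S} S"
    by (rule bij_betw_nth[OF zs(1)]) (simp_all add: zs(2) len)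
  define e where "e = the_inv_into {..<card S} ((!) zs)"
  have "e (xs ! i) = i" if "i < length xs" for i
  proof -
    have "xs ! i = zs ! i" using that by (simp add: zs_def nth_append)
    moreover have "i \<in> {..<card S}" using that by (simp add: len[symmetric] zs_def)
    ultimately show ?thesis
      using b unfolding e_def bij_betw_def by (simp only: the_inv_into_f_f)
  qed
  moreover have "bij_betw e S {..<card S}"
    unfolding e_def by (rule bij_betw_the_inv_into[OF b])
  ultimately show thesis using that by blast
qed

section \<open>Compilation to single-tape machines\<close>

text \<open>
  Stack 0 lies to the left of the origin in raw bits, with its top leftmost, so that it is a query string for
  a head standing on its top. The other stacks are tracks of the cells from the origin to the right, with their bottoms at
  the origin; a track entry is 0 if unused and \<open>Suc a\<close> for the symbol \<open>a\<close>. As all queries share one state, the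
  continuation of a query is stored in the second component of the cell at the origin. The input is already in the layout of stack 0 once the
  origin is placed behind it.
\<close>

datatype sym = Raw nat | Cell "nat list" "com list option"

datatype phase = At | PushW | PopW | Take | BackR | QPush | QPop | QTake | BackL | QAsk

datatype st = Init | Halted bool | Query | Answer bool | Run phase "com list"

fun reg :: "com list \<Rightarrow> nat" where
  "reg (Push r a # k) = r"
| "reg (Pop r f # k) = r"
| "reg (While r f # k) = r"
| "reg k = 0"

fun pushed :: "com list \<Rightarrow> nat" where
  "pushed (Push r a # k) = a"
| "pushed k = 1"

fun tr_at :: "com list \<Rightarrow> sym \<Rightarrow> st \<times> sym \<times> int" where
  "tr_at (Skip # k) x = (Run At k, x, 0)"
| "tr_at (Seq c d # k) x = (Run At (c # d # k), x, 0)"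
| "tr_at (Halt b # k) x = (Halted b, x, 0)"
| "tr_at (Push r a # k) x =
     (if r = 0 then (Run QPush (Push r a # k), x, -1) else (Run PushW (Push r a # k), x, 0))"
| "tr_at (Pop r f # k) x =
     (if r = 0 then (Run QPop (Pop r f # k), x, -1) else (Run PopW (Pop r f # k), x, 0))"
| "tr_at (While r f # k) x =
     (if r = 0 then (Run QPop (While r f # k), x, -1) else (Run PopW (While r f # k), x, 0))"
| "tr_at (Ask f # k) (Cell v h) = (Run QAsk (Ask f # k), Cell v (Some (Ask f # k)), -1)"
| "tr_at k x = (Halted False, x, 0)"

text \<open>Between commands the head rests on the origin. \<open>PushW\<close> and
  \<open>PopW\<close> seek the first free entry of a track; if \<open>PushW\<close> meets a raw
  symbol, it is beyond the last cell and creates a new one. \<open>Take\<close> and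
  \<open>QTake\<close> read the top, and a symbol of the other kind tells them that the stack is
  empty. \<open>BackR\<close> and \<open>BackL\<close> return to the origin from the right and from
  the left. The \<open>min 2\<close> keeps the written symbol in the alphabet for every
  continuation, as closure of the transition table requires.\<close>

fun tr_run :: "nat \<Rightarrow> phase \<Rightarrow> com list \<Rightarrow> sym \<Rightarrow> st \<times> sym \<times> int" where
  "tr_run K At k x = tr_at k x"
| "tr_run K PushW k (Raw b) =
     (Run BackR (nx k 0), Cell ((replicate K 0)[reg k := Suc (pushed k)]) None, -1)"
| "tr_run K PushW k (Cell v h) =
     (if v ! reg k \<noteq> 0 then (Run PushW k, Cell v h, 1)
      else (Run BackR (nx k 0), Cell (v[reg k := Suc (pushed k)]) h, -1))"
| "tr_run K PopW k (Raw b) = (Run Take k, Raw b, -1)"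
| "tr_run K PopW k (Cell v h) =
     (if v ! reg k \<noteq> 0 then (Run PopW k, Cell v h, 1) else (Run Take k, Cell v h, -1))"
| "tr_run K Take k (Raw b) = (Run At (nx k 0), Raw b, 1)"
| "tr_run K Take k (Cell v h) = (Run BackR (nx k (v ! reg k - 1)), Cell (v[reg k := 0]) h, -1)"
| "tr_run K BackR k (Raw b) = (Run At k, Raw b, 1)"
| "tr_run K BackR k (Cell v h) = (Run BackR k, Cell v h, -1)"
| "tr_run K QPush k (Raw b) =
     (if b \<noteq> 0 then (Run QPush k, Raw b, -1) else (Run BackL (nx k 0), Raw (min 2 (pushed k)), 1))"
| "tr_run K QPop k (Raw b) =
     (if b \<noteq> 0 then (Run QPop k, Raw b, -1) else (Run QTake k, Raw b, 1))"
| "tr_run K QTake k (Raw b) = (Run BackL (nx k b), Raw 0, 1)"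
| "tr_run K QTake k (Cell v h) = (Run At (nx k 0), Cell v h, 0)"
| "tr_run K BackL k (Raw b) = (Run BackL k, Raw b, 1)"
| "tr_run K BackL k (Cell v h) = (Run At k, Cell v h, 0)"
| "tr_run K QAsk k (Raw b) =
     (if b \<noteq> 0 then (Run QAsk k, Raw b, -1) else (Query, Raw b, 1))"
| "tr_run K ph k x = (Halted False, x, 0)"

fun tr_st :: "nat \<Rightarrow> com \<Rightarrow> st \<Rightarrow> sym \<Rightarrow> st \<times> sym \<times> int" where
  "tr_st K C Init (Raw b) =
     (if b = 0 then (Run At [C], Cell (replicate K 0) None, 0) else (Init, Raw b, 1))"
| "tr_st K C (Answer b) (Raw a) = (Answer b, Raw a, 1)"
| "tr_st K C (Answer b) (Cell v (Some k)) = (Run At (nx k (if b then 2 else 1)), Cell v None, 0)"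
| "tr_st K C (Run ph k) x = tr_run K ph k x"
| "tr_st K C q x = (Halted False, x, 0)"

definition kset :: "nat \<Rightarrow> com \<Rightarrow> com list set" where
  "kset A C = insert [] (conts A C [])"

definition sts :: "nat \<Rightarrow> com \<Rightarrow> st set" where
  "sts A C = {Init, Halted False, Halted True, Query, Answer False, Answer True} \<union>
     (\<lambda>(ph, k). Run ph k) ` (UNIV \<times> kset A C)"

definition syms :: "nat \<Rightarrow> nat \<Rightarrow> com \<Rightarrow> sym set" where
  "syms K A C = Raw ` {0, 1, 2} \<union>
     (\<lambda>(v, h). Cell v h) ` ({v. set v \<subseteq> {..A} \<and> length v = K} \<times> insert None (Some ` kset A C))"

lemma UNIV_phase: "UNIV = {At, PushW, PopW, Take, BackR, QPush, QPop, QTake, BackL, QAsk}"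
  by (auto intro: phase.exhaust)

lemma finite_kset: "finite (kset A C)"
  by (simp add: kset_def finite_conts)

lemma finite_sts: "finite (sts A C)"
proof -
  have "finite (UNIV :: phase set)" unfolding UNIV_phase by simp
  then show ?thesis by (simp add: sts_def finite_kset)
qed

lemma finite_syms: "finite (syms K A C)"
  using finite_lists_length_eq[of "{..A}" K] by (simp add: syms_def finite_kset)

lemma Run_sts [simp]: "Run ph k \<in> sts A C \<longleftrightarrow> k \<in> kset A C"
  by (auto simp: sts_def)

lemma base_sts [simp]: "Init \<in> sts A C" "Halted b \<in> sts A C" "Query \<in> sts A C" "Answer b \<in> sts A C"
  by (cases b; auto simp: sts_def)+

lemma Raw_syms [simp]: "Raw b \<in> syms K A C \<longleftrightarrow> b \<le> 2"
  by (auto simp: syms_def)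

lemma Cell_syms [simp]: "Cell v h \<in> syms K A C \<longleftrightarrow> set v \<subseteq> {..A} \<and> length v = K \<and>
  (\<forall>k. h = Some k \<longrightarrow> k \<in> kset A C)"
  by (cases h) (auto simp: syms_def)

locale compile =
  fixes K A :: nat and C :: com and e :: "st \<Rightarrow> nat" and se :: "sym \<Rightarrow> nat"
  assumes KA: "0 < K" "3 \<le> A" and wfC: "wfc K A C"
    and e: "bij_betw e (sts A C) {..<card (sts A C)}" "e Init = 0" "e (Halted False) = 1"
      "e (Halted True) = 2" "e Query = 3" "e (Answer False) = 4" "e (Answer True) = 5"
    and se: "bij_betw se (syms K A C) {..<card (syms K A C)}" "se (Raw 0) = 0" "se (Raw 1) = 1"
      "se (Raw 2) = 2"
begin

definition machine :: otm where
  "machine = \<lparr>nst = card (sts A C), nsym = card (syms K A C),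
     tr = (\<lambda>q x. case tr_st K C (inv_into (sts A C) e q) (inv_into (syms K A C) se x) of
        (q', w, m) \<Rightarrow> (e q', se w, m))\<rparr>"

lemma nx_kset: "k \<in> kset A C \<Longrightarrow> a < A \<Longrightarrow> nx k a \<in> kset A C"
  using nx_conts[of k A C "[]" a] by (auto simp: kset_def)

lemma wfc_kset: "k \<in> kset A C \<Longrightarrow> c \<in> set k \<Longrightarrow> wfc K A c"
  using wfc_conts[OF wfC, of "[]" k] by (auto simp: kset_def)

lemma reg_less: "k \<in> kset A C \<Longrightarrow> reg k < K"
  using wfc_kset[of k "hd k"] KA by (cases k rule: reg.cases) auto

lemma pushed_less: "k \<in> kset A C \<Longrightarrow> pushed k < A"
  using wfc_kset[of k "hd k"] KA by (cases k rule: pushed.cases) auto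

lemma tr_at_closed:
  assumes "k \<in> kset A C" "x \<in> syms K A C"
  shows "tr_at k x \<in> sts A C \<times> syms K A C \<times> {-1, 0, 1}"
  using nx_kset[OF assms(1), of 0] KA assms by (cases "(k, x)" rule: tr_at.cases) auto

lemma update_bounded: "set v \<subseteq> {..A} \<Longrightarrow> a \<le> A \<Longrightarrow> set (v[r := a]) \<subseteq> {..A}"
  using set_update_subset_insert[of v r a] by auto

lemma tr_run_closed:
  assumes "k \<in> kset A C" "x \<in> syms K A C"
  shows "tr_run K ph k x \<in> sts A C \<times> syms K A C \<times> {-1, 0, 1}"
proof -
  have 0: "nx k 0 \<in> kset A C" using nx_kset[OF assms(1)] KA by simp
  have r: "reg k < K" "Suc (pushed k) \<le> A" using reg_less pushed_less assms(1) by (auto simp: Suc_leI)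
  have u: "set ((replicate K 0)[reg k := Suc (pushed k)]) \<subseteq> {..A}"
    by (rule update_bounded) (use r in auto)
  show ?thesis
  proof (cases x)
    case (Raw b)
    have "nx k b \<in> kset A C" using nx_kset[OF assms(1)] KA assms(2) Raw by simp
    then show ?thesis
      using assms Raw 0 r(1) u KA tr_at_closed[OF assms] by (cases ph) simp_all
  next
    case (Cell v h)
    then have v: "set v \<subseteq> {..A}" "length v = K" using assms(2) by auto
    then have "v ! reg k \<le> A" using r nth_mem[of "reg k" v] by (auto simp del: nth_mem)
    then have "nx k (v ! reg k - 1) \<in> kset A C" by (intro nx_kset[OF assms(1)]) (use KA in auto)
    moreover have "set (v[reg k := Suc (pushed k)]) \<subseteq> {..A}" "set (v[reg k := 0]) \<subseteq> {..A}"
      using update_bounded[OF v(1)] r(2) by blast+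
    ultimately show ?thesis
      using assms Cell v 0 tr_at_closed[OF assms] by (cases ph) simp_all
  qed
qed

lemma tr_st_closed:
  assumes "q \<in> sts A C" "x \<in> syms K A C"
  shows "tr_st K C q x \<in> sts A C \<times> syms K A C \<times> {-1, 0, 1}"
proof (cases "(K, C, q, x)" rule: tr_st.cases)
  case (1 K C b)
  then show ?thesis using assms self_conts[of C "[]" A] by (auto simp: kset_def)
next
  case (3 K C b v k)
  then show ?thesis using assms KA nx_kset by auto
next
  case (4 K C ph k x)
  then show ?thesis using assms tr_run_closed by auto
qed (use assms in auto)

lemma e_inv: "q \<in> sts A C \<Longrightarrow> inv_into (sts A C) e (e q) = q"
  using e(1) by (simp add: bij_betw_def)

lemma se_inv: "x \<in> syms K A C \<Longrightarrow> inv_into (syms K A C) se (se x) = x"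
  using se(1) by (simp add: bij_betw_def)

lemma wf_machine: "wf_otm machine"
proof -
  have "5 < card (sts A C)" using e(7) bij_betwE[OF e(1)] base_sts(4)[of True A C] by (metis lessThan_iff)
  moreover have "2 < card (syms K A C)" using se(4) bij_betwE[OF se(1)] Raw_syms[of 2 K A C] by (metis lessThan_iff order_refl)
  moreover have "case tr machine q x of (q', w, d) \<Rightarrow> q' < nst machine \<and> w < nsym machine \<and> d \<in> {-1, 0, 1}"
    if "q < nst machine" "x < nsym machine" for q x
  proof -
    define q0 x0 where "q0 = inv_into (sts A C) e q" and "x0 = inv_into (syms K A C) se x"
    have "q0 \<in> sts A C" using that e(1) unfolding q0_def machine_def bij_betw_def
      by (metis inv_into_into lessThan_iff otm.select_convs(1))
    moreover have "x0 \<in> syms K A C" using that se(1) unfolding x0_def machine_def bij_betw_def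
      by (metis inv_into_into lessThan_iff otm.select_convs(2))
    ultimately have "tr_st K C q0 x0 \<in> sts A C \<times> syms K A C \<times> {-1, 0, 1}" by (rule tr_st_closed)
    then show ?thesis using bij_betwE[OF e(1)] bij_betwE[OF se(1)]
      by (auto simp: machine_def q0_def[symmetric] x0_def[symmetric] split: prod.splits)
  qed
  ultimately show ?thesis by (simp add: wf_otm_def machine_def)
qed

definition cfg :: "st \<Rightarrow> (int \<Rightarrow> sym) \<Rightarrow> int \<Rightarrow> config" where
  "cfg q t p = (e q, \<lambda>z. se (t z), p)"

lemma e_eq: "q \<in> sts A C \<Longrightarrow> q' \<in> sts A C \<Longrightarrow> e q = e q' \<longleftrightarrow> q = q'"
  using e(1) by (auto simp: bij_betw_def inj_on_eq_iff)

lemma machine_step: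
  assumes "q \<in> sts A C" "q \<noteq> Query" "\<And>b. q \<noteq> Halted b" "t p \<in> syms K A C"
    and "tr_st K C q (t p) = (q', w, m)"
  shows "step \<phi> machine (cfg q t p) c \<longleftrightarrow> c = cfg q' (t(p := w)) (p + m)"
proof -
  have n: "e q \<notin> {1, 2, 3}"
    using e_eq[OF assms(1)] assms(2,3) e(3-5) base_sts by (metis empty_iff insert_iff)
  have T: "tr machine (e q) (se (t p)) = (e q', se w, m)"
    using assms by (simp add: machine_def e_inv se_inv)
  have u: "(\<lambda>z. se ((t(p := w)) z)) = (\<lambda>z. se (t z))(p := se w)" by auto
  show ?thesis
  proof
    assume "step \<phi> machine (cfg q t p) c"
    then show "c = cfg q' (t(p := w)) (p + m)"
      using n T by (cases rule: step.cases) (auto simp: cfg_def u)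
  next
    assume "c = cfg q' (t(p := w)) (p + m)"
    then show "step \<phi> machine (cfg q t p) c"
      using step.move[OF n, of machine "\<lambda>z. se (t z)" p] T by (simp add: cfg_def u del: fun_upd_apply)
  qed
qed

lemma AF_machine:
  assumes "q \<in> sts A C" "q \<noteq> Query" "\<And>b. q \<noteq> Halted b" "t p \<in> syms K A C"
    and "tr_st K C q (t p) = (q', w, m)"
    and "AF (step \<phi> machine) n P (cfg q' (t(p := w)) (p + m))"
  shows "AF (step \<phi> machine) (Suc n) P (cfg q t p)"
proof (rule AF_step)
  show "step \<phi> machine (cfg q t p) (cfg q' (t(p := w)) (p + m))"
    by (simp only: machine_step[of q t p, OF assms(1-5)])
  show "AF (step \<phi> machine) n P c'" if "step \<phi> machine (cfg q t p) c'" for c'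
    using that assms(6) by (simp only: machine_step[of q t p, OF assms(1-5)])
qed

text \<open>All seeking and returning phases are of this kind: a state that reproduces itself and
  the symbols it reads crosses a stretch of the tape.\<close>

lemma AF_walk:
  assumes "q \<in> sts A C" "q \<noteq> Query" "\<And>b. q \<noteq> Halted b"
    and "\<And>j. j < n \<Longrightarrow> t (p + d * int j) \<in> syms K A C \<and>
           tr_st K C q (t (p + d * int j)) = (q, t (p + d * int j), d)"
    and "AF (step \<phi> machine) m P (cfg q t (p + d * int n))"
  shows "AF (step \<phi> machine) (n + m) P (cfg q t p)"
  using assms(4,5)
proof (induction n arbitrary: p)
  case (Suc n)
  have 0: "t p \<in> syms K A C" "tr_st K C q (t p) = (q, t p, d)"
    using Suc.prems(1)[of 0] by auto
  have "AF (step \<phi> machine) (n + m) P (cfg q t (p + d))"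
  proof (rule Suc.IH)
    fix j assume "j < n"
    then show "t (p + d + d * int j) \<in> syms K A C \<and>
       tr_st K C q (t (p + d + d * int j)) = (q, t (p + d + d * int j), d)"
      using Suc.prems(1)[of "Suc j"] by (simp add: algebra_simps)
  next
    show "AF (step \<phi> machine) m P (cfg q t (p + d + d * int n))"
      using Suc.prems(2) by (simp add: algebra_simps)
  qed
  then show ?case using AF_machine[of q t p, OF assms(1-3) 0] by simp
qed simp

end

section \<open>The layout of the stacks on the tape\<close>

definition track_at :: "nat list \<Rightarrow> nat \<Rightarrow> nat" where
  "track_at xs i = (if i < length xs then Suc (rev xs ! i) else 0)"

definition raw_at :: "nat list \<Rightarrow> nat \<Rightarrow> nat" where
  "raw_at xs i = (if i < length xs then rev xs ! i else 0)"

lemma track_at_Nil [simp]: "track_at [] i = 0"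
  by (simp add: track_at_def)

lemma track_at_Cons: "track_at (a # xs) i = (if i = length xs then Suc a else track_at xs i)"
  by (auto simp: track_at_def nth_append)

lemma raw_at_Cons: "raw_at (a # xs) i = (if i = length xs then a else raw_at xs i)"
  by (auto simp: raw_at_def nth_append)

context compile
begin

definition cells :: "store \<Rightarrow> nat \<Rightarrow> nat list" where
  "cells s i = map (\<lambda>r. if r = 0 then 0 else track_at (s r) i) [0..<K]"

text \<open>Here \<open>x\<close> is the origin and \<open>N\<close> the number of cells created so
  far. Cells are never turned back into raw symbols, so \<open>N\<close> bounds the height of every
  track and may exceed it. The origin cell always exists (\<open>1 \<le> N\<close> in
  \<open>good\<close>): it marks the place to which the head returns.\<close>

definition tape :: "store \<Rightarrow> int \<Rightarrow> nat \<Rightarrow> int \<Rightarrow> sym" where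
  "tape s x N z =
     (if x \<le> z then if nat (z - x) < N then Cell (cells s (nat (z - x))) None else Raw 0
      else Raw (raw_at (s 0) (nat (x - 1 - z))))"

definition good :: "store \<Rightarrow> nat \<Rightarrow> bool" where
  "good s N \<longleftrightarrow> (\<forall>r<K. set (s r) \<subseteq> {..<A}) \<and> set (s 0) \<subseteq> {1, 2} \<and>
     (\<forall>r<K. r \<noteq> 0 \<longrightarrow> length (s r) \<le> N) \<and> 1 \<le> N"

lemma good_shorten:
  assumes "good s N" "set xs \<subseteq> set (s r)" "length xs \<le> length (s r)"
  shows "good (s(r := xs)) N"
  using assms unfolding good_def by (auto split: if_splits)

lemma tape_right: "tape s x N (x + int i) = (if i < N then Cell (cells s i) None else Raw 0)"
  by (simp add: tape_def)

lemma tape_left: "tape s x N (x - 1 - int i) = Raw (raw_at (s 0) i)"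
  by (simp add: tape_def)

lemma cells_nth: "r < K \<Longrightarrow> r \<noteq> 0 \<Longrightarrow> cells s i ! r = track_at (s r) i"
  by (simp add: cells_def)

lemma length_cells [simp]: "length (cells s i) = K"
  by (simp add: cells_def)

lemma raw_at_good: "good s N \<Longrightarrow> raw_at (s 0) i \<in> {0, 1, 2}"
  using nth_mem[of i "rev (s 0)"] by (auto simp: good_def raw_at_def simp del: nth_mem)

lemma track_at_good: "good s N \<Longrightarrow> r < K \<Longrightarrow> track_at (s r) i \<le> A"
  using nth_mem[of i "rev (s r)"]
  by (auto simp: good_def track_at_def Suc_le_eq simp del: nth_mem)

lemma cells_good: "good s N \<Longrightarrow> set (cells s i) \<subseteq> {..A}"
  using track_at_good by (auto simp: cells_def)

lemma raw_at_le: "good s N \<Longrightarrow> raw_at (s 0) i \<le> 2"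
  using raw_at_good[of s N i] by auto

lemma tape_syms: "good s N \<Longrightarrow> tape s x N z \<in> syms K A C"
  by (simp add: tape_def raw_at_le cells_good)

lemma cells_zero: "good s N \<Longrightarrow> N \<le> i \<Longrightarrow> cells s i = replicate K 0"
  by (rule nth_equalityI) (auto simp: good_def cells_def track_at_def)

lemma tape_upd_right:
  assumes "\<And>i. i \<noteq> j \<Longrightarrow> cells s' i = cells s i" "s' 0 = s 0" "j \<le> N"
  shows "(tape s x N)(x + int j := Cell (cells s' j) None) = tape s' x (max N (Suc j))"
proof
  fix z
  show "((tape s x N)(x + int j := Cell (cells s' j) None)) z = tape s' x (max N (Suc j)) z"
  proof (cases "x \<le> z")
    case True
    then obtain i where z: "z = x + int i" by (metis zle_iff_zadd)
    show ?thesis using assms(1)[of i] assms(3) by (auto simp: z tape_right)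
  qed (use assms(2) in \<open>auto simp: tape_def\<close>)
qed

lemma tape_upd_left:
  assumes "\<And>i. i \<noteq> j \<Longrightarrow> raw_at (s' 0) i = raw_at (s 0) i" "\<And>i. cells s' i = cells s i"
  shows "(tape s x N)(x - 1 - int j := Raw (raw_at (s' 0) j)) = tape s' x N"
proof
  fix z
  show "((tape s x N)(x - 1 - int j := Raw (raw_at (s' 0) j))) z = tape s' x N z"
  proof (cases "x \<le> z")
    case False
    define i where "i = nat (x - 1 - z)"
    have z: "z = x - 1 - int i" using False by (simp add: i_def)
    show ?thesis using assms(1)[of i] by (auto simp: z tape_left)
  qed (use assms(2) in \<open>auto simp: tape_def\<close>)
qed

lemma cells_upd:
  assumes "r < K" "r \<noteq> 0" "\<And>r'. r' \<noteq> r \<Longrightarrow> s' r' = s r'"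
  shows "cells s' i = (cells s i)[r := track_at (s' r) i]"
  by (rule nth_equalityI) (use assms in \<open>auto simp: cells_def nth_list_update\<close>)

section \<open>Execution of a single command on the tape\<close>

lemma AF_stay:
  assumes "q \<in> sts A C" "q \<noteq> Query" "\<And>b. q \<noteq> Halted b" "t p \<in> syms K A C"
    and "tr_st K C q (t p) = (q', t p, m)"
    and "AF (step \<phi> machine) n P (cfg q' t (p + m))"
  shows "AF (step \<phi> machine) (Suc n) P (cfg q t p)"
  using AF_machine[of q t p, OF assms(1-5)] assms(6) by simp

text \<open>The walk starts one place to the left of cell \<open>i\<close>. For \<open>i = 0\<close>
  the head is already on the raw symbol beside the origin, where the walk ends and one step to the
  right follows.\<close>

lemma back_right:
  assumes k: "k \<in> kset A C" and s: "good s N" and i: "i \<le> N"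
    and AF: "AF (step \<phi> machine) m P (cfg (Run At k) (tape s x N) x)"
  shows "AF (step \<phi> machine) (i + Suc m) P (cfg (Run BackR k) (tape s x N) (x + int i - 1))"
proof (rule AF_walk[where d = "-1"])
  fix j assume "j < i"
  then have e: "x + int i - 1 + - 1 * int j = x + int (i - 1 - j)" by simp
  have "i - 1 - j < N" using i \<open>j < i\<close> by simp
  then show "tape s x N (x + int i - 1 + - 1 * int j) \<in> syms K A C \<and>
    tr_st K C (Run BackR k) (tape s x N (x + int i - 1 + - 1 * int j)) =
      (Run BackR k, tape s x N (x + int i - 1 + - 1 * int j), - 1)"
    unfolding e using cells_good[OF s] by (simp add: tape_right)
next
  have e: "x + int i - 1 + - 1 * int i = x - 1 - int 0" by simp
  show "AF (step \<phi> machine) (Suc m) P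
     (cfg (Run BackR k) (tape s x N) (x + int i - 1 + - 1 * int i))"
    unfolding e
    by (rule AF_stay[where q' = "Run At k" and m = 1])
      (use k AF tape_left[of s x N 0] raw_at_le[OF s] in simp_all)
qed (use k in simp_all)

lemma back_left:
  assumes k: "k \<in> kset A C" and s: "good s N"
    and AF: "AF (step \<phi> machine) m P (cfg (Run At k) (tape s x N) x)"
  shows "AF (step \<phi> machine) (i + Suc m) P (cfg (Run BackL k) (tape s x N) (x - int i))"
proof (rule AF_walk[where d = 1])
  fix j assume "j < i"
  then have e: "x - int i + 1 * int j = x - 1 - int (i - 1 - j)" by simp
  show "tape s x N (x - int i + 1 * int j) \<in> syms K A C \<and>
    tr_st K C (Run BackL k) (tape s x N (x - int i + 1 * int j)) =
      (Run BackL k, tape s x N (x - int i + 1 * int j), 1)"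
    unfolding e using raw_at_le[OF s] by (simp add: tape_left)
next
  have e: "x - int i + 1 * int i = x" by simp
  have c: "tape s x N x = Cell (cells s 0) None"
    using s tape_right[of s x N 0] by (simp add: good_def)
  show "AF (step \<phi> machine) (Suc m) P (cfg (Run BackL k) (tape s x N) (x - int i + 1 * int i))"
    unfolding e
    by (rule AF_stay[where q' = "Run At k" and m = 0])
      (use k AF tape_syms[OF s, of x x] c in simp_all)
qed (use k in simp_all)

lemma seek_right:
  assumes k: "k \<in> kset A C" and s: "good s N" and ph: "ph \<in> {PushW, PopW}" and r: "reg k \<noteq> 0"
    and AF: "AF (step \<phi> machine) m P
      (cfg (Run ph k) (tape s x N) (x + int (length (s (reg k)))))"
  shows "AF (step \<phi> machine) (length (s (reg k)) + m) P (cfg (Run ph k) (tape s x N) x)"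
proof (rule AF_walk[where d = 1])
  fix j assume j: "j < length (s (reg k))"
  have "length (s (reg k)) \<le> N" using s r reg_less[OF k] by (simp add: good_def)
  moreover have "cells s j ! reg k \<noteq> 0" using r reg_less[OF k] j by (simp add: cells_nth track_at_def)
  ultimately show "tape s x N (x + 1 * int j) \<in> syms K A C \<and>
    tr_st K C (Run ph k) (tape s x N (x + 1 * int j)) = (Run ph k, tape s x N (x + 1 * int j), 1)"
    using cells_good[OF s, of j] j ph by (auto simp: tape_right)
qed (use k AF in simp_all)

text \<open>Only the part of the tape left of the origin is prescribed, because during a query the
  origin cell differs from that of \<open>tape s x N\<close>.\<close>

lemma seek_left:
  assumes k: "k \<in> kset A C" and s: "good s N" and ph: "ph \<in> {QPush, QPop, QAsk}"
    and t: "\<And>z. z < x \<Longrightarrow> t z = tape s x N z"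
    and AF: "AF (step \<phi> machine) m P (cfg (Run ph k) t (x - 1 - int (length (s 0))))"
  shows "AF (step \<phi> machine) (length (s 0) + m) P (cfg (Run ph k) t (x - 1))"
proof (rule AF_walk[where d = "-1"])
  fix j assume j: "j < length (s 0)"
  have e: "x - 1 + - 1 * int j = x - 1 - int j" by simp
  have "raw_at (s 0) j \<in> {1, 2}"
    using s j nth_mem[of j "rev (s 0)"] by (auto simp: good_def raw_at_def simp del: nth_mem)
  then show "t (x - 1 + - 1 * int j) \<in> syms K A C \<and>
    tr_st K C (Run ph k) (t (x - 1 + - 1 * int j)) = (Run ph k, t (x - 1 + - 1 * int j), - 1)"
    unfolding e using ph t[of "x - 1 - int j"] by (auto simp: tape_left)
qed (use k AF in simp_all)

lemma sim_push_right:
  assumes k: "Push r a # k \<in> kset A C" and s: "good s N" and r: "r \<noteq> 0"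
    and AF: "AF (step \<phi> machine) m P
      (cfg (Run At k) (tape (s(r := a # s r)) x (max N (Suc (length (s r))))) x)"
  shows "AF (step \<phi> machine) (2 * length (s r) + 3 + m) P
      (cfg (Run At (Push r a # k)) (tape s x N) x)"
proof -
  let ?k = "Push r a # k" and ?l = "length (s r)" and ?s = "s(r := a # s r)"
  let ?N = "max N (Suc ?l)"
  have rK: "r < K" using reg_less[OF k] by simp
  have aA: "a < A" using pushed_less[OF k] by simp
  have l: "?l \<le> N" using s r rK by (simp add: good_def)
  have s': "good ?s ?N" using s rK r aA by (auto simp: good_def)
  have k': "k \<in> kset A C" using nx_kset[OF k, of 0] KA by simp
  have w: "(cells s ?l)[r := Suc a] = cells ?s ?l"
    using cells_upd[OF rK r, of ?s s ?l] by (simp add: track_at_Cons)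
  have o: "cells ?s i = cells s i" if "i \<noteq> ?l" for i
  proof -
    have "track_at (s r) i = cells s i ! r" using rK r by (simp add: cells_nth)
    then show ?thesis using cells_upd[OF rK r, of ?s s i] that by (simp add: track_at_Cons)
  qed
  have T: "(tape s x N)(x + int ?l := Cell (cells ?s ?l) None) = tape ?s x ?N"
    by (rule tape_upd_right) (use o r l in auto)
  have 3: "AF (step \<phi> machine) (?l + Suc m) P (cfg (Run BackR k) (tape ?s x ?N) (x + int ?l - 1))"
    by (rule back_right[OF k' s' _ AF]) simp
  have tr: "tr_st K C (Run PushW ?k) (tape s x N (x + int ?l)) =
      (Run BackR k, Cell (cells ?s ?l) None, - 1)"
    using cells_zero[OF s, of ?l] rK r
    by (auto simp: tape_right w[symmetric] cells_nth track_at_def)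
  have 2: "AF (step \<phi> machine) (Suc (?l + Suc m)) P (cfg (Run PushW ?k) (tape s x N) (x + int ?l))"
    by (rule AF_machine[of _ "tape s x N" "x + int ?l", OF _ _ _ tape_syms[OF s] tr]) (use k 3 T in simp_all)
  have 1: "AF (step \<phi> machine) (?l + (Suc (?l + Suc m))) P (cfg (Run PushW ?k) (tape s x N) x)"
    using seek_right[OF k s, of PushW, where m = "Suc (?l + Suc m)"] r 2 by simp
  have "AF (step \<phi> machine) (Suc (?l + (Suc (?l + Suc m)))) P (cfg (Run At ?k) (tape s x N) x)"
    by (rule AF_stay[where q' = "Run PushW ?k" and m = 0])
      (use k r 1 tape_syms[OF s] in simp_all)
  then show ?thesis by (rule AF_mono) auto
qed

text \<open>The assumption \<open>at\<close> stands in for the form of the command. It holds for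
  \<open>Pop\<close> and for \<open>While\<close>, and \<open>nx\<close> takes care of whether a
  loop ends.\<close>

lemma sim_pop_right:
  assumes k: "k \<in> kset A C" and s: "good s N" and r: "reg k = r" "r \<noteq> 0"
    and AF: "AF (step \<phi> machine) m P
      (cfg (Run At (nx k (hd0 (s r)))) (tape (s(r := tl (s r))) x N) x)"
    and at: "\<And>y. tr_at k y = (Run PopW k, y, 0)"
  shows "AF (step \<phi> machine) (2 * length (s r) + 4 + m) P (cfg (Run At k) (tape s x N) x)"
proof -
  let ?l = "length (s r)" and ?s = "s(r := tl (s r))"
  have rK: "r < K" using reg_less[OF k] r by simp
  have l: "?l \<le> N" using s r rK by (simp add: good_def)
  have 3: "AF (step \<phi> machine) (Suc (?l + m)) P (cfg (Run Take k) (tape s x N) (x + int ?l - 1))"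
  proof (cases "s r")
    \<comment> \<open>The search has stopped at the origin at once, so \<open>Take\<close> stands on
      the raw symbol to its left; the pop yields 0 and the tape stays as it is.\<close>
    case Nil
    have [simp]: "s(r := []) = s" using Nil by (simp add: fun_upd_idem)
    have t: "tape s x N (x - 1) = Raw (raw_at (s 0) 0)" using tape_left[of s x N 0] by simp
    have "nx k 0 \<in> kset A C" using nx_kset[OF k, of 0] KA by simp
    show ?thesis
      by (rule AF_stay[where q' = "Run At (nx k 0)" and m = 1])
        (use Nil k AF t raw_at_le[OF s] in simp_all)
  next
    case (Cons a xs)
    have s': "good ?s N" by (rule good_shorten[OF s]) (use Cons in auto)
    have aA: "a < A" using s rK Cons by (auto simp: good_def)
    have t: "tape s x N (x + int ?l - 1) = Cell (cells s (length xs)) None"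
      using tape_right[of s x N "length xs"] l Cons by simp
    have v: "cells s (length xs) ! r = Suc a"
      using rK r Cons by (simp add: cells_nth track_at_Cons)
    have w: "(cells s (length xs))[r := 0] = cells ?s (length xs)"
      using cells_upd[OF rK r(2), of ?s s "length xs"] Cons by (simp add: track_at_def)
    have o: "cells ?s i = cells s i" if "i \<noteq> length xs" for i
    proof -
      have "track_at (tl (s r)) i = cells s i ! r" using rK r that Cons by (simp add: cells_nth track_at_Cons)
      then show ?thesis using cells_upd[OF rK r(2), of ?s s i] by simp
    qed
    have "(tape s x N)(x + int (length xs) := Cell (cells ?s (length xs)) None) =
        tape ?s x (max N (Suc (length xs)))"
      by (rule tape_upd_right) (use o r l Cons in auto)
    then have T: "(tape s x N)(x + int ?l - 1 := Cell (cells ?s (length xs)) None) = tape ?s x N"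
      using l Cons by (simp add: max_def)
    have "nx k a \<in> kset A C" using nx_kset[OF k aA] .
    then have 4: "AF (step \<phi> machine) (length xs + Suc m) P
        (cfg (Run BackR (nx k a)) (tape ?s x N) (x + int (length xs) - 1))"
      by (rule back_right[OF _ s']) (use AF Cons l in simp_all)
    have "AF (step \<phi> machine) (Suc (length xs + Suc m)) P
        (cfg (Run Take k) (tape s x N) (x + int ?l - 1))"
      by (rule AF_machine[where q' = "Run BackR (nx k a)" and w = "Cell (cells ?s (length xs)) None"
            and m = "-1"])
        (use k t r v w T 4 Cons cells_good[OF s] in \<open>simp_all del: fun_upd_apply\<close>)
    then show ?thesis using Cons by simp
  qed
  have tr: "tr_st K C (Run PopW k) (tape s x N (x + int ?l)) =
      (Run Take k, tape s x N (x + int ?l), - 1)"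
    using rK r by (auto simp: tape_right cells_nth track_at_def)
  have 2: "AF (step \<phi> machine) (Suc (Suc (?l + m))) P (cfg (Run PopW k) (tape s x N) (x + int ?l))"
    by (rule AF_machine[of _ "tape s x N" "x + int ?l", OF _ _ _ tape_syms[OF s] tr]) (use k 3 in simp_all)
  have 1: "AF (step \<phi> machine) (?l + (Suc (Suc (?l + m)))) P (cfg (Run PopW k) (tape s x N) x)"
    using seek_right[OF k s, of PopW, where m = "Suc (Suc (?l + m))"] r 2 by simp
  have "AF (step \<phi> machine) (Suc (?l + (Suc (Suc (?l + m))))) P (cfg (Run At k) (tape s x N) x)"
    by (rule AF_stay[where q' = "Run PopW k" and m = 0])
      (use k at 1 tape_syms[OF s] in simp_all)
  then show ?thesis by (rule AF_mono) auto
qed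

lemma sim_push_left:
  assumes k: "Push 0 a # k \<in> kset A C" and s: "good s N"
    and AF: "AF (step \<phi> machine) m P (cfg (Run At k) (tape (s(0 := a # s 0)) x N) x)"
  shows "AF (step \<phi> machine) (2 * length (s 0) + 3 + m) P
      (cfg (Run At (Push 0 a # k)) (tape s x N) x)"
proof -
  let ?k = "Push 0 a # k" and ?l = "length (s 0)" and ?s = "s(0 := a # s 0)"
  have a: "a \<in> {1, 2}" using wfc_kset[OF k, of "Push 0 a"] by simp
  have s': "good ?s N" using s a KA by (auto simp: good_def)
  have k': "k \<in> kset A C" using nx_kset[OF k, of 0] KA by simp
  have c: "cells ?s i = cells s i" for i by (simp add: cells_def)
  have "(tape s x N)(x - 1 - int ?l := Raw (raw_at (?s 0) ?l)) = tape ?s x N"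
    by (rule tape_upd_left) (simp add: raw_at_Cons, rule c)
  moreover have "raw_at (?s 0) ?l = a" by (simp add: raw_at_Cons)
  ultimately have T: "(tape s x N)(x - 1 - int ?l := Raw a) = tape ?s x N" by (simp only:)
  have 3: "AF (step \<phi> machine) (?l + Suc m) P (cfg (Run BackL k) (tape ?s x N) (x - int ?l))"
    by (rule back_left[OF k' s' AF])
  have t: "tape s x N (x - 1 - int ?l) = Raw 0" by (simp add: tape_left raw_at_def)
  have 2: "AF (step \<phi> machine) (Suc (?l + Suc m)) P (cfg (Run QPush ?k) (tape s x N) (x - 1 - int ?l))"
    by (rule AF_machine[where q' = "Run BackL k" and w = "Raw a" and m = 1])
      (use k a 3 T t in \<open>auto simp del: fun_upd_apply\<close>)
  have 1: "AF (step \<phi> machine) (?l + (Suc (?l + Suc m))) P (cfg (Run QPush ?k) (tape s x N) (x - 1))"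
    using seek_left[OF k s, of QPush, OF _ refl 2] by simp
  have "AF (step \<phi> machine) (Suc (?l + (Suc (?l + Suc m)))) P (cfg (Run At ?k) (tape s x N) x)"
    by (rule AF_stay[where q' = "Run QPush ?k" and m = "-1"])
      (use k 1 tape_syms[OF s] in simp_all)
  then show ?thesis by (rule AF_mono) auto
qed

lemma sim_pop_left:
  assumes k: "k \<in> kset A C" and s: "good s N"
    and AF: "AF (step \<phi> machine) m P
      (cfg (Run At (nx k (hd0 (s 0)))) (tape (s(0 := tl (s 0))) x N) x)"
    and at: "\<And>y. tr_at k y = (Run QPop k, y, -1)"
  shows "AF (step \<phi> machine) (2 * length (s 0) + 3 + m) P (cfg (Run At k) (tape s x N) x)"
proof -
  let ?l = "length (s 0)" and ?s = "s(0 := tl (s 0))"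
  have 3: "AF (step \<phi> machine) (Suc (?l + m)) P (cfg (Run QTake k) (tape s x N) (x - int ?l))"
  proof (cases "s 0")
    case Nil
    have [simp]: "s(0 := []) = s" using Nil by (simp add: fun_upd_idem)
    have t: "tape s x N x = Cell (cells s 0) None"
      using s tape_right[of s x N 0] by (simp add: good_def)
    show ?thesis
      by (rule AF_stay[where q' = "Run At (nx k 0)" and m = 0])
        (use Nil k AF t cells_good[OF s] in simp_all)
  next
    case (Cons a xs)
    have s': "good ?s N" by (rule good_shorten[OF s]) (use Cons in auto)
    have a: "a \<in> {1, 2}" using s Cons by (auto simp: good_def)
    have p: "x - int ?l = x - 1 - int (length xs)" using Cons by simp
    have t: "tape s x N (x - 1 - int (length xs)) = Raw a"
      using Cons by (simp add: tape_left raw_at_Cons)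
    have c: "cells ?s i = cells s i" for i by (simp add: cells_def)
    have "(tape s x N)(x - 1 - int (length xs) := Raw (raw_at (?s 0) (length xs))) = tape ?s x N"
      by (rule tape_upd_left) (simp add: raw_at_Cons Cons, rule c)
    moreover have "raw_at (?s 0) (length xs) = 0" using Cons by (simp add: raw_at_def)
    ultimately have T: "(tape s x N)(x - 1 - int (length xs) := Raw 0) = tape ?s x N" by (simp only:)
    have "nx k a \<in> kset A C" using nx_kset[OF k, of a] a KA by auto
    then have 4: "AF (step \<phi> machine) (length xs + Suc m) P
        (cfg (Run BackL (nx k a)) (tape ?s x N) (x - int (length xs)))"
      by (rule back_left[OF _ s']) (use AF Cons in simp_all)
    have "AF (step \<phi> machine) (Suc (length xs + Suc m)) P
        (cfg (Run QTake k) (tape s x N) (x - 1 - int (length xs)))"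
      by (rule AF_machine[where q' = "Run BackL (nx k a)" and w = "Raw 0" and m = 1])
        (use k a t T 4 in \<open>auto simp del: fun_upd_apply\<close>)
    then show ?thesis unfolding p using Cons by simp
  qed
  have t: "tape s x N (x - 1 - int ?l) = Raw 0" by (simp add: tape_left raw_at_def)
  have 2: "AF (step \<phi> machine) (Suc (Suc (?l + m))) P (cfg (Run QPop k) (tape s x N) (x - 1 - int ?l))"
    by (rule AF_stay[where q' = "Run QTake k" and m = 1])
      (use k 3 t in simp_all)
  have 1: "AF (step \<phi> machine) (?l + (Suc (Suc (?l + m)))) P (cfg (Run QPop k) (tape s x N) (x - 1))"
    using seek_left[OF k s, of QPop, OF _ refl 2] by simp
  have "AF (step \<phi> machine) (Suc (?l + (Suc (Suc (?l + m))))) P (cfg (Run At k) (tape s x N) x)"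
    by (rule AF_stay[where q' = "Run QPop k" and m = "-1"])
      (use k at 1 tape_syms[OF s] in simp_all)
  then show ?thesis by (rule AF_mono) auto
qed

lemma se_iff: "u \<in> syms K A C \<Longrightarrow> v \<in> syms K A C \<Longrightarrow> se u = se v \<longleftrightarrow> u = v"
  using se(1) by (auto simp: bij_betw_def inj_on_eq_iff)

lemma se_Raw: "b \<in> {0, 1, 2} \<Longrightarrow> se (Raw b) = b"
  using se by auto

lemma se_Cell: "Cell v h \<in> syms K A C \<Longrightarrow> se (Cell v h) \<notin> {1, 2}"
  using se_iff[of "Cell v h" "Raw 1"] se_iff[of "Cell v h" "Raw 2"] se(3,4) by auto

text \<open>From its top on, stack 0 is a run of bit symbols, and the run ends exactly at the origin
  because no cell has the code 1 or 2.\<close>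

lemma query_string_tape:
  assumes s: "good s N" and t: "\<And>z. z < x \<Longrightarrow> t z = tape s x N z"
    and c: "t x = Cell v h" "t x \<in> syms K A C"
  shows "query_string (\<lambda>z. se (t z)) (x - int (length (s 0))) = map (\<lambda>a. a = 2) (s 0)"
proof -
  let ?l = "length (s 0)"
  have i: "se (t (x - int ?l + int i)) = s 0 ! i" "s 0 ! i \<in> {1, 2}" if "i < ?l" for i
  proof -
    show 12: "s 0 ! i \<in> {1, 2}" using s nth_mem[OF that] by (auto simp: good_def simp del: nth_mem)
    have "t (x - int ?l + int i) = tape s x N (x - 1 - int (?l - 1 - i))"
      using t[of "x - int ?l + int i"] that by (simp add: algebra_simps)
    moreover have "raw_at (s 0) (?l - 1 - i) = s 0 ! i" using that by (simp add: raw_at_def rev_nth)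
    ultimately have "t (x - int ?l + int i) = Raw (s 0 ! i)"
      by (simp only: tape_left)
    then show "se (t (x - int ?l + int i)) = s 0 ! i" using 12 se_Raw by auto
  qed
  have "(LEAST k. se (t (x - int ?l + int k)) \<notin> {1, 2}) = ?l"
  proof (rule Least_equality)
    show "se (t (x - int ?l + int ?l)) \<notin> {1, 2}" using c se_Cell[of v h] by simp
    show "?l \<le> k" if "se (t (x - int ?l + int k)) \<notin> {1, 2}" for k
      using i[of k] that by (metis not_le_imp_less)
  qed
  then show ?thesis
    unfolding query_string_def by (intro nth_equalityI) (use i in auto)
qed

lemma query_step:
  "step \<phi> machine (cfg Query t p) c \<longleftrightarrow>
     (\<exists>b\<in>\<phi> (query_string (\<lambda>z. se (t z)) p). c = cfg (Answer b) t p)"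
proof
  assume "step \<phi> machine (cfg Query t p) c"
  then show "\<exists>b\<in>\<phi> (query_string (\<lambda>z. se (t z)) p). c = cfg (Answer b) t p"
    by (cases rule: step.cases) (use e in \<open>auto simp: cfg_def split: if_splits\<close>)
next
  assume "\<exists>b\<in>\<phi> (query_string (\<lambda>z. se (t z)) p). c = cfg (Answer b) t p"
  then obtain b where b: "b \<in> \<phi> (query_string (\<lambda>z. se (t z)) p)" "c = cfg (Answer b) t p" by blast
  from step.query[of b \<phi> "\<lambda>z. se (t z)" p machine, OF b(1)]
  show "step \<phi> machine (cfg Query t p) c"
    using b(2) e by (cases b) (simp_all add: cfg_def)
qed

lemma sim_ask:
  assumes k: "Ask f # k \<in> kset A C" and s: "good s N"
    and ne: "\<phi> (map (\<lambda>a. a = 2) (s 0)) \<noteq> {}"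
    and AF: "\<And>b. b \<in> \<phi> (map (\<lambda>a. a = 2) (s 0)) \<Longrightarrow>
      AF (step \<phi> machine) m P (cfg (Run At (f b # k)) (tape s x N) x)"
  shows "AF (step \<phi> machine) (2 * length (s 0) + 4 + m) P
      (cfg (Run At (Ask f # k)) (tape s x N) x)"
proof -
  let ?k = "Ask f # k" and ?l = "length (s 0)"
  \<comment> \<open>The tape during the call: the origin cell also remembers where to continue. The
    answer state erases this entry, which restores \<open>tape s x N\<close>.\<close>
  define t where "t = (tape s x N)(x := Cell (cells s 0) (Some ?k))"
  have c: "tape s x N x = Cell (cells s 0) None"
    using s tape_right[of s x N 0] by (simp add: good_def)
  have t1: "t z = tape s x N z" if "z < x" for z using that by (simp add: t_def)
  have t0: "t (x - 1 - int ?l) = Raw 0"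
    by (subst t1) (simp_all add: tape_left raw_at_def)
  have t2: "t x = Cell (cells s 0) (Some ?k)" by (simp add: t_def)
  have t3: "t x \<in> syms K A C" unfolding t2 using k cells_good[OF s] by simp
  have T: "t(x := Cell (cells s 0) None) = tape s x N"
    unfolding t_def by (simp only: fun_upd_upd fun_upd_idem[of "tape s x N" x, OF c])
  have 5: "AF (step \<phi> machine) (?l + Suc m) P (cfg (Answer b) t (x - int ?l))"
    if b: "b \<in> \<phi> (map (\<lambda>a. a = 2) (s 0))" for b
  proof (rule AF_walk[where d = 1])
    fix j assume "j < ?l"
    then have "t (x - int ?l + 1 * int j) = tape s x N (x - 1 - int (?l - 1 - j))"
      using t1[of "x - int ?l + 1 * int j"] by (simp add: algebra_simps)
    then have "t (x - int ?l + 1 * int j) = Raw (raw_at (s 0) (?l - 1 - j))" by (simp only: tape_left)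
    then show "t (x - int ?l + 1 * int j) \<in> syms K A C \<and>
      tr_st K C (Answer b) (t (x - int ?l + 1 * int j)) = (Answer b, t (x - int ?l + 1 * int j), 1)"
      using raw_at_le[OF s] by simp
  next
    have "AF (step \<phi> machine) (Suc m) P (cfg (Answer b) t x)"
      by (rule AF_machine[where q' = "Run At (f b # k)" and w = "Cell (cells s 0) None" and m = 0])
        (use t2 t3 AF[OF b] T in \<open>simp_all del: fun_upd_apply\<close>)
    then show "AF (step \<phi> machine) (Suc m) P (cfg (Answer b) t (x - int ?l + 1 * int ?l))" by simp
  qed simp_all
  have 4: "AF (step \<phi> machine) (Suc (?l + Suc m)) P (cfg Query t (x - int ?l))"
  proof -
    have q: "step \<phi> machine (cfg Query t (x - int ?l)) c \<longleftrightarrow>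
        (\<exists>b\<in>\<phi> (map (\<lambda>a. a = 2) (s 0)). c = cfg (Answer b) t (x - int ?l))" for c
      using query_step[of \<phi> t "x - int ?l"] query_string_tape[of s N x t, OF s t1 t2 t3]
      by (simp only:)
    obtain b where "b \<in> \<phi> (map (\<lambda>a. a = 2) (s 0))" using ne by blast
    show ?thesis
    proof (rule AF_step)
      show "step \<phi> machine (cfg Query t (x - int ?l)) (cfg (Answer b) t (x - int ?l))"
        unfolding q using \<open>b \<in> _\<close> by blast
      fix c' assume "step \<phi> machine (cfg Query t (x - int ?l)) c'"
      then show "AF (step \<phi> machine) (?l + Suc m) P c'" unfolding q using 5 by blast
    qed
  qed
  have 3: "AF (step \<phi> machine) (Suc (Suc (?l + Suc m))) P (cfg (Run QAsk ?k) t (x - 1 - int ?l))"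
    by (rule AF_stay[where q' = Query and m = 1])
      (use k 4 t0 in simp_all)
  have 2: "AF (step \<phi> machine) (?l + Suc (Suc (?l + Suc m))) P (cfg (Run QAsk ?k) t (x - 1))"
    by (rule seek_left[OF k s _ t1 3]) simp_all
  have tr: "tr_st K C (Run At ?k) (tape s x N x) =
      (Run QAsk ?k, Cell (cells s 0) (Some ?k), -1)" unfolding c by simp
  have "AF (step \<phi> machine) (Suc (?l + Suc (Suc (?l + Suc m)))) P (cfg (Run At ?k) (tape s x N) x)"
    by (rule AF_machine[of _ "tape s x N" x, OF _ _ _ tape_syms[OF s] tr])
      (use k 2 in \<open>simp_all add: t_def[symmetric] del: fun_upd_apply\<close>)
  then show ?thesis by (rule AF_mono) auto
qed

end

definition bit_sym :: "bool \<Rightarrow> nat" where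
  "bit_sym b = (if b then 2 else 1)"

definition input_store :: "bool list \<Rightarrow> store" where
  "input_store x = (\<lambda>_. [])(0 := map bit_sym x)"

context compile
begin

lemma good_push:
  assumes "good s N" "r < K" "a < A" "r = 0 \<Longrightarrow> a \<in> {1, 2}"
  shows "good (s(r := a # s r)) (if r = 0 then N else max N (Suc (length (s r))))"
  using assms by (auto simp: good_def)

lemma good_pop: "good s N \<Longrightarrow> good (s(r := tl (s r))) N"
  by (rule good_shorten) (cases "s r"; auto)+

lemma hd0_less: "good s N \<Longrightarrow> r < K \<Longrightarrow> hd0 (s r) < A"
  using KA by (cases "s r") (auto simp: good_def)

lemma AF_halt:
  assumes "Halt b # k \<in> kset A C" "good s N" "H b"
  shows "AF (step \<phi> machine) (Suc m)
    (\<lambda>c. fst c \<in> {1, 2} \<and> H (fst c = 2)) (cfg (Run At (Halt b # k)) (tape s x N) x)"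
proof (rule AF_stay[where q' = "Halted b" and m = 0])
  show "AF (step \<phi> machine) m (\<lambda>c. fst c \<in> {1, 2} \<and> H (fst c = 2))
      (cfg (Halted b) (tape s x N) (x + 0))"
    by (rule AF_now) (use e assms(3) in \<open>cases b; simp add: cfg_def\<close>)
qed (use assms tape_syms[OF assms(2)] in simp_all)

text \<open>The number \<open>z\<close> bounds how far the stacks reach to both sides of the origin
  together, and a command costs at most \<open>2 * z + 8\<close> machine steps, since the head goes
  to the end of a stack and back. The bound allows \<open>z\<close> to grow by 2 per command, hence
  \<open>z + 2 * n\<close>; the last 1 is the step into a halting state.\<close>

lemma AF_compile:
  assumes "AF (cstep \<phi>) n G (k, s)" and "k \<in> kset A C" and "good s N"
    and G: "\<And>c. G c \<Longrightarrow> \<exists>b k s. c = (Halt b # k, s) \<and> H b"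
    and "N + length (s 0) \<le> z"
  shows "AF (step \<phi> machine) (n * (2 * (z + 2 * n) + 8) + 1)
    (\<lambda>c. fst c \<in> {1, 2} \<and> H (fst c = 2)) (cfg (Run At k) (tape s x N) x)"
  using assms(1-3,5)
proof (induction n arbitrary: k s N z)
  case 0
    then obtain b k' where "k = Halt b # k'" "H b" using G[of "(k, s)"] by (auto simp: AF.simps)
    then show ?case using AF_halt[of b k' s N H \<phi> 0] 0 by simp
  next
    case (Suc n)
    let ?P = "\<lambda>c. fst c \<in> {1, 2} \<and> H (fst c = 2)"
    let ?B = "n * (2 * (z + 2 + 2 * n) + 8) + 1"
    have fin: "AF (step \<phi> machine) (Suc n * (2 * (z + 2 * Suc n) + 8) + 1) ?P
        (cfg (Run At k) (tape s x N) x)"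
      if "AF (step \<phi> machine) (m + ?B) ?P (cfg (Run At k) (tape s x N) x)" "m \<le> 2 * z + 8" for m
      by (rule AF_mono[OF that(1)]) (use that(2) in \<open>simp_all add: algebra_simps\<close>)
    show ?case
    proof (cases "G (k, s)")
      case True
      obtain b k' where "k = Halt b # k'" "H b" using G[OF True] by auto
      then show ?thesis
        using AF_halt[of b k' s N H \<phi> "Suc n * (2 * (z + 2 * Suc n) + 8)" x] Suc.prems(2,3)
        by (simp only: Suc_eq_plus1)
    next
      case False
      then have ex: "\<exists>c'. cstep \<phi> (k, s) c'" and all: "\<And>c'. cstep \<phi> (k, s) c' \<Longrightarrow> AF (cstep \<phi>) n G c'"
        using Suc.prems(1) by (auto simp: AF.simps)
      have IH: "AF (step \<phi> machine) ?B ?P (cfg (Run At k') (tape s' x N') x)"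
        if "cstep \<phi> (k, s) (k', s')" "k' \<in> kset A C" "good s' N'" "N' + length (s' 0) \<le> z + 2"
        for k' s' N'
        using Suc.IH[OF all[OF that(1)] that(2-4)] .
      have nx0: "nx k a \<in> kset A C" if "a < A" for a using nx_kset[OF Suc.prems(2) that] .
      have A0: "0 < A" using KA by simp
      have ts: "tape s x N x \<in> syms K A C" by (rule tape_syms[OF Suc.prems(3)])
      from ex obtain c' where "cstep \<phi> (k, s) c'" by blast
      then show ?thesis
      proof (cases rule: cstep.cases)
        case (1 k1)
        have "AF (step \<phi> machine) (1 + ?B) ?P (cfg (Run At k) (tape s x N) x)"
          unfolding plus_1_eq_Suc
          by (rule AF_stay[where q' = "Run At k1" and m = 0])
            (use 1 Suc.prems ts IH[of k1 s N] cstep.intros(1) nx0[OF A0] in auto)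
        then show ?thesis by (rule fin) simp
      next
        case (2 a b k1)
        have "AF (step \<phi> machine) (1 + ?B) ?P (cfg (Run At k) (tape s x N) x)"
          unfolding plus_1_eq_Suc
          by (rule AF_stay[where q' = "Run At (a # b # k1)" and m = 0])
            (use 2 Suc.prems ts IH[of "a # b # k1" s N] cstep.intros(2) nx0[OF A0] in auto)
        then show ?thesis by (rule fin) simp
      next
        case (3 r a k1)
        then have k: "k = Push r a # k1" by auto
        have wf: "r < K" "a < A" "r = 0 \<Longrightarrow> a \<in> {1, 2}"
          using wfc_kset[OF Suc.prems(2), of "Push r a"] k by auto
        let ?N = "if r = 0 then N else max N (Suc (length (s r)))"
        have lN: "r \<noteq> 0 \<Longrightarrow> length (s r) \<le> N" using Suc.prems(3) wf(1) by (auto simp: good_def)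
        have k1: "k1 \<in> kset A C" using nx0[OF A0] k by simp
        have ih: "AF (step \<phi> machine) ?B ?P (cfg (Run At k1) (tape (s(r := a # s r)) x ?N) x)"
          by (rule IH[OF _ k1 good_push[OF Suc.prems(3) wf]])
            (use k cstep.intros(3) Suc.prems(4) lN in \<open>auto\<close>)
        show ?thesis
        proof (cases "r = 0")
          case True
          have "AF (step \<phi> machine) (2 * length (s 0) + 3 + ?B) ?P (cfg (Run At k) (tape s x N) x)"
            unfolding k True
            by (rule sim_push_left) (use Suc.prems k True ih in simp_all)
          then show ?thesis by (rule fin) (use Suc.prems(4) in simp)
        next
          case False
          have "AF (step \<phi> machine) (2 * length (s r) + 3 + ?B) ?P (cfg (Run At k) (tape s x N) x)"
            unfolding k
            by (rule sim_push_right) (use Suc.prems k False ih in simp_all)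
          then show ?thesis by (rule fin) (use Suc.prems(4) lN False in simp)
        qed
      next
        case (7 b f k1)
        then have k: "k = Ask f # k1" by auto
        have f: "f b' # k1 \<in> kset A C" for b'
          using nx0[of "if b' then 2 else 1"] k KA by (cases b') simp_all
        have "AF (step \<phi> machine) (2 * length (s 0) + 4 + ?B) ?P (cfg (Run At k) (tape s x N) x)"
          unfolding k
        proof (rule sim_ask)
          fix b' assume "b' \<in> \<phi> (map (\<lambda>a. a = 2) (s 0))"
          then show "AF (step \<phi> machine) ?B ?P (cfg (Run At (f b' # k1)) (tape s x N) x)"
            using IH[OF _ f Suc.prems(3)] cstep.intros(7)[of b' \<phi> s f k1] k Suc.prems(4) by simp
        qed (use Suc.prems k 7 in auto)
        then show ?thesis by (rule fin) (use Suc.prems(4) in simp)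
      next
        case (4 r f k1)
        then have k: "k = Pop r f # k1" by auto
        have r: "reg k = r" "r < K" using reg_less[OF Suc.prems(2)] k by auto
        have n: "nx k (hd0 (s r)) \<in> kset A C" using nx0 hd0_less[OF Suc.prems(3) r(2)] .
        have ih: "AF (step \<phi> machine) ?B ?P
            (cfg (Run At (nx k (hd0 (s r)))) (tape (s(r := tl (s r))) x N) x)"
          by (rule IH[OF _ n good_pop[OF Suc.prems(3)]])
            (use k cstep.intros(4) Suc.prems(4) in auto)
        show ?thesis
        proof (cases "r = 0")
          case True
          have "AF (step \<phi> machine) (2 * length (s 0) + 3 + ?B) ?P (cfg (Run At k) (tape s x N) x)"
            by (rule sim_pop_left) (use Suc.prems k True ih in simp_all)
          then show ?thesis by (rule fin) (use Suc.prems(4) in simp)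
        next
          case False
          have "AF (step \<phi> machine) (2 * length (s r) + 4 + ?B) ?P (cfg (Run At k) (tape s x N) x)"
            by (rule sim_pop_right) (use Suc.prems k False ih in simp_all)
          then show ?thesis by (rule fin) (use Suc.prems(3,4) False r in \<open>auto simp: good_def\<close>)
        qed
      next
        case (5 r f k1)
        then have k: "k = While r f # k1" by auto
        have r: "reg k = r" "r < K" using reg_less[OF Suc.prems(2)] k by auto
        have n: "nx k (hd0 (s r)) \<in> kset A C" using nx0 hd0_less[OF Suc.prems(3) r(2)] .
        have ih: "AF (step \<phi> machine) ?B ?P
            (cfg (Run At (nx k (hd0 (s r)))) (tape (s(r := tl (s r))) x N) x)"
          by (rule IH[OF _ n good_pop[OF Suc.prems(3)]])
            (use k cstep.intros(5,6) Suc.prems(4) in auto)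
        show ?thesis
        proof (cases "r = 0")
          case True
          have "AF (step \<phi> machine) (2 * length (s 0) + 3 + ?B) ?P (cfg (Run At k) (tape s x N) x)"
            by (rule sim_pop_left) (use Suc.prems k True ih in simp_all)
          then show ?thesis by (rule fin) (use Suc.prems(4) in simp)
        next
          case False
          have "AF (step \<phi> machine) (2 * length (s r) + 4 + ?B) ?P (cfg (Run At k) (tape s x N) x)"
            by (rule sim_pop_right) (use Suc.prems k False ih in simp_all)
          then show ?thesis by (rule fin) (use Suc.prems(3,4) False r in \<open>auto simp: good_def\<close>)
        qed
      next
        case (6 r f k1)
        then have k: "k = While r f # k1" by auto
        have r: "reg k = r" "r < K" using reg_less[OF Suc.prems(2)] k by auto
        have n: "nx k (hd0 (s r)) \<in> kset A C" using nx0 hd0_less[OF Suc.prems(3) r(2)] .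
        have ih: "AF (step \<phi> machine) ?B ?P
            (cfg (Run At (nx k (hd0 (s r)))) (tape (s(r := tl (s r))) x N) x)"
          by (rule IH[OF _ n good_pop[OF Suc.prems(3)]])
            (use k cstep.intros(5,6) Suc.prems(4) in auto)
        show ?thesis
        proof (cases "r = 0")
          case True
          have "AF (step \<phi> machine) (2 * length (s 0) + 3 + ?B) ?P (cfg (Run At k) (tape s x N) x)"
            by (rule sim_pop_left) (use Suc.prems k True ih in simp_all)
          then show ?thesis by (rule fin) (use Suc.prems(4) in simp)
        next
          case False
          have "AF (step \<phi> machine) (2 * length (s r) + 4 + ?B) ?P (cfg (Run At k) (tape s x N) x)"
            by (rule sim_pop_right) (use Suc.prems k False ih in simp_all)
          then show ?thesis by (rule fin) (use Suc.prems(3,4) False r in \<open>auto simp: good_def\<close>)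
        qed
      qed
    qed
qed

lemma AF_init:
  assumes "AF (cstep \<phi>) n G ([C], input_store u)"
    and "\<And>c. G c \<Longrightarrow> \<exists>b k s. c = (Halt b # k, s) \<and> H b"
  shows "AF (step \<phi> machine) (length u + Suc (n * (2 * (length u + 1 + 2 * n) + 8) + 1))
    (\<lambda>c. fst c \<in> {1, 2} \<and> H (fst c = 2)) (init_config u)"
proof -
  let ?l = "length u" and ?P = "\<lambda>c. fst c \<in> {1, 2} \<and> H (fst c = (2 :: nat))"
  define t where "t = (\<lambda>i. if 0 \<le> i \<and> i < int ?l then Raw (bit_sym (u ! nat i)) else Raw 0)"
  have i: "init_config u = cfg Init t 0"
    using se e by (auto simp: init_config_def cfg_def t_def bit_sym_def)
  have g: "good (input_store u) 1" using KA by (auto simp: good_def input_store_def bit_sym_def)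
  have c: "cells (input_store u) i = replicate K 0" for i
    by (rule nth_equalityI) (auto simp: cells_def input_store_def)
  have T: "t(int ?l := Cell (replicate K 0) None) = tape (input_store u) (int ?l) 1"
  proof
    fix z
    show "(t(int ?l := Cell (replicate K 0) None)) z = tape (input_store u) (int ?l) 1 z"
    proof (cases "int ?l \<le> z")
      case True
      then show ?thesis using c by (auto simp: tape_def t_def)
    next
      case False
      show ?thesis
      proof (cases "0 \<le> z")
        case True
        have "rev (map bit_sym u) ! nat (int ?l - 1 - z) = bit_sym (u ! nat z)"
          using True False by (subst rev_nth) (auto simp: nat_diff_distrib intro!: arg_cong[of _ _ bit_sym] arg_cong[of _ _ "(!) u"])
        then show ?thesis using True False by (auto simp: tape_def t_def raw_at_def input_store_def)
      next
        case False
        then show ?thesis by (auto simp: tape_def t_def raw_at_def input_store_def)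
      qed
    qed
  qed
  have k: "[C] \<in> kset A C" by (simp add: kset_def self_conts)
  have 2: "AF (step \<phi> machine) (n * (2 * (?l + 1 + 2 * n) + 8) + 1) ?P
      (cfg (Run At [C]) (tape (input_store u) (int ?l) 1) (int ?l))"
    by (rule AF_compile[OF assms(1) k g assms(2)]) (simp_all add: input_store_def)
  have 1: "AF (step \<phi> machine) (Suc (n * (2 * (?l + 1 + 2 * n) + 8) + 1)) ?P (cfg Init t (int ?l))"
    by (rule AF_machine[where q' = "Run At [C]" and w = "Cell (replicate K 0) None" and m = 0])
      (use 2 T in \<open>simp_all add: t_def del: fun_upd_apply\<close>)
  show ?thesis unfolding i
    by (rule AF_walk[where d = 1]) (use 1 in \<open>auto simp: t_def bit_sym_def\<close>)
qed

end

theorem reduces_if_program: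
  fixes p :: "nat poly"
  assumes "wfc K A C" "0 < K" "3 \<le> A"
    and AF: "\<And>x. x \<noteq> [] \<Longrightarrow> AF (cstep \<phi>) (poly p (length x))
       (\<lambda>c. \<exists>b k s. c = (Halt b # k, s) \<and> b \<in> \<psi> x) ([C], input_store x)"
  shows "\<psi> \<propto>\<^sub>T \<phi>"
proof -
  let ?q = "[Init, Halted False, Halted True, Query, Answer False, Answer True]"
  obtain e where e: "bij_betw e (sts A C) {..<card (sts A C)}" "\<And>i. i < length ?q \<Longrightarrow> e (?q ! i) = i"
    using indexing_exists[OF finite_sts, of ?q A C] by auto
  let ?y = "[Raw 0, Raw 1, Raw 2]"
  obtain se where se: "bij_betw se (syms K A C) {..<card (syms K A C)}"
      "\<And>i. i < length ?y \<Longrightarrow> se (?y ! i) = i"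
    using indexing_exists[OF finite_syms, of ?y K A C] by auto
  interpret compile K A C e se
    by unfold_locales
      (use assms(1-3) e(1) e(2)[of 0] e(2)[of 1] e(2)[of 2] e(2)[of 3] e(2)[of 4] e(2)[of 5]
        se(1) se(2)[of 0] se(2)[of 1] se(2)[of 2] in simp_all)
  define X :: "nat poly" where "X = [:0, 1:]"
  \<comment> \<open>The time bound of \<open>AF_init\<close> as a polynomial in the input length
    \<open>X\<close>, with \<open>p\<close> for the number of commands: compilation squares the
    running time at most, up to constants and the input length.\<close>
  define P where "P = X + 2 + p * (2 * (X + 1 + 2 * p) + 8)"
  have P: "poly P l = l + Suc (poly p l * (2 * (l + 1 + 2 * poly p l) + 8) + 1)" for l
    by (simp add: P_def X_def)
  have "k \<le> poly P (length x)"
    "\<not> (\<exists>c'. step \<phi> machine c c') \<longrightarrow> fst c \<in> {1, 2} \<and> (fst c = 2) \<in> \<psi> x"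
    if x: "x \<noteq> []" and k: "(step \<phi> machine ^^ k) (init_config x) c" for x k c
  proof -
    let ?G = "\<lambda>c. fst c \<in> {1, 2} \<and> (fst c = (2 :: nat)) \<in> \<psi> x"
    have a: "AF (step \<phi> machine) (poly P (length x)) ?G (init_config x)"
      unfolding P by (rule AF_init[OF AF[OF x]]) blast
    \<comment> \<open>Halting states have no successor, so targets are dead ends as
      \<open>AF_paths\<close> requires.\<close>
    have s: "\<not> (\<exists>c'. step \<phi> machine c c')" if "?G c" for c
      using that by (auto elim!: step.cases)
    show "k \<le> poly P (length x)" using AF_paths(1)[OF a s k] .
    show "\<not> (\<exists>c'. step \<phi> machine c c') \<longrightarrow> ?G c" using AF_paths(2)[OF a s k] by blast
  qed
  then show ?thesis
    unfolding reduces_def using wf_machine by blast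
qed

section \<open>Total correctness with time bounds\<close>

text \<open>The triple is stated in continuation-passing style, so that it composes without a notion of final configuration.\<close>

definition ht ::
  "(bool list \<Rightarrow> bool set) \<Rightarrow> com \<Rightarrow> store \<Rightarrow> nat \<Rightarrow> (store \<Rightarrow> bool) \<Rightarrow> bool" where
  "ht \<phi> c s t P \<longleftrightarrow> (\<forall>k m Q. (\<forall>s'. P s' \<longrightarrow> AF (cstep \<phi>) m Q (k, s')) \<longrightarrow>
     AF (cstep \<phi>) (t + m) Q (c # k, s))"

lemma htD: "ht \<phi> c s t P \<Longrightarrow> (\<And>s'. P s' \<Longrightarrow> AF (cstep \<phi>) m Q (k, s')) \<Longrightarrow>
    AF (cstep \<phi>) (t + m) Q (c # k, s)"
  by (auto simp: ht_def)

lemma ht_mono: "ht \<phi> c s t P \<Longrightarrow> t \<le> t' \<Longrightarrow> (\<And>s. P s \<Longrightarrow> P' s) \<Longrightarrow> ht \<phi> c s t' P'"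
  unfolding ht_def
proof (intro allI impI)
  fix k m Q
  assume *: "\<forall>k m Q. (\<forall>s'. P s' \<longrightarrow> AF (cstep \<phi>) m Q (k, s')) \<longrightarrow> AF (cstep \<phi>) (t + m) Q (c # k, s)"
    and "t \<le> t'" and P: "\<And>s. P s \<Longrightarrow> P' s" and Q: "\<forall>s'. P' s' \<longrightarrow> AF (cstep \<phi>) m Q (k, s')"
  have "AF (cstep \<phi>) (t + m) Q (c # k, s)" using * P Q by blast
  then show "AF (cstep \<phi>) (t' + m) Q (c # k, s)" by (rule AF_mono) (use \<open>t \<le> t'\<close> in simp_all)
qed

inductive_cases cstep_elims: "cstep \<phi> (Skip # k, s) c" "cstep \<phi> (Halt b # k, s) c"
  "cstep \<phi> (Seq a b # k, s) c" "cstep \<phi> (Push r a # k, s) c" "cstep \<phi> (Pop r f # k, s) c"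
  "cstep \<phi> (While r f # k, s) c" "cstep \<phi> (Ask f # k, s) c"

lemma cstep_det:
  assumes "cstep \<phi> (C # k, s) c'" "\<And>f. C \<noteq> Ask f" "cstep \<phi> (C # k, s) c''"
  shows "c'' = c'"
  using assms by (cases C) (auto elim!: cstep_elims)

lemma AF_cstep:
  assumes "cstep \<phi> (C # k, s) c'" "\<And>f. C \<noteq> Ask f" "AF (cstep \<phi>) n P c'"
  shows "AF (cstep \<phi>) (Suc n) P (C # k, s)"
proof (rule AF_step[of "cstep \<phi>" _ c'])
  show "cstep \<phi> (C # k, s) c'" by (rule assms(1))
  fix c'' assume "cstep \<phi> (C # k, s) c''"
  then show "AF (cstep \<phi>) n P c''" using cstep_det[OF assms(1,2)] assms(3) by simp
qed

lemma ht_Skip: "0 < t \<Longrightarrow> P s \<Longrightarrow> ht \<phi> Skip s t P"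
  by (cases t; simp add: ht_def) (intro allI impI, rule AF_cstep, rule cstep.intros,
    auto elim!: AF_mono)

lemma ht_Push: "0 < t \<Longrightarrow> P (s(r := a # s r)) \<Longrightarrow> ht \<phi> (Push r a) s t P"
  by (cases t; simp add: ht_def) (intro allI impI, rule AF_cstep, rule cstep.intros,
    auto elim!: AF_mono)

lemma ht_Pop: "ht \<phi> (f (hd0 (s r))) (s(r := tl (s r))) t P \<Longrightarrow> ht \<phi> (Pop r f) s (Suc t) P"
  unfolding ht_def add_Suc
  by (intro allI impI, rule AF_cstep, rule cstep.intros) simp_all

lemma ht_Seq:
  assumes "ht \<phi> c s t Q" "\<And>s'. Q s' \<Longrightarrow> ht \<phi> d s' u P"
  shows "ht \<phi> (Seq c d) s (Suc (t + u)) P"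
  unfolding ht_def
proof (intro allI impI)
  fix k m R assume *: "\<forall>s'. P s' \<longrightarrow> AF (cstep \<phi>) m R (k, s')"
  have "AF (cstep \<phi>) (t + (u + m)) R (c # d # k, s)"
    by (rule htD[OF assms(1)]) (use htD[OF assms(2)] * in blast)
  then show "AF (cstep \<phi>) (Suc (t + u) + m) R (Seq c d # k, s)"
    using AF_cstep[OF cstep.intros(2)[of \<phi> c d k s], of "t + (u + m)" R] by (simp add: add.assoc)
qed

lemma ht_While_end:
  "0 < t \<Longrightarrow> hd0 (s r) = 0 \<Longrightarrow> P (s(r := tl (s r))) \<Longrightarrow> ht \<phi> (While r f) s t P"
  by (cases t; simp add: ht_def) (intro allI impI, rule AF_cstep, rule cstep.intros(5),
    auto elim!: AF_mono)

lemma AF_While_step: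
  assumes "hd0 (s r) \<noteq> 0"
    and "AF (cstep \<phi>) n Q (f (hd0 (s r)) # While r f # k, s(r := tl (s r)))"
  shows "AF (cstep \<phi>) (Suc n) Q (While r f # k, s)"
  by (rule AF_cstep, rule cstep.intros(6)) (use assms in simp_all)

lemma ht_While_step:
  assumes "hd0 (s r) \<noteq> 0" "ht \<phi> (f (hd0 (s r))) (s(r := tl (s r))) t Q"
    and "\<And>s'. Q s' \<Longrightarrow> ht \<phi> (While r f) s' u P"
  shows "ht \<phi> (While r f) s (Suc (t + u)) P"
  unfolding ht_def
proof (intro allI impI)
  fix k m R assume *: "\<forall>s'. P s' \<longrightarrow> AF (cstep \<phi>) m R (k, s')"
  have "AF (cstep \<phi>) (t + (u + m)) R (f (hd0 (s r)) # While r f # k, s(r := tl (s r)))"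
    by (rule htD[OF assms(2)]) (use htD[OF assms(3)] * in blast)
  then show "AF (cstep \<phi>) (Suc (t + u) + m) R (While r f # k, s)"
    using AF_While_step[of s r \<phi> "t + (u + m)" R f k] assms(1) by (simp add: add.assoc)
qed

lemma ht_Ask:
  assumes "\<phi> (map (\<lambda>a. a = 2) (s 0)) \<noteq> {}"
    and "\<And>b. b \<in> \<phi> (map (\<lambda>a. a = 2) (s 0)) \<Longrightarrow> ht \<phi> (f b) s t P"
  shows "ht \<phi> (Ask f) s (Suc t) P"
  unfolding ht_def
proof (intro allI impI)
  fix k m Q assume *: "\<forall>s'. P s' \<longrightarrow> AF (cstep \<phi>) m Q (k, s')"
  obtain b where b: "b \<in> \<phi> (map (\<lambda>a. a = 2) (s 0))" using assms(1) by blast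
  show "AF (cstep \<phi>) (Suc t + m) Q (Ask f # k, s)"
    unfolding add_Suc
  proof (rule AF_step)
    show "cstep \<phi> (Ask f # k, s) (f b # k, s)" using b by (rule cstep.intros)
    fix c' assume "cstep \<phi> (Ask f # k, s) c'"
    then obtain b' where "b' \<in> \<phi> (map (\<lambda>a. a = 2) (s 0))" "c' = (f b' # k, s)"
      by (auto elim!: cstep_elims)
    then show "AF (cstep \<phi>) (t + m) Q c'" using htD[OF assms(2)] * by blast
  qed
qed

lemma ht_Pop': "ht \<phi> (f (hd0 (s r))) (s(r := tl (s r))) t P \<Longrightarrow> t < t' \<Longrightarrow> ht \<phi> (Pop r f) s t' P"
  by (rule ht_mono[where P = P and t = "Suc t"], rule ht_Pop) simp_all

lemma ht_Seq':
  assumes "ht \<phi> c s t Q" "\<And>s'. Q s' \<Longrightarrow> ht \<phi> d s' u P" "t + u < t'"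
  shows "ht \<phi> (Seq c d) s t' P"
  by (rule ht_mono[where P = P and t = "Suc (t + u)"], rule ht_Seq[OF assms(1,2)]) (use assms(3) in simp_all)

lemma ht_While_step':
  assumes "hd0 (s r) \<noteq> 0" "ht \<phi> (f (hd0 (s r))) (s(r := tl (s r))) t Q"
    and "\<And>s'. Q s' \<Longrightarrow> ht \<phi> (While r f) s' u P" "t + u < t'"
  shows "ht \<phi> (While r f) s t' P"
  by (rule ht_mono[where P = P and t = "Suc (t + u)"], rule ht_While_step[of s r, OF assms(1-3)])
    (use assms(4) in simp_all)

lemma ht_Ask':
  assumes "\<phi> (map (\<lambda>a. a = 2) (s 0)) \<noteq> {}"
    and "\<And>b. b \<in> \<phi> (map (\<lambda>a. a = 2) (s 0)) \<Longrightarrow> ht \<phi> (f b) s t P" "t < t'"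
  shows "ht \<phi> (Ask f) s t' P"
  by (rule ht_mono[where P = P and t = "Suc t"], rule ht_Ask[of \<phi> s, OF assms(1,2)]) (use assms(3) in simp_all)

text \<open>Stores reached by updates in different orders are compared stack by stack.\<close>

lemma pointwise: "P s \<Longrightarrow> (\<And>r. s' r = s r) \<Longrightarrow> P s'" for s s' :: store
proof -
  assume "P s" "\<And>r. s' r = s r"
  then have "s' = s" by (intro ext)
  with \<open>P s\<close> show "P s'" by simp
qed

section \<open>Basic programs: pushing, moving and transducing words\<close>

fun pushes :: "nat \<Rightarrow> nat list \<Rightarrow> com" where
  "pushes r [] = Skip"
| "pushes r (a # as) = Seq (Push r a) (pushes r as)"

lemma ht_pushes: "P (s(r := rev as @ s r)) \<Longrightarrow> ht \<phi> (pushes r as) s (2 * length as + 1) P"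
proof (induction as arbitrary: s)
  case Nil
  then show ?case using ht_Skip[of 1 P s] by (simp add: fun_upd_idem)
next
  case (Cons a as)
  have "ht \<phi> (pushes r (a # as)) s (Suc (1 + (2 * length as + 1))) P"
    unfolding pushes.simps
  proof (rule ht_Seq[where Q = "\<lambda>s'. s' = s(r := a # s r)"])
    show "ht \<phi> (pushes r as) s' (2 * length as + 1) P" if s': "s' = s(r := a # s r)" for s'
      by (rule Cons.IH, rule pointwise[of P, OF Cons.prems]) (simp add: s')
  qed (simp add: ht_Push)
  then show ?case by simp
qed

lemma wfc_pushes:
  "wfc K A (pushes r as) \<longleftrightarrow> (\<forall>a\<in>set as. r < K \<and> a < A \<and> (r = 0 \<longrightarrow> a \<in> {1, 2}))"
  by (induction as) auto

text \<open>The word arrives reversed. The body has to be well-formed for every symbol, while stack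
  0 accepts bits only, whence the \<open>Skip\<close>. Bit symbols are nonzero, so on a bit word the
  loop stops exactly at the bottom.\<close>

definition move :: "nat \<Rightarrow> nat list \<Rightarrow> com" where
  "move r qs = While r (\<lambda>a. foldr (\<lambda>q c. Seq (if q = 0 \<and> a \<notin> {1, 2} then Skip else Push q a) c) qs Skip)"

lemma ht_move1:
  assumes "r \<noteq> q" "s r = map bit_sym x" "P (s(r := [], q := rev (map bit_sym x) @ s q))"
  shows "ht \<phi> (move r [q]) s (4 * length x + 1) P"
  using assms(2,3)
proof (induction x arbitrary: s)
  case Nil
  then show ?case unfolding move_def
    by (auto intro!: ht_While_end simp: fun_upd_idem fun_upd_twist)
next
  case (Cons b x)
  let ?f = "\<lambda>a. foldr (\<lambda>q c. Seq (if q = 0 \<and> a \<notin> {1, 2} then Skip else Push q a) c) [q] Skip"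
  have b: "bit_sym b \<in> {1, 2}" "bit_sym b \<noteq> 0" by (auto simp: bit_sym_def)
  have "ht \<phi> (While r ?f) s (Suc (3 + (4 * length x + 1))) P"
  proof (rule ht_While_step[where Q = "\<lambda>s'. s' = s(r := map bit_sym x, q := bit_sym b # s q)"])
    show "hd0 (s r) \<noteq> 0" using Cons.prems b by simp
    have "ht \<phi> (Seq (Push q (bit_sym b)) Skip) (s(r := map bit_sym x)) (Suc (1 + 1))
        (\<lambda>s'. s' = s(r := map bit_sym x, q := bit_sym b # s q))"
      by (rule ht_Seq[where Q = "\<lambda>s'. s' = s(r := map bit_sym x, q := bit_sym b # s q)"])
        (use assms(1) in \<open>auto intro!: ht_Push ht_Skip\<close>)
    then show "ht \<phi> (?f (hd0 (s r))) (s(r := tl (s r))) 3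
        (\<lambda>s'. s' = s(r := map bit_sym x, q := bit_sym b # s q))"
      using Cons.prems b by (simp add: numeral_3_eq_3)
    fix s' assume s': "s' = s(r := map bit_sym x, q := bit_sym b # s q)"
    show "ht \<phi> (While r ?f) s' (4 * length x + 1) P"
      unfolding move_def[symmetric]
      by (rule Cons.IH, use s' assms(1) in simp, rule pointwise[of P, OF Cons.prems(2)])
        (use s' assms(1) in simp)
  qed
  then show ?case unfolding move_def by (rule ht_mono) simp_all
qed

lemma ht_move2:
  assumes "distinct [r, q, q']" "s r = map bit_sym x"
    "P (s(r := [], q := rev (map bit_sym x) @ s q, q' := rev (map bit_sym x) @ s q'))"
  shows "ht \<phi> (move r [q, q']) s (6 * length x + 1) P"
  using assms(2,3)
proof (induction x arbitrary: s)
  case Nil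
  then show ?case unfolding move_def
    by (auto intro!: ht_While_end simp: fun_upd_idem fun_upd_twist)
next
  case (Cons b x)
  let ?f = "\<lambda>a. foldr (\<lambda>q c. Seq (if q = 0 \<and> a \<notin> {1, 2} then Skip else Push q a) c) [q, q'] Skip"
  let ?s = "s(r := map bit_sym x, q := bit_sym b # s q, q' := bit_sym b # s q')"
  have b: "bit_sym b \<in> {1, 2}" "bit_sym b \<noteq> 0" by (auto simp: bit_sym_def)
  have "ht \<phi> (While r ?f) s (Suc (5 + (6 * length x + 1))) P"
  proof (rule ht_While_step[where Q = "\<lambda>s'. s' = ?s"])
    show "hd0 (s r) \<noteq> 0" using Cons.prems b by simp
    have "ht \<phi> (Seq (Push q (bit_sym b)) (Seq (Push q' (bit_sym b)) Skip)) (s(r := map bit_sym x))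
        (Suc (1 + Suc (1 + 1))) (\<lambda>s'. s' = ?s)"
      by (rule ht_Seq[where Q = "\<lambda>s'. s' = s(r := map bit_sym x, q := bit_sym b # s q)"])
        (use assms(1) in \<open>auto intro!: ht_Seq[where Q = "\<lambda>s'. s' = ?s" and t = 1 and u = 1, simplified]
           ht_Push ht_Skip\<close>)
    then show "ht \<phi> (?f (hd0 (s r))) (s(r := tl (s r))) 5 (\<lambda>s'. s' = ?s)"
      using Cons.prems b by (simp add: numeral_eq_Suc)
    fix s' assume s': "s' = ?s"
    show "ht \<phi> (While r ?f) s' (6 * length x + 1) P"
      unfolding move_def[symmetric]
      by (rule Cons.IH, use s' assms(1) in simp, rule pointwise[of P, OF Cons.prems(2)])
        (use s' assms(1) in simp)
  qed
  then show ?case unfolding move_def by (rule ht_mono) simp_all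
qed

lemma wfc_move: "r < K \<Longrightarrow> \<forall>q\<in>set qs. q < K \<Longrightarrow> wfc K A (move r qs)"
proof -
  assume r: "r < K" and qs: "\<forall>q\<in>set qs. q < K"
  have "wfc K A (foldr (\<lambda>q c. Seq (if q = 0 \<and> a \<notin> {1, 2} then Skip else Push q a) c) qs Skip)"
    if "a < A" for a
    using qs that by (induction qs) auto
  then show ?thesis using r by (simp add: move_def)
qed

fun fst_run :: "(nat \<Rightarrow> bool \<Rightarrow> nat \<times> bool list) \<Rightarrow> nat \<Rightarrow> bool list \<Rightarrow> bool list" where
  "fst_run \<delta> q [] = []"
| "fst_run \<delta> q (b # x) = snd (\<delta> q b) @ fst_run \<delta> (fst (\<delta> q b)) x"

text \<open>Stack \<open>c\<close> holds the state, as a successor because 0 ends the loop. At the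
  end of the input no new state is pushed, and the empty stack \<open>c\<close> then stops the loop.
  The output arrives reversed on \<open>d\<close>.\<close>

definition transduce :: "(nat \<Rightarrow> bool \<Rightarrow> nat \<times> bool list) \<Rightarrow> nat \<Rightarrow> nat \<Rightarrow> nat \<Rightarrow> nat \<Rightarrow> com" where
  "transduce \<delta> q0 c r d = Seq (Push c (Suc q0)) (While c (\<lambda>q. Pop r (\<lambda>a. if a = 0 then Skip
     else Seq (pushes d (map bit_sym (snd (\<delta> (q - 1) (a = 2)))))
            (Push c (Suc (fst (\<delta> (q - 1) (a = 2))))))))"

lemma ht_transduce:
  assumes dist: "distinct [c, r, d]" and s: "s r = map bit_sym x" "s c = []"
    and B: "\<And>q b. length (snd (\<delta> q b)) \<le> B"
    and P: "P (s(r := [], d := rev (map bit_sym (fst_run \<delta> q0 x)) @ s d))"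
  shows "ht \<phi> (transduce \<delta> q0 c r d) s ((2 * B + 5) * length x + 6) P"
proof -
  let ?f = "\<lambda>q. Pop r (\<lambda>a. if a = 0 then Skip
     else Seq (pushes d (map bit_sym (snd (\<delta> (q - 1) (a = 2)))))
            (Push c (Suc (fst (\<delta> (q - 1) (a = 2))))))"
  have main: "ht \<phi> (While c ?f) s ((2 * B + 5) * length x + 4) P"
    if "s c = [Suc q]" "s r = map bit_sym x"
      "P (s(c := [], r := [], d := rev (map bit_sym (fst_run \<delta> q x)) @ s d))" for s q
    using that
  proof (induction x arbitrary: s q)
    case Nil
    have "ht \<phi> (While c ?f) s (Suc (2 + 1)) P"
    proof (rule ht_While_step[where Q = "\<lambda>s'. s' = s(c := [], r := [])"])
      have "ht \<phi> (?f (Suc q)) (s(c := [])) (Suc 1) (\<lambda>s'. s' = s(c := [], r := []))"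
        by (rule ht_Pop) (use Nil dist in \<open>auto intro!: ht_Skip\<close>)
      then show "ht \<phi> (?f (hd0 (s c))) (s(c := tl (s c))) 2 (\<lambda>s'. s' = s(c := [], r := []))"
        unfolding Nil(1) hd0_simps list.sel(3) by (simp only: numeral_2_eq_2 One_nat_def)
      fix s' assume "s' = s(c := [], r := [])"
      then show "ht \<phi> (While c ?f) s' 1 P"
        by (intro ht_While_end pointwise[of P, OF Nil(3)]) (use Nil dist in auto)
    qed (use Nil in simp)
    then show ?case by (rule ht_mono) simp_all
  next
    case (Cons b x)
    have b: "bit_sym b \<noteq> 0" "(bit_sym b = 2) = b" by (auto simp: bit_sym_def)
    obtain q' w where q': "\<delta> q b = (q', w)" by fastforce
    have w: "length w \<le> B" using B[of q b] q' by simp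
    let ?s = "s(c := [Suc q'], r := map bit_sym x, d := rev (map bit_sym w) @ s d)"
    have "ht \<phi> (While c ?f) s (Suc ((2 * B + 4) + ((2 * B + 5) * length x + 4))) P"
    proof (rule ht_While_step[where Q = "\<lambda>s'. s' = ?s"])
      have "ht \<phi> (?f (Suc q)) (s(c := [])) (Suc (Suc ((2 * length (map bit_sym w) + 1) + 1))) (\<lambda>s'. s' = ?s)"
      proof (rule ht_Pop)
        let ?s1 = "s(c := [], r := map bit_sym x, d := rev (map bit_sym w) @ s d)"
        have e: "(s(c := []))(r := tl ((s(c := [])) r)) = s(c := [], r := map bit_sym x)"
          using Cons.prems dist by simp
        have "ht \<phi> (Seq (pushes d (map bit_sym w)) (Push c (Suc q'))) (s(c := [], r := map bit_sym x))
            (Suc ((2 * length (map bit_sym w) + 1) + 1)) (\<lambda>s'. s' = ?s)"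
          by (rule ht_Seq[OF ht_pushes[where P = "\<lambda>s'. s' = ?s1"]])
            (use dist in \<open>auto intro!: ht_Push simp: fun_upd_twist\<close>)
        then show "ht \<phi> ((\<lambda>a. if a = 0 then Skip
            else Seq (pushes d (map bit_sym (snd (\<delta> (Suc q - 1) (a = 2)))))
            (Push c (Suc (fst (\<delta> (Suc q - 1) (a = 2)))))) (hd0 ((s(c := [])) r)))
          ((s(c := []))(r := tl ((s(c := [])) r))) (Suc ((2 * length (map bit_sym w) + 1) + 1))
          (\<lambda>s'. s' = ?s)"
          unfolding e using Cons.prems dist b q' by simp
      qed
      then have "ht \<phi> (?f (Suc q)) (s(c := [])) (2 * B + 4) (\<lambda>s'. s' = ?s)"
        by (rule ht_mono) (use w in simp_all)
      then show "ht \<phi> (?f (hd0 (s c))) (s(c := tl (s c))) (2 * B + 4) (\<lambda>s'. s' = ?s)"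
        unfolding Cons.prems(1) hd0_simps list.sel(3) .
      fix s' assume s': "s' = ?s"
      show "ht \<phi> (While c ?f) s' ((2 * B + 5) * length x + 4) P"
        by (rule Cons.IH[where q = q'], use s' dist in simp, use s' dist in simp,
            rule pointwise[of P, OF Cons.prems(3)]) (use s' dist q' in auto)
    qed (use Cons.prems in simp)
    then show ?case by (rule ht_mono) simp_all
  qed
  have "ht \<phi> (transduce \<delta> q0 c r d) s (Suc (1 + ((2 * B + 5) * length x + 4))) P"
    unfolding transduce_def
    by (rule ht_Seq[OF ht_Push[where P = "\<lambda>s'. s' = s(c := [Suc q0])"]])
      (use s P dist in \<open>auto intro!: main[where q = q0] simp: fun_upd_idem\<close>)
  then show ?thesis by (rule ht_mono) simp_all
qed

lemma wfc_transduce: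
  assumes "c < K" "r < K" "d < K" "c \<noteq> 0" "\<And>q b. Suc (fst (\<delta> q b)) < A" "Suc q0 < A" "3 \<le> A"
  shows "wfc K A (transduce \<delta> q0 c r d)"
  using assms by (auto simp: transduce_def wfc_pushes bit_sym_def)

section \<open>Simulating an oracle machine with a subroutine for its oracle\<close>

text \<open>
  Stacks \<open>rL\<close> and \<open>rR\<close> are the simulated tape to the left of the head and from the head on, \<open>rS\<close> holds the
  successor of the simulated state (0 would end the main loop), \<open>rX\<close> and \<open>rV\<close> are the input and output of
  the subroutine.
\<close>

abbreviation (input) "rL \<equiv> 2 :: nat"
abbreviation (input) "rR \<equiv> 3 :: nat"
abbreviation (input) "rS \<equiv> 4 :: nat"
abbreviation (input) "rX \<equiv> 5 :: nat"
abbreviation (input) "rA \<equiv> 6 :: nat"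
abbreviation (input) "rB \<equiv> 7 :: nat"
abbreviation (input) "rC \<equiv> 8 :: nat"
abbreviation (input) "rV \<equiv> 9 :: nat"

text \<open>The simulated machine must survive a call, and the next call needs clean stacks again;
  therefore the final store is prescribed exactly. Every element of the value is accepted as result,
  and every word as input.\<close>

definition computes :: "(bool list \<Rightarrow> bool set) \<Rightarrow> com \<Rightarrow> (bool list \<Rightarrow> bool set) \<Rightarrow> (nat \<Rightarrow> nat) \<Rightarrow> bool"
  where "computes \<phi> c \<psi> T \<longleftrightarrow> (\<forall>s x. s rX = map bit_sym x \<longrightarrow> (\<forall>r. r \<notin> {rL, rR, rS, rX} \<longrightarrow> s r = []) \<longrightarrow>
    ht \<phi> c s (T (length x)) (\<lambda>s'. \<exists>v\<in>\<psi> x. s' = s(rX := [], rV := [bit_sym v])))"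

lemma computesD: "computes \<phi> c \<psi> T \<Longrightarrow> s rX = map bit_sym x \<Longrightarrow>
    (\<And>r. r \<notin> {rL, rR, rS, rX} \<Longrightarrow> s r = []) \<Longrightarrow>
    ht \<phi> c s (T (length x)) (\<lambda>s'. \<exists>v\<in>\<psi> x. s' = s(rX := [], rV := [bit_sym v]))"
  unfolding computes_def by blast

definition is_bit :: "nat \<Rightarrow> bool" where
  "is_bit a \<longleftrightarrow> a = 1 \<or> a = 2"

definition nth0 :: "nat list \<Rightarrow> nat \<Rightarrow> nat" where
  "nth0 xs i = (if i < length xs then xs ! i else 0)"

text \<open>Stack \<open>rC\<close> is a flag that keeps the loop going. A symbol that is not a bit
  is put back; at the bottom of \<open>rR\<close> this leaves an explicit blank, the source of
  \<open>xs @ [0]\<close> in \<open>ht_grab_loop\<close>.\<close>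

definition grab_loop :: com where
  "grab_loop = While rC (\<lambda>_. Pop rR (\<lambda>a. if a = 1 \<or> a = 2 then Seq (Push rA a) (Push rC 1) else Push rR a))"

definition grab :: com where
  "grab = Seq (Push rC 1) (Seq grab_loop (move rA [rR, rX]))"

definition sim_move :: "nat \<Rightarrow> int \<Rightarrow> com" where
  "sim_move w d = (if d = 1 then Push rL w else if d = 0 then Push rR w
     else Seq (Push rR w) (Pop rL (\<lambda>b. Push rR b)))"

text \<open>Since \<open>s\<close> is the successor of the state, 2 and 3 are the halting states, 4
  is the query state, and 5 and 6 are the states after the answers 0 and 1. The stack alphabet may
  exceed the ranges of \<open>M\<close>, so the transition table is consulted only within them; this
  keeps the program well-formed.\<close>

definition sim_body :: "otm \<Rightarrow> com \<Rightarrow> nat \<Rightarrow> com" where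
  "sim_body M c s =
    (if s = 2 then Halt False else if s = 3 then Halt True
     else if s = 4 then Seq grab (Seq c (Pop rV (\<lambda>v. Push rS (if v = 2 then 6 else 5))))
     else Pop rR (\<lambda>a. if s - 1 < nst M \<and> a < nsym M
       then case tr M (s - 1) a of (q, w, d) \<Rightarrow> Seq (sim_move w d) (Push rS (Suc q)) else Skip))"

text \<open>A move reverses its word, so two moves bring the first input bit to the top of
  \<open>rR\<close>. The symbol 1 is the successor of the start state.\<close>

definition sim_prog :: "otm \<Rightarrow> com \<Rightarrow> com" where
  "sim_prog M c = Seq (move 0 [rA]) (Seq (move rA [rR]) (Seq (Push rS 1) (While rS (sim_body M c))))"

lemma nth0_Nil [simp]: "nth0 [] i = 0"
  by (simp add: nth0_def)

lemma nth0_Cons: "nth0 (a # xs) i = (case i of 0 \<Rightarrow> a | Suc j \<Rightarrow> nth0 xs j)"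
  by (simp add: nth0_def split: nat.split)

lemma nth0_top: "nth0 xs 0 = hd0 xs"
  by (cases xs) (simp_all add: nth0_Cons)

lemma nth0_tl: "nth0 (tl xs) i = nth0 xs (Suc i)"
  by (cases xs) (simp_all add: nth0_Cons)

lemma nth0_snoc0: "nth0 (xs @ [0]) i = nth0 xs i"
  by (auto simp: nth0_def nth_append)

lemma ht_grab_loop:
  assumes "s rC = [1]" "s rR = xs" "s rA = as"
    and P: "\<And>R. R \<in> {xs, xs @ [0]} \<Longrightarrow>
      P (s(rC := [], rR := drop (length (takeWhile is_bit xs)) R, rA := rev (takeWhile is_bit xs) @ as))"
  shows "ht \<phi> grab_loop s (5 * length xs + 5) P"
  using assms
proof (induction xs arbitrary: s as)
  case Nil
  show ?case
    unfolding grab_loop_def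
  proof (rule ht_While_step'[where Q = "\<lambda>s'. s' = s(rC := [], rR := [0])"])
    show "ht \<phi> (Pop rR (\<lambda>a. if a = 1 \<or> a = 2 then Seq (Push rA a) (Push rC 1) else Push rR a))
        (s(rC := tl (s rC))) 2 (\<lambda>s'. s' = s(rC := [], rR := [0]))"
      by (rule ht_Pop'[where t = 1]) (use Nil(1,2) in \<open>auto intro!: ht_Push\<close>)
    show "ht \<phi> (While rC (\<lambda>_. Pop rR (\<lambda>a. if a = 1 \<or> a = 2 then Seq (Push rA a) (Push rC 1) else Push rR a)))
        s' 1 P" if s': "s' = s(rC := [], rR := [0])" for s'
      by (intro ht_While_end pointwise[of P, OF Nil(4)[of "[0]"]]) (use s' Nil(1-3) in auto)
  qed (use Nil(1) in simp_all)
next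
  case (Cons a xs)
  show ?case
  proof (cases "is_bit a")
    case True
    let ?s = "s(rR := xs, rA := a # as)"
    show ?thesis
      unfolding grab_loop_def
    proof (rule ht_While_step'[where Q = "\<lambda>s'. s' = ?s"])
      have "ht \<phi> (Seq (Push rA a) (Push rC 1)) (s(rC := [], rR := xs)) 3 (\<lambda>s'. s' = ?s)"
        by (rule ht_Seq'[where t = 1 and u = 1 and Q = "\<lambda>s'. s' = s(rC := [], rR := xs, rA := a # as)"])
          (use Cons.prems(1-3) in \<open>auto intro!: ht_Push\<close>)
      then show "ht \<phi> (Pop rR (\<lambda>a. if a = 1 \<or> a = 2 then Seq (Push rA a) (Push rC 1) else Push rR a))
          (s(rC := tl (s rC))) 4 (\<lambda>s'. s' = ?s)"
        by (intro ht_Pop'[where t = 3]) (use Cons.prems(1-3) True in \<open>simp_all add: is_bit_def\<close>)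
      show "ht \<phi> (While rC (\<lambda>_. Pop rR (\<lambda>a. if a = 1 \<or> a = 2 then Seq (Push rA a) (Push rC 1) else Push rR a)))
          s' (5 * length xs + 5) P" if s': "s' = ?s" for s'
        unfolding grab_loop_def[symmetric]
      proof (rule Cons.IH[where as = "a # as"])
        fix R assume "R \<in> {xs, xs @ [0]}"
        then have R: "a # R \<in> {a # xs, (a # xs) @ [0]}" by auto
        show "P (s'(rC := [], rR := drop (length (takeWhile is_bit xs)) R,
            rA := rev (takeWhile is_bit xs) @ a # as))"
          by (rule pointwise[of P, OF Cons.prems(4)[OF R]]) (use True s' in auto)
      qed (use s' Cons.prems(1-3) in auto)
    qed (use Cons.prems(1-3) in simp_all)
  next
    case False
    show ?thesis
      unfolding grab_loop_def
    proof (rule ht_While_step'[where Q = "\<lambda>s'. s' = s(rC := [])"])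
      show "ht \<phi> (Pop rR (\<lambda>a. if a = 1 \<or> a = 2 then Seq (Push rA a) (Push rC 1) else Push rR a))
          (s(rC := tl (s rC))) 2 (\<lambda>s'. s' = s(rC := []))"
        by (rule ht_Pop'[where t = 1]) (use Cons.prems(1-3) False in \<open>auto intro!: ht_Push simp: is_bit_def\<close>)
      show "ht \<phi> (While rC (\<lambda>_. Pop rR (\<lambda>a. if a = 1 \<or> a = 2 then Seq (Push rA a) (Push rC 1) else Push rR a)))
          s' 1 P" if s': "s' = s(rC := [])" for s'
        by (intro ht_While_end pointwise[of P, OF Cons.prems(4)[of "a # xs"]])
          (use s' Cons.prems(1-3) False in auto)
    qed (use Cons.prems(1-3) in simp_all)
  qed
qed

lemma map_bit_eq: "\<forall>a\<in>set xs. is_bit a \<Longrightarrow> map bit_sym (map (\<lambda>a. a = 2) xs) = xs"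
  by (induction xs) (auto simp: is_bit_def bit_sym_def)

lemma ht_grab:
  assumes s: "s rC = []" "s rA = []" "s rX = []"
    and P: "\<And>R. R \<in> {s rR, s rR @ [0]} \<Longrightarrow> P (s(rR := R, rX := takeWhile is_bit (s rR)))"
  shows "ht \<phi> grab s (11 * length (s rR) + 9) P"
proof -
  let ?w = "takeWhile is_bit (s rR)"
  let ?x = "rev (map (\<lambda>a. a = 2) ?w)"
  have "map bit_sym (map (\<lambda>a. a = 2) ?w) = ?w"
    by (rule map_bit_eq) (use set_takeWhileD in fast)
  then have "map bit_sym ?x = rev ?w" by (simp only: rev_map[symmetric])
  then obtain x where w: "map bit_sym x = rev ?w" by blast
  have lx: "length x = length ?w" using arg_cong[OF w, of length] by simp
  have lw: "length ?w \<le> length (s rR)" by (rule length_takeWhile_le)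
  then have lw0: "length ?w - length (s rR) = 0" by simp
  let ?Q = "\<lambda>s'. \<exists>R \<in> {s rR, s rR @ [0]}. s' = s(rR := drop (length ?w) R, rA := rev ?w)"
  have 3: "ht \<phi> (move rA [rR, rX]) s2 (6 * length (s rR) + 1) P"
    if R: "R \<in> {s rR, s rR @ [0]}" "s2 = s(rR := drop (length ?w) R, rA := rev ?w)" for s2 R
  proof -
    have "?w @ drop (length ?w) (s rR) = s rR"
      using takeWhile_dropWhile_id[of is_bit "s rR"] unfolding dropWhile_eq_drop .
    then have d: "?w @ drop (length ?w) R = R"
      using R(1) lw0 by (elim insertE emptyE) (simp_all only: drop_append drop0 append_assoc[symmetric])
    have "ht \<phi> (move rA [rR, rX]) s2 (6 * length x + 1) P"
    proof (rule ht_move2)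
      show "s2 rA = map bit_sym x" unfolding R(2) w by simp
      show "P (s2(rA := [], rR := rev (map bit_sym x) @ s2 rR, rX := rev (map bit_sym x) @ s2 rX))"
      proof (rule pointwise[of P, OF P[OF R(1)]])
        fix r
        show "(s2(rA := [], rR := rev (map bit_sym x) @ s2 rR, rX := rev (map bit_sym x) @ s2 rX)) r =
          (s(rR := R, rX := ?w)) r"
          unfolding R(2) w using d s(2,3) by simp
      qed
    qed simp
    then show ?thesis by (rule ht_mono) (use lw lx in simp_all)
  qed
  have 2: "ht \<phi> grab_loop (s(rC := [1])) (5 * length (s rR) + 5) ?Q"
  proof -
    have "?Q (s(rC := [1], rC := [], rR := drop (length ?w) R, rA := rev ?w @ []))"
      if "R \<in> {s rR, s rR @ [0]}" for R
      by (rule bexI[OF _ that]) (use s in \<open>auto simp: fun_eq_iff\<close>)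
    then show ?thesis using ht_grab_loop[of "s(rC := [1])" "s rR" "[]" ?Q \<phi>] s(2) by simp
  qed
  have 1: "ht \<phi> (Push rC 1) s 1 (\<lambda>s'. s' = s(rC := [1]))" by (rule ht_Push) (simp_all add: s)
  have 4: "ht \<phi> (Seq grab_loop (move rA [rR, rX])) s1 (11 * length (s rR) + 7) P"
    if "s1 = s(rC := [1])" for s1
    unfolding that by (rule ht_Seq'[OF 2], erule bexE, rule 3) simp_all
  show ?thesis
    unfolding grab_def by (rule ht_Seq'[OF 1 4]) simp_all
qed

definition sim_rel :: "otm \<Rightarrow> config \<Rightarrow> store \<Rightarrow> bool" where
  "sim_rel M c s \<longleftrightarrow> (case c of (q, t, p) \<Rightarrow> q < nst M \<and> s rS = [Suc q] \<and>
     (\<forall>r. r \<notin> {rL, rR, rS} \<longrightarrow> s r = []) \<and>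
     (\<forall>i. t (p + int i) = nth0 (s rR) i) \<and> (\<forall>i. t (p - 1 - int i) = nth0 (s rL) i) \<and>
     set (s rR) \<union> set (s rL) \<subseteq> {..<nsym M})"

definition tape_size :: "store \<Rightarrow> nat" where
  "tape_size s = length (s rL) + length (s rR)"

lemma set_tl: "set (tl xs) \<subseteq> set xs"
  by (cases xs) auto

text \<open>The extreme case behind the bound \<open>tape_size s + 2\<close> is a move to the left
  with both stacks empty: it pushes the written symbol and a blank.\<close>

lemma ht_sim_move:
  assumes M: "wf_otm M" and rel: "sim_rel M (q, t, p) s" and q: "q \<notin> {1, 2, 3}"
    and tr: "tr M q (t p) = (q', w, d)"
  shows "ht \<phi> (sim_body M c (Suc q)) (s(rS := [])) 9
    (\<lambda>s'. sim_rel M (q', t(p := w), p + d) s' \<and> tape_size s' \<le> tape_size s + 2)"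
proof -
  have r: "q < nst M" "s rS = [Suc q]" "\<And>r. r \<notin> {rL, rR, rS} \<Longrightarrow> s r = []"
    "\<And>i. t (p + int i) = nth0 (s rR) i" "\<And>i. t (p - 1 - int i) = nth0 (s rL) i"
    "set (s rR) \<subseteq> {..<nsym M}" "set (s rL) \<subseteq> {..<nsym M}"
    using rel by (auto simp: sim_rel_def)
  have n0: "0 < nsym M" using M by (auto simp: wf_otm_def)
  have tp: "t p = hd0 (s rR)" using r(4)[of 0] by (simp add: nth0_top)
  have tl: "t (p - 1) = hd0 (s rL)" using r(5)[of 0] by (simp add: nth0_top)
  have lt: "hd0 xs < nsym M" if "set xs \<subseteq> {..<nsym M}" for xs
    using that n0 by (cases xs) auto
  have "case tr M q (t p) of (q', w, d) \<Rightarrow> q' < nst M \<and> w < nsym M \<and> d \<in> {-1, 0, 1}"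
    using M r(1) lt[OF r(6)] tp unfolding wf_otm_def by metis
  then have tr': "q' < nst M" "w < nsym M" "d \<in> {-1, 0, 1}" using tr by auto
  let ?s = "s(rS := [], rR := tl (s rR))"
  define s1 where "s1 = (if d = 1 then ?s(rL := w # s rL) else if d = 0 then ?s(rR := w # tl (s rR))
      else ?s(rR := hd0 (s rL) # w # tl (s rR), rL := tl (s rL)))"
  have 1: "ht \<phi> (sim_move w d) ?s 5 (\<lambda>s'. s' = s1)"
  proof -
    consider "d = 1" | "d = 0" | "d = -1" using tr'(3) by auto
    then show ?thesis
    proof cases
      case 3
      have "ht \<phi> (Seq (Push rR w) (Pop rL (\<lambda>b. Push rR b))) ?s 5 (\<lambda>s'. s' = s1)"
        by (rule ht_Seq'[where Q = "\<lambda>s'. s' = ?s(rR := w # tl (s rR))" and t = 1 and u = 2])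
          (use 3 in \<open>auto intro!: ht_Push ht_Pop'[where t = 1] simp: s1_def fun_eq_iff\<close>)
      then show ?thesis using 3 by (simp add: sim_move_def)
    qed (auto intro!: ht_Push simp: sim_move_def s1_def)
  qed
  have rel1: "sim_rel M (q', t(p := w), p + d) (s1(rS := [Suc q']))"
  proof -
    have R: "(t(p := w)) (p + d + int i) = nth0 (s1 rR) i" for i
    proof -
      consider "d = 1" | "d = 0" | "d = -1" using tr'(3) by auto
      then show ?thesis
      proof cases
        case 1
        then show ?thesis using r(4)[of "Suc i"] by (simp add: s1_def nth0_tl add.assoc)
      next
        case 2
        then show ?thesis using r(4)[of i]
          by (cases i) (simp_all add: s1_def nth0_Cons nth0_tl)
      next
        case 3
        show ?thesis
        proof (cases i)
          case 0
          then show ?thesis using 3 tl by (simp add: s1_def nth0_Cons)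
        next
          case (Suc j)
          then show ?thesis using 3 r(4)[of j]
            by (cases j) (simp_all add: s1_def nth0_Cons nth0_tl algebra_simps)
        qed
      qed
    qed
    have L: "(t(p := w)) (p + d - 1 - int i) = nth0 (s1 rL) i" for i
    proof -
      consider "d = 1" | "d = 0" | "d = -1" using tr'(3) by auto
      then show ?thesis
      proof cases
        case 1
        show ?thesis
        proof (cases i)
          case (Suc j)
          then show ?thesis using 1 r(5)[of j] by (simp add: s1_def nth0_Cons algebra_simps)
        qed (use 1 in \<open>simp add: s1_def nth0_Cons\<close>)
      next
        case 2
        then show ?thesis using r(5)[of i] by (simp add: s1_def)
      next
        case 3
        have e: "p + d - 1 - int i = p - 1 - int (Suc i)" using 3 by simp
        show ?thesis unfolding e using 3 r(5)[of "Suc i"] by (simp add: s1_def nth0_tl algebra_simps)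
      qed
    qed
    have S: "set (s1 rR) \<union> set (s1 rL) \<subseteq> {..<nsym M}"
      using tr'(2) r(6,7) set_tl[of "s rR"] set_tl[of "s rL"] lt[OF r(7)] by (auto simp: s1_def)
    have "s1 r = []" if "r \<notin> {rL, rR, rS}" for r using that r(3) by (auto simp: s1_def)
    then show ?thesis using tr'(1) R L S by (simp add: sim_rel_def)
  qed
  have size1: "tape_size (s1(rS := [Suc q'])) \<le> tape_size s + 2"
    by (auto simp: tape_size_def s1_def)
  have "ht \<phi> (Seq (sim_move w d) (Push rS (Suc q'))) ?s 7
      (\<lambda>s'. sim_rel M (q', t(p := w), p + d) s' \<and> tape_size s' \<le> tape_size s + 2)"
  proof (rule ht_Seq'[OF 1])
    fix s' assume "s' = s1"
    moreover have "s1 rS = []" by (simp add: s1_def)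
    ultimately show "ht \<phi> (Push rS (Suc q')) s' 1
        (\<lambda>s'. sim_rel M (q', t(p := w), p + d) s' \<and> tape_size s' \<le> tape_size s + 2)"
      using rel1 size1 by (intro ht_Push) simp_all
  qed simp
  moreover have "sim_body M c (Suc q) = Pop rR (\<lambda>a. if q < nst M \<and> a < nsym M
       then case tr M q a of (q, w, d) \<Rightarrow> Seq (sim_move w d) (Push rS (Suc q)) else Skip)"
    using q by (auto simp: sim_body_def)
  moreover have "hd0 (s rR) < nsym M" using lt[OF r(6)] .
  ultimately show ?thesis
    using r(1) tr tp by (auto intro!: ht_Pop'[where t = 7])
qed

lemma query_string_takeWhile:
  assumes "\<And>i. t (p + int i) = nth0 xs i"
  shows "query_string t p = map (\<lambda>a. a = 2) (takeWhile is_bit xs)"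
proof -
  let ?w = "takeWhile is_bit xs"
  have "(LEAST k. t (p + int k) \<notin> {1, 2}) = length ?w"
  proof (rule Least_equality)
    show "t (p + int (length ?w)) \<notin> {1, 2}"
      using nth_length_takeWhile[of is_bit xs]
      by (auto simp: assms nth0_def is_bit_def split: if_splits)
    show "length ?w \<le> k" if "t (p + int k) \<notin> {1, 2}" for k
    proof (rule ccontr)
      assume "\<not> length ?w \<le> k"
      then have k: "k < length ?w" by simp
      then have "is_bit (?w ! k)" using set_takeWhileD[of "?w ! k" is_bit xs] by simp
      moreover have "?w ! k = xs ! k" using k by (rule takeWhile_nth)
      moreover have "k < length xs" using k length_takeWhile_le[of is_bit xs] by simp
      ultimately show False using that by (simp add: assms nth0_def is_bit_def)
    qed
  qed
  moreover have "t (p + int i) = ?w ! i" if "i < length ?w" for i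
    using that length_takeWhile_le[of is_bit xs] takeWhile_nth[OF that] by (simp add: assms nth0_def)
  ultimately show ?thesis
    unfolding query_string_def by (intro nth_equalityI) auto
qed

text \<open>The returned \<open>v\<close> lies in \<open>\<psi> x\<close>, where \<open>x\<close> is
  the query string, so the oracle itself could have answered \<open>v\<close>. The new store thus
  represents a genuine successor of the query configuration.\<close>

lemma ht_sim_query:
  assumes M: "wf_otm M" and rel: "sim_rel M (3, t, p) s" and c: "computes \<phi> c \<psi> T" "mono T"
  shows "ht \<phi> (sim_body M c 4) (s(rS := [])) (11 * tape_size s + T (tape_size s) + 16)
    (\<lambda>s'. \<exists>b\<in>\<psi> (query_string t p). sim_rel M (if b then 5 else 4, t, p) s' \<and>
       tape_size s' \<le> tape_size s + 2)"
proof -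
  have r: "s rS = [4]" "\<And>r. r \<notin> {rL, rR, rS} \<Longrightarrow> s r = []"
    "\<And>i. t (p + int i) = nth0 (s rR) i" "\<And>i. t (p - 1 - int i) = nth0 (s rL) i"
    "set (s rR) \<subseteq> {..<nsym M}" "set (s rL) \<subseteq> {..<nsym M}"
    using rel by (auto simp: sim_rel_def)
  have n: "0 < nsym M" "5 < nst M" using M by (auto simp: wf_otm_def)
  let ?w = "takeWhile is_bit (s rR)"
  define x where "x = map (\<lambda>a. a = 2) ?w"
  have x: "map bit_sym x = ?w" unfolding x_def by (rule map_bit_eq) (use set_takeWhileD in fast)
  have qx: "query_string t p = x" using query_string_takeWhile[OF r(3)] by (simp add: x_def)
  have lx: "length x \<le> length (s rR)" by (simp add: x_def length_takeWhile_le)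
  let ?Q = "\<lambda>s'. \<exists>R\<in>{s rR, s rR @ [0]}. s' = s(rS := [], rR := R, rX := ?w)"
  let ?V = "\<lambda>s'. \<exists>R\<in>{s rR, s rR @ [0]}. \<exists>v\<in>\<psi> x. s' = s(rS := [], rR := R, rX := [], rV := [bit_sym v])"
  let ?P = "\<lambda>s'. \<exists>b\<in>\<psi> (query_string t p). sim_rel M (if b then 5 else 4, t, p) s' \<and>
       tape_size s' \<le> tape_size s + 2"
  have 1: "ht \<phi> grab (s(rS := [])) (11 * length (s rR) + 9) ?Q"
  proof -
    have "?Q ((s(rS := []))(rR := R, rX := takeWhile is_bit ((s(rS := [])) rR)))"
      if "R \<in> {s rR, s rR @ [0]}" for R
      by (rule bexI[OF _ that]) simp
    then show ?thesis using ht_grab[of "s(rS := [])" ?Q \<phi>] r(2) by simp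
  qed
  have 2: "ht \<phi> c s' (T (length x)) ?V"
    if R: "R\<in>{s rR, s rR @ [0]}" "s' = s(rS := [], rR := R, rX := ?w)" for s' R
  proof -
    have "ht \<phi> c s' (T (length x)) (\<lambda>s''. \<exists>v\<in>\<psi> x. s'' = s'(rX := [], rV := [bit_sym v]))"
      by (rule computesD[OF c(1)]) (use r(2) in \<open>simp_all add: R(2) x\<close>)
    then show ?thesis
    proof (rule ht_mono)
      fix s'' assume "\<exists>v\<in>\<psi> x. s'' = s'(rX := [], rV := [bit_sym v])"
      then show "?V s''" unfolding R(2) by (intro bexI[OF _ R(1)]) simp
    qed simp
  qed
  have 3: "ht \<phi> (Pop rV (\<lambda>v. Push rS (if v = 2 then 6 else 5))) s' 2 ?P"
    if R: "R\<in>{s rR, s rR @ [0]}" "v \<in> \<psi> x"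
      "s' = s(rS := [], rR := R, rX := [], rV := [bit_sym v])" for s' R v
  proof (rule ht_Pop'[where t = 1])
    have R': "nth0 R i = nth0 (s rR) i" "set R \<subseteq> {..<nsym M}" "length R \<le> length (s rR) + 1" for i
      using R(1) r(5) n by (auto simp: nth0_snoc0)
    let ?s = "s(rS := [Suc (if v then 5 else 4)], rR := R)"
    have e: "(s'(rV := tl (s' rV)))(rS := (if hd0 (s' rV) = 2 then 6 else 5) # (s'(rV := tl (s' rV))) rS) = ?s"
      using r(2)[of rX] r(2)[of rV] unfolding R(3) by (auto simp: fun_eq_iff bit_sym_def)
    have "sim_rel M (if v then 5 else 4, t, p) ?s"
      unfolding sim_rel_def prod.case using r R'(1,2) n by simp
    moreover have "tape_size ?s \<le> tape_size s + 2"
      using R'(3) by (simp add: tape_size_def)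
    ultimately have "?P ?s" using R(2) unfolding qx by blast
    then show "ht \<phi> (Push rS (if hd0 (s' rV) = 2 then 6 else 5)) (s'(rV := tl (s' rV))) 1 ?P"
      by (intro ht_Push) (simp_all only: e zero_less_one)
  qed simp
  have T: "T (length x) \<le> T (tape_size s)"
    by (rule monoD[OF c(2)]) (use lx in \<open>simp add: tape_size_def\<close>)
  have V: "ht \<phi> (Pop rV (\<lambda>v. Push rS (if v = 2 then 6 else 5))) s' 2 ?P" if "?V s'" for s'
    using that by (elim bexE) (rule 3)
  have Q: "ht \<phi> (Seq c (Pop rV (\<lambda>v. Push rS (if v = 2 then 6 else 5)))) s'
      (T (length x) + 3) ?P" if "?Q s'" for s'
    using that by (elim bexE) (rule ht_Seq'[OF 2 V], assumption+, simp)
  have b: "sim_body M c 4 = Seq grab (Seq c (Pop rV (\<lambda>v. Push rS (if v = 2 then 6 else 5))))"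
    by (simp add: sim_body_def)
  show ?thesis
    unfolding b by (rule ht_Seq'[OF 1 Q]) (use T in \<open>simp_all add: tape_size_def\<close>)
qed

text \<open>The represented tape has size at most \<open>z\<close> and grows by at most 2 per step
  of \<open>M\<close>. Query strings are parts of it, so by monotonicity
  \<open>T (z + 2 * n)\<close> bounds the cost of every call.\<close>

lemma AF_sim_loop:
  assumes "AF (step \<psi> M) n G d" and M: "wf_otm M" and c: "computes \<phi> c \<psi> T" "mono T"
    and G: "\<And>d. G d \<Longrightarrow> fst d \<in> {1, 2} \<and> H (fst d = 2)"
    and "sim_rel M d s" "tape_size s \<le> z"
  shows "AF (cstep \<phi>) (n * (11 * (z + 2 * n) + T (z + 2 * n) + 17) + 2)
    (\<lambda>d. \<exists>b k s. d = (Halt b # k, s) \<and> H b) (While rS (sim_body M c) # k, s)"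
  using assms(1) assms(6-7)
proof (induction n arbitrary: d s z)
  case 0
  then have g: "fst d \<in> {1, 2}" "H (fst d = 2)" using G by (auto simp: AF.simps)
  obtain q t p where d: "d = (q, t, p)" by (cases d)
  have S: "s rS = [Suc q]" using 0(2) by (simp add: sim_rel_def d)
  have "sim_body M c (Suc q) = Halt (q = 2)" using g by (auto simp: sim_body_def d)
  then have "AF (cstep \<phi>) (Suc 1) (\<lambda>d. \<exists>b k s. d = (Halt b # k, s) \<and> H b)
      (While rS (sim_body M c) # k, s)"
    by (intro AF_While_step AF_now) (use S g d in auto)
  then show ?case by (rule AF_mono) simp_all
next
  case (Suc n)
  let ?P = "\<lambda>d. \<exists>b k s. d = (Halt b # k, s) \<and> H b"
  let ?B = "n * (11 * (z + 2 + 2 * n) + T (z + 2 + 2 * n) + 17) + 2"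
  obtain q t p where d: "d = (q, t, p)" by (cases d)
  have S: "s rS = [Suc q]" using Suc.prems(2) by (simp add: sim_rel_def d)
  have fin: "AF (cstep \<phi>) (Suc n * (11 * (z + 2 * Suc n) + T (z + 2 * Suc n) + 17) + 2) ?P
      (While rS (sim_body M c) # k, s)"
    if "AF (cstep \<phi>) (Suc (m + ?B)) ?P (While rS (sim_body M c) # k, s)"
      and m: "m \<le> 11 * z + T z + 16" for m
  proof (rule AF_mono[OF that(1)])
    have "T z \<le> T (z + 2 * Suc n)" by (rule monoD[OF c(2)]) simp
    moreover have "z + 2 + 2 * n = z + 2 * Suc n" by simp
    ultimately show "Suc (m + ?B) \<le> Suc n * (11 * (z + 2 * Suc n) + T (z + 2 * Suc n) + 17) + 2"
      using m by (simp add: algebra_simps)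
  qed simp
  show ?case
  proof (cases "G d")
    case True
    from G[OF this] have g: "q \<in> {1, 2}" "H (q = 2)" by (simp_all add: d)
    then have "sim_body M c (Suc q) = Halt (q = 2)" by (auto simp: sim_body_def)
    then have "AF (cstep \<phi>) (Suc (0 + ?B)) ?P (While rS (sim_body M c) # k, s)"
      by (intro AF_While_step AF_now) (use S g in auto)
    then show ?thesis by (rule fin) simp
  next
    case False
    then have ex: "\<exists>d'. step \<psi> M d d'" and all: "\<And>d'. step \<psi> M d d' \<Longrightarrow> AF (step \<psi> M) n G d'"
      using Suc.prems(1) by (auto simp: AF.simps)
    have IH: "AF (cstep \<phi>) ?B ?P (While rS (sim_body M c) # k, s')"
      if "step \<psi> M d d'" "sim_rel M d' s'" "tape_size s' \<le> tape_size s + 2" for d' s'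
      using Suc.IH[OF all[OF that(1)] that(2), of "z + 2"] that(3) Suc.prems(3) by simp
    have go: "AF (cstep \<phi>) (Suc (m + ?B)) ?P (While rS (sim_body M c) # k, s)"
      if "ht \<phi> (sim_body M c (Suc q)) (s(rS := [])) m Q"
        and "\<And>s'. Q s' \<Longrightarrow> AF (cstep \<phi>) ?B ?P (While rS (sim_body M c) # k, s')" for m Q
    proof (rule AF_While_step)
      show "AF (cstep \<phi>) (m + ?B) ?P
          (sim_body M c (hd0 (s rS)) # While rS (sim_body M c) # k, s(rS := tl (s rS)))"
        unfolding S hd0_simps list.sel(3) by (rule htD[OF that])
    qed (simp add: S)
    show ?thesis
    proof (cases "q = 3")
      case True
      have "ht \<phi> (sim_body M c (Suc q)) (s(rS := [])) (11 * tape_size s + T (tape_size s) + 16)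
        (\<lambda>s'. \<exists>b\<in>\<psi> (query_string t p). sim_rel M (if b then 5 else 4, t, p) s' \<and>
         tape_size s' \<le> tape_size s + 2)"
        using ht_sim_query[OF M _ c, of t p s] Suc.prems(2) True d by simp
      then have "AF (cstep \<phi>) (Suc (11 * tape_size s + T (tape_size s) + 16 + ?B)) ?P
          (While rS (sim_body M c) # k, s)"
      proof (rule go, elim bexE conjE)
        fix s' b assume "b \<in> \<psi> (query_string t p)" "sim_rel M (if b then 5 else 4, t, p) s'"
          "tape_size s' \<le> tape_size s + 2"
        then show "AF (cstep \<phi>) ?B ?P (While rS (sim_body M c) # k, s')"
          by (intro IH) (use step.query[of b \<psi> t p M] True d in simp_all)
      qed
      moreover have "T (tape_size s) \<le> T z" by (rule monoD[OF c(2) Suc.prems(3)])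
      ultimately show ?thesis using Suc.prems(3) by (intro fin[of "11 * tape_size s + T (tape_size s) + 16"]) simp_all
    next
      case False
      obtain q' w m where tr: "tr M q (t p) = (q', w, m)" by (cases "tr M q (t p)")
      have q: "q \<notin> {1, 2, 3}" using ex False by (auto simp: d elim: step.cases)
      have "AF (cstep \<phi>) (Suc (9 + ?B)) ?P (While rS (sim_body M c) # k, s)"
      proof (rule go[OF ht_sim_move[of M q t p s, OF M _ q tr]], goal_cases)
        case 1
        show ?case using Suc.prems(2) by (simp add: d)
      next
        case (2 s')
        then show ?case
          by (intro IH[of "(q', t(p := w), p + m)"]) (use step.move[of q M t p, OF q tr] d in simp_all)
      qed
      then show ?thesis by (rule fin) simp
    qed
  qed
qed

lemma poly_nat_mono: "x \<le> y \<Longrightarrow> poly p x \<le> poly p y" for p :: "nat poly"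
  by (induction p) (simp_all add: mult_le_mono)

lemma sim_rel_init:
  assumes "wf_otm M"
  shows "sim_rel M (init_config x) ((\<lambda>_. [])(rR := map bit_sym x, rS := [1]))"
proof -
  have "set (map bit_sym x) \<subseteq> {..<nsym M}" "0 < nst M"
    using assms by (auto simp: bit_sym_def wf_otm_def)
  moreover have "(if 0 \<le> int i \<and> int i < int (length x) then if x ! nat (int i) then 2 else 1 else 0) =
      nth0 (map bit_sym x) i" for i
    by (simp add: nth0_def bit_sym_def)
  ultimately show ?thesis
    unfolding sim_rel_def init_config_def prod.case by (simp add: nth0_def bit_sym_def)
qed

text \<open>Transitivity of the reduction, with one of the two reductions given as a subroutine. The
  stacks in use have indices below 10.\<close>

theorem reduces_transfer:
  fixes Tp :: "nat poly"
  assumes red: "\<psi>' \<propto>\<^sub>T \<psi>" and c: "computes \<phi> c \<psi> (poly Tp)"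
    and wf: "\<And>A. A0 \<le> A \<Longrightarrow> wfc 10 A c"
  shows "\<psi>' \<propto>\<^sub>T \<phi>"
proof -
  obtain M p where M: "wf_otm M"
    and r: "\<forall>x. x \<noteq> [] \<longrightarrow>
        (\<forall>k c. (step \<psi> M ^^ k) (init_config x) c \<longrightarrow> k \<le> poly p (length x)) \<and>
        (\<forall>k c. (step \<psi> M ^^ k) (init_config x) c \<longrightarrow> \<not> (\<exists>c'. step \<psi> M c c') \<longrightarrow>
             fst c \<in> {1, 2} \<and> (fst c = 2) \<in> \<psi>' x)"
    using red unfolding reduces_def by (elim exE conjE)
  \<comment> \<open>Simulated states are stored as successors, up to \<open>nst M\<close>, and the
    answer states are pushed as the literals 5 and 6, so 6 must lie below \<open>A\<close> as
    well.\<close>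
  define A where "A = Max {A0, nst M + 1, nsym M, 7}"
  have A: "A0 \<le> A" "nst M + 1 \<le> A" "nsym M \<le> A" "7 \<le> A" by (auto simp: A_def)
  have tr: "q' < nst M \<and> w < nsym M \<and> d \<in> {-1, 0, 1}"
    if "q < nst M" "a < nsym M" "tr M q a = (q', w, d)" for q a q' w d
    using M that unfolding wf_otm_def by fastforce
  have "wfc 10 A (Seq (sim_move w d) (Push rS (Suc q')))" if "q' < nst M" "w < nsym M" for q' w d
    using that A by (simp add: sim_move_def)
  then have mv: "wfc 10 A (case tr M q a of (q', w, d) \<Rightarrow> Seq (sim_move w d) (Push rS (Suc q')))"
    if "q < nst M" "a < nsym M" for q a
    using tr[OF that] by (cases "tr M q a") auto
  have g: "wfc 10 A grab"
    using A wfc_move[of rA 10 "[rR, rX]" A] by (simp add: grab_def grab_loop_def)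
  have "wfc 10 A (sim_body M c s)" for s
    using A g mv wf[OF A(1)] by (simp add: sim_body_def)
  then have wfc: "wfc 10 A (sim_prog M c)"
    using A wfc_move[of 0 10 "[rA]" A] wfc_move[of rA 10 "[rR]" A] by (simp add: sim_prog_def)
  define X :: "nat poly" where "X = [:0, 1:]"
  define Y where "Y = X + 2 * p"
  define P where "P = 8 * X + 10 + p * (11 * Y + pcompose Tp Y + 17)"
  have P: "poly P l = 8 * l + 10 + poly p l * (11 * (l + 2 * poly p l) + poly Tp (l + 2 * poly p l) + 17)" for l
    by (simp add: P_def Y_def X_def poly_pcompose)
  have T: "mono (poly Tp)" by (simp add: mono_def poly_nat_mono)
  show ?thesis
  proof (rule reduces_if_program[OF wfc])
    fix x :: "bool list" assume x: "x \<noteq> []"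
    let ?G = "\<lambda>d. \<exists>b k s. d = (Halt b # k, s) \<and> b \<in> \<psi>' x"
    have M_AF: "AF (step \<psi> M) (poly p (length x)) (\<lambda>d. fst d \<in> {1, 2} \<and> (fst d = 2) \<in> \<psi>' x) (init_config x)"
    proof (rule AF_if_bounded)
      fix k d assume k: "(step \<psi> M ^^ k) (init_config x) d"
      note r' = r[THEN spec, THEN mp, OF x]
      show "k \<le> poly p (length x)" by (rule r'[THEN conjunct1, rule_format, OF k])
      show "fst d \<in> {1, 2} \<and> (fst d = 2) \<in> \<psi>' x" if "\<not> (\<exists>d'. step \<psi> M d d')"
        by (rule r'[THEN conjunct2, rule_format, OF k that])
    qed
    let ?s = "(\<lambda>_. [])(rR := map bit_sym x, rS := [1])"
    have 4: "AF (cstep \<phi>) (poly p (length x) * (11 * (length x + 2 * poly p (length x)) +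
        poly Tp (length x + 2 * poly p (length x)) + 17) + 2) ?G ([While rS (sim_body M c)], ?s)"
      by (rule AF_sim_loop[OF M_AF M c T _ sim_rel_init[OF M]]) (simp_all add: tape_size_def)
    have 3: "ht \<phi> (Push rS 1) ((\<lambda>_. [])(rR := map bit_sym x)) 1 (\<lambda>s. s = ?s)"
      by (rule ht_Push) simp_all
    have 2: "ht \<phi> (move rA [rR]) ((\<lambda>_. [])(rA := map bit_sym (rev x))) (4 * length (rev x) + 1)
        (\<lambda>s. s = (\<lambda>_. [])(rR := map bit_sym x))"
      by (rule ht_move1) (auto simp: fun_eq_iff rev_map)
    have 1: "ht \<phi> (move 0 [rA]) (input_store x) (4 * length x + 1)
        (\<lambda>s. s = (\<lambda>_. [])(rA := map bit_sym (rev x)))"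
      by (rule ht_move1) (auto simp: fun_eq_iff rev_map input_store_def)
    let ?W = "While rS (sim_body M c)"
    have seq: "AF (cstep \<phi>) (Suc n) ?G (Seq a b # k, s)"
      if "AF (cstep \<phi>) n ?G (a # b # k, s)" for n a b k s
      by (rule AF_cstep[OF cstep.intros(2) _ that]) simp
    have "AF (cstep \<phi>) (1 + (poly p (length x) * (11 * (length x + 2 * poly p (length x)) +
        poly Tp (length x + 2 * poly p (length x)) + 17) + 2)) ?G
        (Push rS 1 # [?W], (\<lambda>_. [])(rR := map bit_sym x))"
      by (rule htD[OF 3]) (use 4 in simp)
    note seq[OF this]
    then have "AF (cstep \<phi>) ((4 * length (rev x) + 1) + Suc (1 + (poly p (length x) * (11 * (length x + 2 * poly p (length x)) +
        poly Tp (length x + 2 * poly p (length x)) + 17) + 2))) ?G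
        (move rA [rR] # [Seq (Push rS 1) ?W], (\<lambda>_. [])(rA := map bit_sym (rev x)))"
      by (intro htD[OF 2]) (simp only:)
    note seq[OF this]
    then have "AF (cstep \<phi>) ((4 * length x + 1) + Suc ((4 * length (rev x) + 1) + Suc (1 + (poly p (length x) * (11 * (length x + 2 * poly p (length x)) +
        poly Tp (length x + 2 * poly p (length x)) + 17) + 2)))) ?G
        (move 0 [rA] # [Seq (move rA [rR]) (Seq (Push rS 1) ?W)], input_store x)"
      by (intro htD[OF 1]) (simp only:)
    note seq[OF this]
    then show "AF (cstep \<phi>) (poly P (length x)) ?G ([sim_prog M c], input_store x)"
      unfolding sim_prog_def P by (rule AF_mono) simp_all
  qed (use A in simp_all)
qed

section \<open>Transductions of encoded instances\<close>

lemma unary_simps: "unary 0 = [False]" "unary (Suc k) = True # unary k"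
  by (simp_all add: unary_def)

lemma unary_prefix: "unary a @ x = unary b @ y \<Longrightarrow> a = b \<and> x = y"
proof (induction a arbitrary: b)
  case 0
  then show ?case by (cases b) (simp_all add: unary_simps)
next
  case (Suc a)
  then show ?case by (cases b) (auto simp: unary_simps)
qed

text \<open>The code is prefix-free: three bits determine the constructor, and the codes of the
  arguments follow. The arbitrary remainders \<open>x\<close> and \<open>y\<close> make the
  induction pass through the binary connectives, where the second argument is the remainder of the
  first.\<close>

lemma enc_form_prefix: "enc_form f @ x = enc_form g @ y \<Longrightarrow> f = g \<and> x = y"
proof (induction f arbitrary: g x y)
  case (BVar i)
  obtain j where g: "g = BVar j" and e: "unary i @ x = unary j @ y"
    using BVar.prems by (cases g) simp_all
  show ?case using unary_prefix[OF e] g by simp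
next
  case (BConst b)
  then show ?case by (cases g) simp_all
next
  case (BNot f)
  obtain g1 where g: "g = BNot g1" and e: "enc_form f @ x = enc_form g1 @ y"
    using BNot.prems by (cases g) simp_all
  show ?case using BNot.IH[OF e] g by simp
next
  case (BAnd f1 f2)
  obtain g1 g2 where g: "g = BAnd g1 g2"
    and e: "enc_form f1 @ (enc_form f2 @ x) = enc_form g1 @ (enc_form g2 @ y)"
    using BAnd.prems by (cases g) simp_all
  note BAnd.IH(1)[OF e]
  moreover from this have "f2 = g2 \<and> x = y" by (intro BAnd.IH(2)) simp
  ultimately show ?case using g by simp
next
  case (BOr f1 f2)
  obtain g1 g2 where g: "g = BOr g1 g2"
    and e: "enc_form f1 @ (enc_form f2 @ x) = enc_form g1 @ (enc_form g2 @ y)"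
    using BOr.prems by (cases g) simp_all
  note BOr.IH(1)[OF e]
  moreover from this have "f2 = g2 \<and> x = y" by (intro BOr.IH(2)) simp
  ultimately show ?case using g by simp
qed

definition hdr :: "nat list \<Rightarrow> bool list" where
  "hdr ms = concat (map (\<lambda>m. True # unary m) ms)"

lemma hdr_simps [simp]: "hdr [] = []" "hdr (m # ms) = True # unary m @ hdr ms"
  "hdr (ms @ ns) = hdr ms @ hdr ns"
  by (simp_all add: hdr_def)

lemma enc_inst_hdr: "enc_inst ms f = hdr ms @ False # enc_form f"
  by (simp add: enc_inst_def hdr_def)

lemma enc_inst_inj: "enc_inst ms f = enc_inst ns g \<Longrightarrow> ms = ns \<and> f = g"
proof (induction ms arbitrary: ns)
  case Nil
  then show ?case using enc_form_prefix[of f "[]" g "[]"] by (cases ns) (simp_all add: enc_inst_hdr)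
next
  case (Cons m ms)
  then show ?case by (cases ns) (auto simp: enc_inst_hdr dest: unary_prefix)
qed

lemma decode_enc: "decode (enc_inst ms f) = (ms, f)"
  unfolding decode_def by (rule the_equality) (auto dest: enc_inst_inj)

lemma USAT_enc: "valid_inst n ms f \<Longrightarrow> USAT n (enc_inst ms f) = usat_fun ms (form_fun f)"
  by (auto simp: USAT_def encodes_level_def decode_enc)

lemma UVAL_enc: "valid_inst n ms f \<Longrightarrow> UVAL n (enc_inst ms f) = uval_fun ms (form_fun f)"
  by (auto simp: UVAL_def encodes_level_def decode_enc)

text \<open>A query without a possible answer would get stuck, and a stuck path counts as
  failure.\<close>

lemma oracle_nonempty: "USAT n x \<noteq> {}" "UVAL n x \<noteq> {}"
  by (auto simp: USAT_def usat_fun_def UVAL_def uval_fun_def)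

section \<open>Substitutions in formulas and the transducers that carry them out\<close>

fun map_form :: "(nat \<Rightarrow> bform) \<Rightarrow> bform \<Rightarrow> bform" where
  "map_form \<sigma> (BVar i) = \<sigma> i"
| "map_form \<sigma> (BConst b) = BConst b"
| "map_form \<sigma> (BNot a) = BNot (map_form \<sigma> a)"
| "map_form \<sigma> (BAnd a b) = BAnd (map_form \<sigma> a) (map_form \<sigma> b)"
| "map_form \<sigma> (BOr a b) = BOr (map_form \<sigma> a) (map_form \<sigma> b)"

lemma beval_map_form: "beval v (map_form \<sigma> f) = beval (\<lambda>i. beval v (\<sigma> i)) f"
  by (induction f) auto

lemma bvars_map_form: "bvars (map_form \<sigma> f) = (\<Union>i\<in>bvars f. bvars (\<sigma> i))"
  by (induction f) auto

text \<open>Variable 0 stays in front, and room for \<open>k\<close> new variables is made between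
  it and the others.\<close>

definition shift_form :: "nat \<Rightarrow> bform \<Rightarrow> bform" where
  "shift_form k = map_form (\<lambda>i. if i = 0 then BVar 0 else BVar (i + k))"

definition subst_form :: "bool \<Rightarrow> bform \<Rightarrow> bform" where
  "subst_form c = map_form (\<lambda>i. if i = 0 then BConst c else BVar (i - 1))"

text \<open>
  States of the scanner: 0 between blocks of the header, 1 inside a block size, 2 at the start of a token, 3 and 4
  after a first bit 0 and 1, 5 after 00, 6 before the last bit of a connective, 7 at the start
  of a variable index, 8 before a constant, 9 inside a variable index.
\<close>

definition nxt :: "nat \<Rightarrow> bool \<Rightarrow> nat" where
  "nxt q b = (if q = 0 then (if b then 1 else 2) else if q = 1 then (if b then 1 else 0)
     else if q = 2 then (if b then 4 else 3) else if q = 3 then (if b then 6 else 5)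
     else if q = 4 then 6 else if q = 5 then (if b then 8 else 7) else if q = 6 then 2
     else if q = 7 then (if b then 9 else 2) else if q = 8 then 2 else if b then 9 else 2)"

text \<open>The eight bits are the end marker of the header, the token 011 of \<open>BAnd\<close>
  and the code 0000 of \<open>BVar 0\<close>.\<close>

definition insert_fst :: "nat \<Rightarrow> bool \<Rightarrow> nat \<times> bool list" where
  "insert_fst q b = (nxt q b,
     if q = 0 \<and> \<not> b then [False, False, True, True, False, False, False, False] else [b])"

definition shift_fst :: "nat \<Rightarrow> nat \<Rightarrow> bool \<Rightarrow> nat \<times> bool list" where
  "shift_fst k q b = (nxt q b, if q = 7 \<and> b then replicate k True @ [True] else [b])"

text \<open>
  The third bit of a token starting with 00 is withheld until it is known whether the variable is 0 (which becomes a
  constant) or positive (which loses a 1).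
\<close>

definition subst_fst :: "bool \<Rightarrow> nat \<Rightarrow> bool \<Rightarrow> nat \<times> bool list" where
  "subst_fst c q b = (nxt q b, if q = 5 \<and> \<not> b then []
     else if q = 7 then (if b then [False] else [True, c]) else [b])"

lemma nxt_less: "nxt q b < 10"
  by (simp add: nxt_def)

lemma insert_fst_simps:
  "insert_fst 0 b = (if b then (Suc 0, [True]) else (2, [False, False, True, True, False, False, False, False]))"
  "insert_fst (Suc 0) b = ((if b then Suc 0 else 0), [b])"
  "insert_fst 2 b = ((if b then 4 else 3), [b])"
  "insert_fst 3 b = ((if b then 6 else 5), [b])"
  "insert_fst 4 b = (6, [b])"
  "insert_fst 5 b = ((if b then 8 else 7), [b])"
  "insert_fst 6 b = (2, [b])"
  "insert_fst 7 b = ((if b then 9 else 2), [b])"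
  "insert_fst 8 b = (2, [b])"
  "insert_fst 9 b = ((if b then 9 else 2), [b])"
  by (simp_all add: insert_fst_def nxt_def)

lemma shift_fst_simps:
  "shift_fst k 0 b = ((if b then Suc 0 else 2), [b])"
  "shift_fst k (Suc 0) b = ((if b then Suc 0 else 0), [b])"
  "shift_fst k 2 b = ((if b then 4 else 3), [b])"
  "shift_fst k 3 b = ((if b then 6 else 5), [b])"
  "shift_fst k 4 b = (6, [b])"
  "shift_fst k 5 b = ((if b then 8 else 7), [b])"
  "shift_fst k 6 b = (2, [b])"
  "shift_fst k 7 b = (if b then (9, replicate k True @ [True]) else (2, [False]))"
  "shift_fst k 8 b = (2, [b])"
  "shift_fst k 9 b = ((if b then 9 else 2), [b])"
  by (simp_all add: shift_fst_def nxt_def)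

lemma subst_fst_simps:
  "subst_fst c 0 b = ((if b then Suc 0 else 2), [b])"
  "subst_fst c (Suc 0) b = ((if b then Suc 0 else 0), [b])"
  "subst_fst c 2 b = ((if b then 4 else 3), [b])"
  "subst_fst c 3 b = ((if b then 6 else 5), [b])"
  "subst_fst c 4 b = (6, [b])"
  "subst_fst c 5 b = (if b then (8, [True]) else (7, []))"
  "subst_fst c 6 b = (2, [b])"
  "subst_fst c 7 b = (if b then (9, [False]) else (2, [True, c]))"
  "subst_fst c 8 b = (2, [b])"
  "subst_fst c 9 b = ((if b then 9 else 2), [b])"
  by (simp_all add: subst_fst_def nxt_def)

lemma trans_unary:
  assumes "\<And>b. \<delta> q b = (if b then q else q', [b])"
  shows "fst_run \<delta> q (unary k @ x) = unary k @ fst_run \<delta> q' x"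
  by (induction k) (simp_all add: unary_simps assms)

lemma unary_shift: "replicate k True @ unary i = unary (i + k)"
  unfolding unary_def append_assoc[symmetric] replicate_add[symmetric] by (simp add: add.commute)

lemma trans_insert_copy:
  "fst_run insert_fst (Suc 0) (unary k @ x) = unary k @ fst_run insert_fst 0 x"
  "fst_run insert_fst 9 (unary k @ x) = unary k @ fst_run insert_fst 2 x"
  by (rule trans_unary, simp add: insert_fst_simps)+

lemma trans_shift_copy:
  "fst_run (shift_fst j) (Suc 0) (unary k @ x) = unary k @ fst_run (shift_fst j) 0 x"
  "fst_run (shift_fst j) 9 (unary k @ x) = unary k @ fst_run (shift_fst j) 2 x"
  by (rule trans_unary, simp add: shift_fst_simps)+

lemma trans_subst_copy:
  "fst_run (subst_fst c) (Suc 0) (unary k @ x) = unary k @ fst_run (subst_fst c) 0 x"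
  "fst_run (subst_fst c) 9 (unary k @ x) = unary k @ fst_run (subst_fst c) 2 x"
  by (rule trans_unary, simp add: subst_fst_simps)+

lemma trans_insert_form: "fst_run insert_fst 2 (enc_form f @ x) = enc_form f @ fst_run insert_fst 2 x"
proof (induction f arbitrary: x)
  case (BVar i)
  then show ?case
    using trans_insert_copy(2) by (cases i) (simp_all add: insert_fst_simps unary_simps)
qed (simp_all add: insert_fst_simps)

lemma trans_shift_form:
  "fst_run (shift_fst k) 2 (enc_form f @ x) = enc_form (shift_form k f) @ fst_run (shift_fst k) 2 x"
proof (induction f arbitrary: x)
  case (BVar i)
  then show ?case
    using trans_shift_copy(2) unary_shift[of k "Suc _", symmetric]
    by (cases i) (simp_all add: shift_fst_simps unary_simps shift_form_def)
qed (simp_all add: shift_fst_simps shift_form_def)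

lemma trans_subst_form:
  "fst_run (subst_fst c) 2 (enc_form f @ x) = enc_form (subst_form c f) @ fst_run (subst_fst c) 2 x"
proof (induction f arbitrary: x)
  case (BVar i)
  then show ?case
    using trans_subst_copy(2)
    by (cases i) (simp_all add: subst_fst_simps unary_simps subst_form_def)
qed (simp_all add: subst_fst_simps subst_form_def)

lemma trans_hdr:
  assumes "\<And>k x. fst_run \<delta> (Suc 0) (unary k @ x) = unary k @ fst_run \<delta> 0 x" "\<delta> 0 True = (Suc 0, [True])"
  shows "fst_run \<delta> 0 (hdr ms @ x) = hdr ms @ fst_run \<delta> 0 x"
  by (induction ms) (simp_all add: assms)

lemma trans_insert_inst: "fst_run insert_fst 0 (enc_inst ms f) = enc_inst ms (BAnd (BVar 0) f)"
proof -
  have "fst_run insert_fst 0 (hdr ms @ x) = hdr ms @ fst_run insert_fst 0 x" for x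
    by (rule trans_hdr) (simp_all add: trans_insert_copy insert_fst_simps)
  then show ?thesis
    using trans_insert_form[of f "[]"] by (simp add: enc_inst_hdr insert_fst_simps unary_simps)
qed

text \<open>The scan starts inside a block size, in state 1, because the two leading bits of the
  instance have been popped by then.\<close>

lemma trans_shift_inst:
  "fst_run (shift_fst k) (Suc 0) (unary m @ enc_inst ms f) = unary m @ enc_inst ms (shift_form k f)"
proof -
  have "fst_run (shift_fst k) 0 (hdr ms @ x) = hdr ms @ fst_run (shift_fst k) 0 x" for x
    by (rule trans_hdr) (simp_all add: trans_shift_copy shift_fst_simps)
  then show ?thesis
    using trans_shift_form[of k f "[]"]
    by (simp add: enc_inst_hdr trans_shift_copy, simp add: shift_fst_simps)
qed

lemma trans_subst_inst:
  "fst_run (subst_fst c) (Suc 0) (unary m @ enc_inst ms f) = unary m @ enc_inst ms (subst_form c f)"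
proof -
  have "fst_run (subst_fst c) 0 (hdr ms @ x) = hdr ms @ fst_run (subst_fst c) 0 x" for x
    by (rule trans_hdr) (simp_all add: trans_subst_copy subst_fst_simps)
  then show ?thesis
    using trans_subst_form[of c f "[]"]
    by (simp add: enc_inst_hdr trans_subst_copy, simp add: subst_fst_simps)
qed

lemma length_trans_le: "(\<And>q b. length (snd (\<delta> q b)) \<le> B) \<Longrightarrow> length (fst_run \<delta> q x) \<le> B * length x"
proof (induction x arbitrary: q)
  case (Cons b x)
  have "length (fst_run \<delta> (fst (\<delta> q b)) x) \<le> B * length x" by (rule Cons.IH[OF Cons.prems])
  then show ?case using Cons.prems[of q b] by simp
qed simp

lemma nxt_eq_7: "nxt q b = 7 \<longleftrightarrow> q = 5 \<and> \<not> b"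
  by (simp add: nxt_def)

text \<open>State 7 means that one bit has been withheld, and this bit pays for the two bits written
  in place of the index 0. Hence repeated substitution never lengthens an instance.\<close>

lemma length_trans_subst: "length (fst_run (subst_fst c) q x) \<le> length x + (if q = 7 then 1 else 0)"
proof (induction x arbitrary: q)
  case (Cons b x)
  have f: "fst (subst_fst c q b) = nxt q b"
    and s: "length (snd (subst_fst c q b)) = (if q = 5 \<and> \<not> b then 0 else if q = 7 \<and> \<not> b then 2 else 1)"
    by (simp_all add: subst_fst_def)
  have "length (fst_run (subst_fst c) (nxt q b) x) \<le> length x + (if q = 5 \<and> \<not> b then 1 else 0)"
    using Cons[of "nxt q b"] by (simp only: nxt_eq_7)
  then show ?case using f s by (cases "q = 5"; cases "q = 7"; cases b) simp_all
qed simp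

lemma form_fun_subst: "form_fun (subst_form c f) (x # xs) = form_fun f ((c # x) # xs)"
  unfolding form_fun_def subst_form_def beval_map_form
  by (rule arg_cong[where f = "\<lambda>v. beval v f"]) (auto simp: fun_eq_iff nth_Cons split: nat.split)

lemma form_fun_Nil: "form_fun f ([] # xs) = form_fun f xs"
  by (simp add: form_fun_def)

text \<open>In the query, the bit \<open>b\<close>, the \<open>k\<close> dummy bits and
  \<open>e\<close> precede \<open>y\<close>. Position \<open>i - 1\<close> of the string formed by
  \<open>y # zs\<close> is therefore position \<open>i + Suc k\<close> of the query.\<close>

lemma form_fun_shift:
  assumes "length (concat ds) = k"
  shows "form_fun (shift_form (Suc k) f) ([b] # ds @ (e # y) # zs) = form_fun (subst_form b f) (y # zs)"
proof -
  have "beval (\<lambda>i. i < length (concat ([b] # ds @ (e # y) # zs)) \<and> concat ([b] # ds @ (e # y) # zs) ! i)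
      (if i = 0 then BVar 0 else BVar (i + Suc k)) =
    beval (\<lambda>i. i < length (concat (y # zs)) \<and> concat (y # zs) ! i)
      (if i = 0 then BConst b else BVar (i - 1))" for i
    using assms by (cases i) (simp_all add: nth_append)
  then show ?thesis
    unfolding form_fun_def subst_form_def shift_form_def beval_map_form by (simp only:)
qed

section \<open>Eliminating one variable\<close>

text \<open>Which of the two quantifiers comes first depends on the block number \<open>j\<close> of the original instance.\<close>

definition game_val :: "nat \<Rightarrow> nat list \<Rightarrow> (bool list list \<Rightarrow> bool) \<Rightarrow> bool" where
  "game_val j ms g = (if odd j then sat ms g else csat ms g)"

lemma ex_Suc_list: "(\<exists>x :: bool list. length x = Suc m \<and> P x) \<longleftrightarrow> (\<exists>b x. length x = m \<and> P (b # x))"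
  by (metis length_Cons length_Suc_conv)

lemma all_Suc_list: "(\<forall>x :: bool list. length x = Suc m \<longrightarrow> P x) \<longleftrightarrow> (\<forall>b x. length x = m \<longrightarrow> P (b # x))"
  by (metis length_Cons length_Suc_conv)

text \<open>Each dummy block is quantified vacuously but exchanges the roles of \<open>sat\<close>
  and \<open>csat\<close>, so after \<open>k\<close> of them the real block meets the quantifier
  that belongs to its number. The extra bit \<open>e\<close> is vacuous too.\<close>

lemma game_val_dummies:
  assumes "\<And>ds e y zs. length (concat ds) = k \<Longrightarrow> G (ds @ (e # y) # zs) = h (y # zs)"
  shows "sat (replicate k 1 @ Suc m # ms) G = game_val (Suc k) (m # ms) h"
    and "csat (replicate k 1 @ Suc m # ms) G = game_val k (m # ms) h"
proof -
  have "sat (replicate k 1 @ Suc m # ms) G = game_val (Suc k) (m # ms) h \<and>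
    csat (replicate k 1 @ Suc m # ms) G = game_val k (m # ms) h"
    using assms
  proof (induction k arbitrary: G)
    case 0
    have "(\<lambda>xs. G ((e # y) # xs)) = (\<lambda>xs. h (y # xs))" for e y
      using 0[of "[]"] by simp
    then show ?case by (simp add: ex_Suc_list all_Suc_list game_val_def)
  next
    case (Suc k)
    have "sat (replicate k 1 @ Suc m # ms) (\<lambda>xs. G ([b] # xs)) = game_val (Suc k) (m # ms) h \<and>
      csat (replicate k 1 @ Suc m # ms) (\<lambda>xs. G ([b] # xs)) = game_val k (m # ms) h" for b
    proof (rule Suc.IH)
      fix ds :: "bool list list" and e y zs
      assume "length (concat ds) = k"
      then show "G ([b] # ds @ (e # y) # zs) = h (y # zs)"
        using Suc.prems[of "[b] # ds" e y zs] by simp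
    qed
    then show ?case by (simp add: ex_Suc_list all_Suc_list game_val_def)
  qed
  then show "sat (replicate k 1 @ Suc m # ms) G = game_val (Suc k) (m # ms) h"
    "csat (replicate k 1 @ Suc m # ms) G = game_val k (m # ms) h" by auto
qed

lemma sat_witnesses: "sat (m # ms) g \<longleftrightarrow> witnesses (m # ms) g \<noteq> {}"
  by (auto simp: witnesses_def)

lemma finite_witnesses: "finite (witnesses ms g)"
  by (rule finite_subset[OF _ finite_lists_length_eq[of "UNIV :: bool set" "hd ms"]])
    (auto simp: witnesses_def)

lemma witnesses_subst:
  "witnesses (m # ms) (form_fun (subst_form c f)) = {x. c # x \<in> witnesses (Suc m # ms) (form_fun f)}"
  by (simp add: witnesses_def form_fun_subst)

lemma sat_const: "sat ms (\<lambda>_. q) = q" "csat ms (\<lambda>_. q) = q"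
proof -
  have "\<exists>x :: bool list. length x = m" for m
    by (rule exI[of _ "replicate m True"]) simp
  then have "sat ms (\<lambda>_. q) = q \<and> csat ms (\<lambda>_. q) = q"
    by (induction ms) simp_all
  then show "sat ms (\<lambda>_. q) = q" "csat ms (\<lambda>_. q) = q" by simp_all
qed

lemma beval_cong: "(\<And>i. i \<in> bvars f \<Longrightarrow> v i = w i) \<Longrightarrow> beval v f = beval w f"
  by (induction f) auto

lemma form_fun_closed: "bvars f = {} \<Longrightarrow> form_fun f xs = form_fun f []"
  unfolding form_fun_def by (rule beval_cong) simp

lemma game_val_Suc:
  "game_val j (Suc m # ms) (form_fun f) = (if odd j then \<exists>c. game_val j (m # ms) (form_fun (subst_form c f))
     else \<forall>c. game_val j (m # ms) (form_fun (subst_form c f)))"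
  by (simp add: game_val_def ex_Suc_list all_Suc_list form_fun_subst)

lemma game_val_zero: "game_val j (0 # ms) (form_fun f) = game_val (Suc j) ms (form_fun f)"
  by (simp add: game_val_def form_fun_Nil)

lemma uval_funD:
  assumes "a \<in> uval_fun ms g" "x \<in> witnesses ms g" "\<And>y. y \<in> witnesses ms g \<Longrightarrow> y = x"
  shows "a = hd x"
proof -
  have "\<exists>!x. x \<in> witnesses ms g" using assms(2,3) by blast
  moreover have "(THE x. x \<in> witnesses ms g) = x" using assms(2,3) by (rule the_equality)
  ultimately show ?thesis using assms(1) by (simp add: uval_fun_def)
qed

text \<open>There are two candidates, and \<open>V\<close> tells which of them win. If exactly one
  wins, it is the unique witness, and it equals \<open>V True\<close>.\<close>

lemma uval_bit:
  assumes a: "a \<in> uval_fun (1 # ms) g" and V: "\<And>b. csat ms (\<lambda>xs. g ([b] # xs)) = V b"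
    and ne: "V True \<noteq> V False"
  shows "a = V True"
proof -
  have W: "x \<in> witnesses (1 # ms) g \<longleftrightarrow> x = [V True]" for x
  proof -
    have "x \<in> witnesses (1 # ms) g \<longleftrightarrow> (\<exists>b. x = [b] \<and> V b)"
      using V by (auto simp: witnesses_def length_Suc_conv)
    also have "\<dots> \<longleftrightarrow> x = [V True]" using ne by (cases "V True") (auto, (metis (full_types))+)
    finally show ?thesis .
  qed
  have "a = hd [V True]" by (rule uval_funD[OF a]) (simp_all only: W)
  then show ?thesis by simp
qed

text \<open>Here \<open>k\<close> is \<open>j - 2\<close>: the number of dummy blocks between the
  bit and block \<open>j\<close>, and of the same parity as \<open>j\<close>.\<close>

lemma uval_later_block:
  assumes "a \<in> uval_fun (replicate (Suc k) 1 @ Suc m # ms) (form_fun (shift_form (Suc k) f))"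
  shows "game_val k (m # ms) (form_fun (subst_form (if odd k then a else \<not> a) f)) =
    game_val k (Suc m # ms) (form_fun f)"
proof -
  define V where "V b = game_val k (m # ms) (form_fun (subst_form b f))" for b
  have 1: "csat (replicate k 1 @ Suc m # ms) (\<lambda>xs. form_fun (shift_form (Suc k) f) ([b] # xs)) = V b" for b
    unfolding V_def by (rule game_val_dummies(2)) (rule form_fun_shift)
  have 2: "a \<in> uval_fun (1 # replicate k 1 @ Suc m # ms) (form_fun (shift_form (Suc k) f))"
    using assms by simp
  have "V True \<noteq> V False \<Longrightarrow> a = V True" by (rule uval_bit[OF 2 1])
  then have "V (if odd k then a else \<not> a) = (if odd k then V True \<or> V False else V True \<and> V False)"
    by (cases a; cases "V True"; cases "V False") auto
  also have "\<dots> = game_val k (Suc m # ms) (form_fun f)"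
    unfolding game_val_Suc V_def[symmetric] by (auto, (metis (full_types))+)
  finally show ?thesis unfolding V_def .
qed

text \<open>After the substitution the witnesses are the tails of those old ones that start with
  \<open>a\<close>; there is still at most one. If an old witness exists, \<open>a\<close> is its
  first bit, so it survives.\<close>

lemma uval_first_block:
  assumes a: "a \<in> uval_fun (Suc m # ms) (form_fun f)"
    and c: "card (witnesses (Suc m # ms) (form_fun f)) \<le> 1"
  shows "card (witnesses (m # ms) (form_fun (subst_form a f))) \<le> 1"
    and "sat (m # ms) (form_fun (subst_form a f)) = sat (Suc m # ms) (form_fun f)"
proof -
  let ?W = "witnesses (Suc m # ms) (form_fun f)"
  let ?W' = "witnesses (m # ms) (form_fun (subst_form a f))"
  have W': "?W' = {x. a # x \<in> ?W}" by (rule witnesses_subst)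
  have u: "x = y" if "x \<in> ?W" "y \<in> ?W" for x y
    using c that card_le_Suc0_iff_eq[OF finite_witnesses] by (metis One_nat_def)
  show "card ?W' \<le> 1"
    using card_le_Suc0_iff_eq[OF finite_witnesses, of "m # ms" "form_fun (subst_form a f)"] u
    unfolding W' by fastforce
  have "?W' \<noteq> {} \<longleftrightarrow> ?W \<noteq> {}"
  proof
    assume "?W \<noteq> {}"
    then obtain x where x: "x \<in> ?W" by blast
    then have "length x = Suc m" by (simp add: witnesses_def)
    then obtain b y where b: "x = b # y" by (cases x) auto
    have "a = hd x" by (rule uval_funD[OF a x]) (rule u[OF _ x])
    then show "?W' \<noteq> {}" using x b unfolding W' by auto
  qed (auto simp: W')
  then show "sat (m # ms) (form_fun (subst_form a f)) = sat (Suc m # ms) (form_fun f)"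
    by (simp only: sat_witnesses)
qed

definition iff_form :: "bform \<Rightarrow> bform" where
  "iff_form f = BOr (BAnd (BVar 0) f) (BAnd (BNot (BVar 0)) (BNot f))"

lemma uval_closed:
  assumes a: "a \<in> uval_fun (replicate (Suc k) 1) (form_fun (iff_form f))" and f: "bvars f = {}"
  shows "a = form_fun f []"
proof -
  have "form_fun (iff_form f) ([b] # xs) = (b = form_fun f [])" for b xs
    using form_fun_closed[OF f, of "[b] # xs"] unfolding form_fun_def iff_form_def by auto
  then have "csat (replicate k 1) (\<lambda>xs. form_fun (iff_form f) ([b] # xs)) = (b = form_fun f [])" for b
    by (simp add: sat_const)
  from uval_bit[OF _ this] a show ?thesis by auto
qed

lemma usat_and_first:
  assumes b: "b \<in> usat_fun (Suc m # ms) (form_fun (BAnd (BVar 0) f))"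
  shows "b \<in> uval_fun (Suc m # ms) (form_fun f)"
proof -
  let ?W = "witnesses (Suc m # ms) (form_fun f)"
  let ?W' = "witnesses (Suc m # ms) (form_fun (BAnd (BVar 0) f))"
  have W': "?W' = {x \<in> ?W. hd x}"
  proof -
    have "form_fun (BAnd (BVar 0) f) ((c # x) # xs) = (c \<and> form_fun f ((c # x) # xs))" for c x xs
      by (simp add: form_fun_def)
    \<comment> \<open>For a false \<open>c\<close> the formula is constantly false, and
      \<open>sat_const\<close> evaluates the remaining game.\<close>
    then have "csat ms (\<lambda>xs. form_fun (BAnd (BVar 0) f) ((c # x) # xs)) \<longleftrightarrow>
        csat ms (\<lambda>xs. form_fun f ((c # x) # xs)) \<and> c" for c x
      by (cases c) (simp_all add: sat_const)
    then have "x \<in> ?W' \<longleftrightarrow> x \<in> {x \<in> ?W. hd x}" for x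
      by (cases x) (simp_all add: witnesses_def)
    then show ?thesis by blast
  qed
  show ?thesis
  proof (cases "\<exists>!x. x \<in> ?W")
    case True
    define x where "x = (THE x. x \<in> ?W)"
    have x1: "x \<in> ?W" unfolding x_def by (rule theI'[OF True])
    have x2: "x = y" if "y \<in> ?W" for y unfolding x_def by (rule the1_equality[OF True that])
    have "?W = {x}"
    proof (intro equalityI subsetI)
      fix y assume "y \<in> ?W"
      from x2[OF this] show "y \<in> {x}" by simp
    qed (simp add: x1)
    then have "?W' = {y \<in> {x}. hd y}" using W' by (simp only:)
    then have "?W' = (if hd x then {x} else {})" by auto
    then have "card ?W' \<le> 1" "?W' \<noteq> {} \<longleftrightarrow> hd x" by (simp_all split: if_splits)
    then have "usat_fun (Suc m # ms) (form_fun (BAnd (BVar 0) f)) = {hd x}"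
      by (simp only: usat_fun_def sat_witnesses if_True)
    moreover have "uval_fun (Suc m # ms) (form_fun f) = {hd x}"
      using True by (simp only: uval_fun_def x_def if_True)
    ultimately show ?thesis using b by simp
  next
    case False
    then show ?thesis by (simp add: uval_fun_def)
  qed
qed

section \<open>The two subroutines\<close>

text \<open>The stacks that a subroutine uses, except \<open>rC\<close>, which is empty whenever a
  transduction starts or ends. In this form every update replaces one argument.\<close>

definition work :: "store \<Rightarrow> nat list \<Rightarrow> nat list \<Rightarrow> nat list \<Rightarrow> nat list \<Rightarrow> nat list \<Rightarrow> store" where
  "work s q x a b v = s(0 := q, rX := x, rA := a, rB := b, rV := v)"

lemma work_simps [simp]:
  "work s q x a b v 0 = q" "work s q x a b v rX = x" "work s q x a b v rA = a" "work s q x a b v rB = b"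
  "work s q x a b v rV = v" "work s q x a b v rC = s rC"
  "(work s q x a b v)(0 := q') = work s q' x a b v" "(work s q x a b v)(rX := q') = work s q q' a b v"
  "(work s q x a b v)(rA := q') = work s q x q' b v" "(work s q x a b v)(rB := q') = work s q x a q' v"
  "(work s q x a b v)(rV := q') = work s q x a b q'"
  by (auto simp: work_def fun_eq_iff)

lemma ht_Seq_det:
  assumes "ht \<phi> c s t (\<lambda>s'. s' = s1)" "ht \<phi> d s1 u P" "t + u < t'"
  shows "ht \<phi> (Seq c d) s t' P"
  by (rule ht_Seq'[OF assms(1)]) (use assms(2,3) in simp_all)

definition drain :: "nat \<Rightarrow> com" where
  "drain r = While r (\<lambda>_. Skip)"

lemma ht_drain:
  assumes "s r = map bit_sym x" "P (s(r := []))"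
  shows "ht \<phi> (drain r) s (3 * length x + 1) P"
  using assms
proof (induction x arbitrary: s)
  case Nil
  then show ?case unfolding drain_def by (intro ht_While_end) simp_all
next
  case (Cons b x)
  have b: "bit_sym b \<noteq> 0" by (simp add: bit_sym_def)
  show ?case
    unfolding drain_def
  proof (rule ht_While_step'[where Q = "\<lambda>s'. s' = s(r := map bit_sym x)" and t = 1 and u = "3 * length x + 1"])
    show "ht \<phi> Skip (s(r := tl (s r))) 1 (\<lambda>s'. s' = s(r := map bit_sym x))"
      by (rule ht_Skip) (simp_all add: Cons.prems(1))
    fix s' assume s': "s' = s(r := map bit_sym x)"
    show "ht \<phi> (While r (\<lambda>_. Skip)) s' (3 * length x + 1) P"
      unfolding drain_def[symmetric] s' by (rule Cons.IH) (simp_all only: fun_upd_same fun_upd_upd Cons.prems(2))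
  qed (simp_all add: Cons.prems(1) b)
qed

lemma map_unbit: "map (\<lambda>a. a = 2) (map bit_sym x) = x"
  by (induction x) (simp_all add: bit_sym_def)

text \<open>A query leaves its string on stack 0, so the string has to be drained before the answer
  is used.\<close>

lemma ht_ask:
  assumes "\<phi> q \<noteq> {}" "\<And>b. b \<in> \<phi> q \<Longrightarrow> ht \<phi> (f b) (work s [] x a c v) t P" "t + 3 * length q + 3 \<le> t'"
  shows "ht \<phi> (Ask (\<lambda>b. Seq (drain 0) (f b))) (work s (map bit_sym q) x a c v) t' P"
proof (rule ht_Ask'[where t = "t + 3 * length q + 2"])
  fix b assume "b \<in> \<phi> (map (\<lambda>a. a = 2) (work s (map bit_sym q) x a c v 0))"
  then have b: "b \<in> \<phi> q" by (simp only: work_simps map_unbit)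
  have "ht \<phi> (drain 0) (work s (map bit_sym q) x a c v) (3 * length q + 1) (\<lambda>s'. s' = work s [] x a c v)"
    by (rule ht_drain) simp_all
  from ht_Seq_det[OF this assms(2)[OF b]]
  show "ht \<phi> (Seq (drain 0) (f b)) (work s (map bit_sym q) x a c v) (t + 3 * length q + 2) P" by simp
qed (use assms in \<open>simp_all only: work_simps map_unbit, simp_all\<close>)

lemma clean_st:
  assumes "s rX = x" "\<And>r. r \<notin> {rL, rR, rS, rX} \<Longrightarrow> s r = []"
  shows "s = work s [] x [] [] []" "s rC = []"
proof -
  show "s = work s [] x [] [] []"
  proof
    fix r
    show "s r = work s [] x [] [] [] r"
      using assms(1) assms(2)[of 0] assms(2)[of rA] assms(2)[of rB] assms(2)[of rV]
      by (simp add: work_def)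
  qed
  show "s rC = []" using assms(2)[of rC] by simp
qed

lemma result_st: "s = work s [] x [] [] [] \<Longrightarrow> work s [] [] [] [] v = s(rX := [], rV := v)"
  by (erule ssubst) simp

section \<open>Answering \<open>UVAL\<close> with one query to \<open>USAT\<close>\<close>

definition insert_prog :: com where
  "insert_prog = Seq (transduce insert_fst 0 rC rX rA) (Seq (move rA [0])
     (Ask (\<lambda>b. Seq (drain 0) (Push rV (bit_sym b)))))"

lemma ht_transduce_XA:
  assumes "s rC = []" "\<And>q b. length (snd (\<delta> q b)) \<le> B"
  shows "ht \<phi> (transduce \<delta> q0 rC rX rA) (work s q (map bit_sym y) [] c v) ((2 * B + 5) * length y + 6)
    (\<lambda>s'. s' = work s q [] (map bit_sym (rev (fst_run \<delta> q0 y))) c v)"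
  by (rule ht_transduce[where x = y]) (use assms in \<open>simp_all add: rev_map\<close>)

lemma ht_move_A0:
  "ht \<phi> (move rA [0]) (work s q x (map bit_sym (rev y)) c v) (4 * length y + 1)
    (\<lambda>s'. s' = work s (map bit_sym y @ q) x [] c v)"
proof -
  have "ht \<phi> (move rA [0]) (work s q x (map bit_sym (rev y)) c v) (4 * length (rev y) + 1)
    (\<lambda>s'. s' = work s (map bit_sym y @ q) x [] c v)"
    by (rule ht_move1) (simp_all add: rev_map)
  then show ?thesis by simp
qed

lemma ht_move_B0:
  "ht \<phi> (move rB [0]) (work s q x a (map bit_sym (rev y)) v) (4 * length y + 1)
    (\<lambda>s'. s' = work s (map bit_sym y @ q) x a [] v)"
proof -
  have "ht \<phi> (move rB [0]) (work s q x a (map bit_sym (rev y)) v) (4 * length (rev y) + 1)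
    (\<lambda>s'. s' = work s (map bit_sym y @ q) x a [] v)"
    by (rule ht_move1) (simp_all add: rev_map)
  then show ?thesis by simp
qed

lemma ht_move_AX:
  "ht \<phi> (move rA [rX]) (work s q [] (map bit_sym (rev y)) c v) (4 * length y + 1)
    (\<lambda>s'. s' = work s q (map bit_sym y) [] c v)"
proof -
  have "ht \<phi> (move rA [rX]) (work s q [] (map bit_sym (rev y)) c v) (4 * length (rev y) + 1)
    (\<lambda>s'. s' = work s q (map bit_sym y) [] c v)"
    by (rule ht_move1) (simp_all add: rev_map)
  then show ?thesis by simp
qed

lemma ht_move_BX:
  "ht \<phi> (move rB [rX]) (work s q [] a (map bit_sym (rev y)) v) (4 * length y + 1)
    (\<lambda>s'. s' = work s q (map bit_sym y) a [] v)"
proof -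
  have "ht \<phi> (move rB [rX]) (work s q [] a (map bit_sym (rev y)) v) (4 * length (rev y) + 1)
    (\<lambda>s'. s' = work s q (map bit_sym y) a [] v)"
    by (rule ht_move1) (simp_all add: rev_map)
  then show ?thesis by simp
qed

lemma ht_move_XAB:
  "ht \<phi> (move rX [rA, rB]) (work s q (map bit_sym y) [] [] v) (6 * length y + 1)
    (\<lambda>s'. s' = work s q [] (map bit_sym (rev y)) (map bit_sym (rev y)) v)"
  by (rule ht_move2[where x = y]) (simp_all add: rev_map)

lemma ht_pushes_0:
  "ht \<phi> (pushes 0 (map bit_sym (rev y))) (work s q x a c v) (2 * length y + 1)
    (\<lambda>s'. s' = work s (map bit_sym y @ q) x a c v)"
proof -
  have "ht \<phi> (pushes 0 (map bit_sym (rev y))) (work s q x a c v) (2 * length (map bit_sym (rev y)) + 1)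
    (\<lambda>s'. s' = work s (map bit_sym y @ q) x a c v)"
    by (rule ht_pushes) (simp add: rev_map)
  then show ?thesis by simp
qed

text \<open>The transducer writes at most 8 bits per input bit, so the query is at most 8 times as
  long as the input. The coefficients 80 and 20 leave room for the scan, the move, the query and the
  draining.\<close>

lemma insert_prog_computes:
  assumes ne: "\<And>x. \<phi> x \<noteq> {}" and sub: "\<And>x. \<phi> (fst_run insert_fst 0 x) \<subseteq> \<psi> x"
  shows "computes \<phi> insert_prog \<psi> (poly [:20, 80:])"
  unfolding computes_def
proof (intro allI impI)
  fix s x assume x: "s rX = map bit_sym x" and r: "\<forall>r. r \<notin> {rL, rR, rS, rX} \<longrightarrow> s r = []"
  have c: "s = work s [] (map bit_sym x) [] [] []" "s rC = []"
    using clean_st[of s, OF x] r by blast+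
  let ?y = "fst_run insert_fst 0 x"
  let ?P = "\<lambda>s'. \<exists>v\<in>\<psi> x. s' = s(rX := [], rV := [bit_sym v])"
  have B: "length (snd (insert_fst q b)) \<le> 8" for q b by (simp add: insert_fst_def)
  have ly: "length ?y \<le> 8 * length x" by (rule length_trans_le[OF B])
  have 3: "ht \<phi> (Ask (\<lambda>b. Seq (drain 0) (Push rV (bit_sym b)))) (work s (map bit_sym ?y @ []) [] [] [] [])
      (3 * length ?y + 4) ?P"
    unfolding append_Nil2
  proof (rule ht_ask[OF ne])
    fix b assume "b \<in> \<phi> ?y"
    then have b: "b \<in> \<psi> x" using sub by blast
    have "?P (work s [] [] [] [] [bit_sym b])" by (rule bexI[OF result_st[OF c(1)] b])
    then show "ht \<phi> (Push rV (bit_sym b)) (work s [] [] [] [] []) 1 ?P"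
      by (intro ht_Push) (simp_all only: work_simps zero_less_one)
  qed simp
  have "ht \<phi> insert_prog (work s [] (map bit_sym x) [] [] []) (80 * length x + 20) ?P"
    unfolding insert_prog_def
    by (rule ht_Seq_det[OF ht_transduce_XA[where s = s and \<delta> = insert_fst and B = 8, OF c(2) B] ht_Seq_det[OF ht_move_A0 3 lessI]])
      (use ly in simp)
  then have "ht \<phi> insert_prog s (80 * length x + 20) ?P" unfolding c(1)[symmetric] .
  then show "ht \<phi> insert_prog s (poly [:20, 80:] (length x)) ?P"
    by (simp add: algebra_simps)
qed

lemma wfc_fst:
  assumes "12 \<le> A" "\<And>q b. fst (\<delta> q b) = nxt q b" "q0 < 10"
  shows "wfc 10 A (transduce \<delta> q0 rC rX rA)"
proof (rule wfc_transduce)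
  show "Suc (fst (\<delta> q b)) < A" for q b using nxt_less[of q b] assms(1) by (simp add: assms(2))
qed (use assms(1,3) in simp_all)

lemma wfc_insert_prog: "12 \<le> A \<Longrightarrow> wfc 10 A insert_prog"
  using wfc_fst[of A insert_fst 0] wfc_move[of rA 10 "[0]" A]
  by (simp add: insert_prog_def insert_fst_def drain_def bit_sym_def)

lemma usat_decides_uval:
  assumes "1 \<le> n"
  shows "USAT n (fst_run insert_fst 0 x) \<subseteq> UVAL n x"
proof (cases "encodes_level n x")
  case True
  then obtain ms f where x: "x = enc_inst ms f" "valid_inst n ms f" by (auto simp: encodes_level_def)
  \<comment> \<open>As \<open>n\<close> and all block sizes are positive, there is a nonempty first
    block, and \<open>BVar 0\<close> is its first bit.\<close>
  then obtain m ms' where ms: "ms = Suc m # ms'" using assms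
    by (cases ms; cases "hd ms") (auto simp: valid_inst_def)
  have v: "valid_inst n ms (BAnd (BVar 0) f)" using x(2) ms by (simp add: valid_inst_def)
  show ?thesis
    unfolding x(1) trans_insert_inst USAT_enc[OF v] UVAL_enc[OF x(2)]
    using usat_and_first[of _ m ms' f] ms by blast
next
  case False
  then show ?thesis by (simp add: UVAL_def)
qed

section \<open>Answering \<open>USAT\<close> with \<open>UVAL\<close>: the elimination
  program\<close>

definition phase_prefix :: "nat \<Rightarrow> bool list" where
  "phase_prefix j = hdr (replicate (j - 1) 1) @ [True, True]"

text \<open>The word \<open>y\<close> is the current instance without its two leading ones. The
  query puts \<open>j - 1\<close> one-bit blocks in front and restores both ones, so the current
  block keeps its size.\<close>

definition phase_query :: "nat \<Rightarrow> bool list \<Rightarrow> bool list" where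
  "phase_query j y = phase_prefix j @ fst_run (shift_fst (j - 1)) 1 y"

text \<open>Only one of the two removed ones is restored: the current block loses the substituted
  variable.\<close>

definition phase_next :: "nat \<Rightarrow> bool \<Rightarrow> bool list \<Rightarrow> bool list" where
  "phase_next j b y = True # fst_run (subst_fst (if odd j then b else \<not> b)) 1 y"

text \<open>Scanning consumes a word, so \<open>y\<close> is duplicated: one copy becomes the query,
  the other waits on \<open>rB\<close> for the answer that selects the substitution. The 1 on
  \<open>rV\<close> requests another round.\<close>

definition step_prog :: "nat \<Rightarrow> com" where
  "step_prog j =
     Seq (move rX [rA, rB]) (Seq (move rA [rX]) (Seq (transduce (shift_fst (j - 1)) 1 rC rX rA)
       (Seq (move rA [0]) (Seq (pushes 0 (map bit_sym (rev (phase_prefix j)))) (Seq (move rB [rX])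
       (Ask (\<lambda>b. Seq (drain 0) (Seq (transduce (subst_fst (if odd j then b else \<not> b)) 1 rC rX rA)
          (Seq (move rA [rX]) (Seq (Push rX 2) (Push rV 1)))))))))))"

text \<open>A nonempty block begins with two ones, whereas an empty block is encoded as 10. Popping
  these two bits removes the empty block, and as nothing is pushed on \<open>rV\<close>, the phase
  ends.\<close>

definition phase_body :: "nat \<Rightarrow> com" where
  "phase_body j = Pop rX (\<lambda>a. Pop rX (\<lambda>b. if a = 2 \<and> b = 2 then step_prog j else Skip))"

definition phase_prog :: "nat \<Rightarrow> com" where
  "phase_prog j = Seq (Push rV 1) (While rV (\<lambda>_. phase_body j))"

text \<open>These bits stand between the two copies of \<open>f\<close> in the code of
  \<open>iff_form f\<close>: the tokens of \<open>BAnd\<close> and \<open>BNot\<close>, variable 0,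
  and \<open>BNot\<close> again. In \<open>final_pre\<close> the header is followed by its end
  marker, \<open>BOr\<close>, \<open>BAnd\<close> and variable 0.\<close>

definition final_mid :: "bool list" where
  "final_mid = [False, True, True, False, True, False, False, False, False, False, False, True, False]"

definition final_pre :: "nat \<Rightarrow> bool list" where
  "final_pre n = hdr (replicate n 1) @
     [False, True, False, False, False, True, True, False, False, False, False]"

definition final_prog :: "nat \<Rightarrow> com" where
  "final_prog n = Pop rX (\<lambda>_. Seq (move rX [rA, rB]) (Seq (move rA [0])
     (Seq (pushes 0 (map bit_sym (rev final_mid))) (Seq (move rB [0])
     (Seq (pushes 0 (map bit_sym (rev (final_pre n))))
       (Ask (\<lambda>b. Seq (drain 0) (Push rV (bit_sym b)))))))))"

definition game_prog :: "nat \<Rightarrow> com" where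
  "game_prog n = foldr (\<lambda>j c. Seq (phase_prog j) c) [1..<Suc n] (final_prog n)"

text \<open>All outcomes of a phase against an adversarial oracle. As \<open>stop\<close> applies to
  every word without two leading ones, the relation describes the program on meaningless words
  too.\<close>

inductive phase_run :: "(bool list \<Rightarrow> bool set) \<Rightarrow> nat \<Rightarrow> bool list \<Rightarrow> bool list \<Rightarrow> bool"
  for \<phi> j where
  stop: "(\<And>y. w \<noteq> True # True # y) \<Longrightarrow> phase_run \<phi> j w (drop 2 w)"
| go: "b \<in> \<phi> (phase_query j y) \<Longrightarrow> phase_run \<phi> j (phase_next j b y) w' \<Longrightarrow>
    phase_run \<phi> j (True # True # y) w'"

fun phases_run :: "(bool list \<Rightarrow> bool set) \<Rightarrow> nat list \<Rightarrow> bool list \<Rightarrow> bool list \<Rightarrow> bool" where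
  "phases_run \<phi> [] w w' \<longleftrightarrow> w' = w"
| "phases_run \<phi> (j # js) w w' \<longleftrightarrow> (\<exists>u. phase_run \<phi> j w u \<and> phases_run \<phi> js u w')"

lemma length_hdr_ones: "length (hdr (replicate k (Suc 0))) = 3 * k"
  by (induction k) (simp_all add: unary_def)

lemma length_phase_next: "length (phase_next j b y) \<le> Suc (length y)"
  using length_trans_subst[of _ 1 y] by (simp add: phase_next_def)

lemma ht_step_prog:
  assumes ne: "\<And>x. \<phi> x \<noteq> {}" and j: "1 \<le> j" and c: "s rC = []"
  shows "ht \<phi> (step_prog j) (work s [] (map bit_sym y) [] [] []) ((9 * j + 32) * length y + 15 * j + 60)
    (\<lambda>s'. \<exists>b\<in>\<phi> (phase_query j y). s' = work s [] (map bit_sym (phase_next j b y)) [] [] [1])"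
proof -
  let ?P = "\<lambda>s'. \<exists>b\<in>\<phi> (phase_query j y). s' = work s [] (map bit_sym (phase_next j b y)) [] [] [1]"
  let ?l = "length y"
  let ?z = "fst_run (shift_fst (j - 1)) 1 y"
  have B1: "length (snd (shift_fst (j - 1) q b)) \<le> j" for q b
    using j by (simp add: shift_fst_def)
  have B2: "length (snd (subst_fst d q b)) \<le> 2" for d q b
    by (simp add: subst_fst_def)
  have lz: "length ?z \<le> j * ?l" by (rule length_trans_le[OF B1])
  have lp: "length (phase_prefix j) = 3 * j - 1"
    using j by (simp add: phase_prefix_def length_hdr_ones)
  have lq: "length (phase_query j y) \<le> 3 * j + j * ?l"
    using lz by (simp add: phase_query_def lp)
  have ask: "ht \<phi> (Seq (transduce (subst_fst (if odd j then b else \<not> b)) 1 rC rX rA)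
          (Seq (move rA [rX]) (Seq (Push rX 2) (Push rV 1))))
      (work s [] (map bit_sym y) [] [] []) (13 * ?l + 14) ?P"
    if b: "b \<in> \<phi> (phase_query j y)" for b
  proof -
    let ?d = "if odd j then b else \<not> b"
    let ?u = "fst_run (subst_fst ?d) 1 y"
    have lu: "length ?u \<le> ?l" using length_trans_subst[of ?d 1 y] by simp
    have nu: "2 # map bit_sym ?u = map bit_sym (phase_next j b y)" by (simp add: phase_next_def bit_sym_def)
    have 4: "ht \<phi> (Push rV 1) (work s [] (2 # map bit_sym ?u) [] [] []) 1 ?P"
    proof (rule ht_Push)
      show "?P ((work s [] (2 # map bit_sym ?u) [] [] [])(rV := 1 # work s [] (2 # map bit_sym ?u) [] [] [] rV))"
        unfolding work_simps nu by (rule bexI[OF refl b])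
    qed simp
    have 3: "ht \<phi> (Push rX 2) (work s [] (map bit_sym ?u) [] [] []) 1 (\<lambda>s'. s' = work s [] (2 # map bit_sym ?u) [] [] [])"
      by (rule ht_Push) simp_all
    show ?thesis
      by (rule ht_Seq_det[OF ht_transduce_XA[where s = s and \<delta> = "subst_fst ?d" and B = 2, OF c B2]
            ht_Seq_det[OF ht_move_AX ht_Seq_det[OF 3 4 lessI] lessI]])
        (use lu in simp)
  qed
  have 7: "ht \<phi> (Ask (\<lambda>b. Seq (drain 0) (Seq (transduce (subst_fst (if odd j then b else \<not> b)) 1 rC rX rA)
          (Seq (move rA [rX]) (Seq (Push rX 2) (Push rV 1))))))
      (work s (map bit_sym (phase_query j y)) (map bit_sym y) [] [] []) (13 * ?l + 17 + 3 * (3 * j + j * ?l)) ?P"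
    by (rule ht_ask[OF ne ask]) (use lq in simp_all)
  have q: "map bit_sym (phase_prefix j) @ map bit_sym ?z @ [] = map bit_sym (phase_query j y)"
    by (simp add: phase_query_def)
  have 1: "ht \<phi> (transduce (shift_fst (j - 1)) 1 rC rX rA) (work s [] (map bit_sym y) [] (map bit_sym (rev y)) [])
      ((2 * j + 5) * ?l + 6) (\<lambda>s'. s' = work s [] [] (map bit_sym (rev ?z)) (map bit_sym (rev y)) [])"
    by (rule ht_transduce_XA[where s = s and \<delta> = "shift_fst (j - 1)" and B = j, OF c B1])
  have 2: "ht \<phi> (pushes 0 (map bit_sym (rev (phase_prefix j)))) (work s (map bit_sym ?z @ []) [] [] (map bit_sym (rev y)) [])
      (2 * length (phase_prefix j) + 1)
      (\<lambda>s'. s' = work s (map bit_sym (phase_query j y)) [] [] (map bit_sym (rev y)) [])"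
    using ht_pushes_0[of \<phi> "phase_prefix j" s "map bit_sym ?z @ []"] unfolding q .
  show ?thesis
    unfolding step_prog_def
    by (rule ht_Seq_det[OF ht_move_XAB ht_Seq_det[OF ht_move_AX ht_Seq_det[OF 1
          ht_Seq_det[OF ht_move_A0 ht_Seq_det[OF 2 ht_Seq_det[OF ht_move_BX 7 lessI] lessI]
          lessI] lessI] lessI]])
      (use lz j in \<open>simp add: lp algebra_simps\<close>)
qed

text \<open>A round removes two bits and restores at most one, as substitution does not lengthen the
  word. Induction on the length therefore covers all words, including those that encode
  nothing.\<close>

lemma ht_phase_loop:
  assumes ne: "\<And>x. \<phi> x \<noteq> {}" and j: "1 \<le> j" and c: "s rC = []" and "length w \<le> L"
  shows "ht \<phi> (While rV (\<lambda>_. phase_body j)) (work s [] (map bit_sym w) [] [] [1])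
    ((length w + 1) * ((9 * j + 32) * L + 15 * j + 70))
    (\<lambda>s'. \<exists>w'. phase_run \<phi> j w w' \<and> length w' \<le> length w \<and> s' = work s [] (map bit_sym w') [] [] [])"
  using assms(4)
proof (induction "length w" arbitrary: w rule: less_induct)
  case less
  let ?K = "(9 * j + 32) * L + 15 * j + 70"
  let ?P = "\<lambda>w s'. \<exists>w'. phase_run \<phi> j w w' \<and> length w' \<le> length w \<and> s' = work s [] (map bit_sym w') [] [] []"
  let ?W = "While rV (\<lambda>_. phase_body j)"
  show ?case
  proof (cases "\<exists>y. w = True # True # y")
    case True
    then obtain y where w: "w = True # True # y" by blast
    let ?Q = "\<lambda>s'. \<exists>b\<in>\<phi> (phase_query j y). s' = work s [] (map bit_sym (phase_next j b y)) [] [] [1]"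
    show ?thesis
    proof (rule ht_While_step'[where Q = ?Q])
      have "ht \<phi> (step_prog j) (work s [] (map bit_sym y) [] [] []) ((9 * j + 32) * length y + 15 * j + 60) ?Q"
        by (rule ht_step_prog[of \<phi> j s y, OF ne j c])
      then have "ht \<phi> (Pop rX (\<lambda>b. if (2::nat) = 2 \<and> b = 2 then step_prog j else Skip))
          (work s [] (2 # map bit_sym y) [] [] []) ((9 * j + 32) * length y + 15 * j + 61) ?Q"
        by - (rule ht_Pop'[where t = "(9 * j + 32) * length y + 15 * j + 60"], simp_all only: work_simps hd0_simps list.sel(3) if_True simp_thms, simp?)
      then have "ht \<phi> (phase_body j) (work s [] (2 # 2 # map bit_sym y) [] [] [])
          ((9 * j + 32) * length y + 15 * j + 62) ?Q"
        unfolding phase_body_def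
        by - (rule ht_Pop'[where t = "(9 * j + 32) * length y + 15 * j + 61"], simp_all only: work_simps hd0_simps list.sel(3), simp?)
      then show "ht \<phi> (phase_body j) ((work s [] (map bit_sym w) [] [] [1])
            (rV := tl (work s [] (map bit_sym w) [] [] [1] rV)))
          ((9 * j + 32) * length y + 15 * j + 62) ?Q"
        by (simp add: w bit_sym_def)
      fix s' assume "?Q s'"
      then show "ht \<phi> ?W s' ((length y + 2) * ?K) (?P w)"
      proof (elim bexE)
        fix b assume b: "b \<in> \<phi> (phase_query j y)" and s': "s' = work s [] (map bit_sym (phase_next j b y)) [] [] [1]"
        have ln: "length (phase_next j b y) \<le> Suc (length y)" by (rule length_phase_next)
        have "ht \<phi> ?W s' ((length (phase_next j b y) + 1) * ?K) (?P (phase_next j b y))"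
          unfolding s' by (rule less.hyps) (use ln less.prems w in simp_all)
        then show "ht \<phi> ?W s' ((length y + 2) * ?K) (?P w)"
        proof (rule ht_mono)
          show "(length (phase_next j b y) + 1) * ?K \<le> (length y + 2) * ?K"
            by (rule mult_le_mono1) (use ln in simp)
          fix s'' assume "?P (phase_next j b y) s''"
          then show "?P w s''"
          proof (elim exE conjE)
            fix w' assume r: "phase_run \<phi> j (phase_next j b y) w'" and l: "length w' \<le> length (phase_next j b y)"
              and s'': "s'' = work s [] (map bit_sym w') [] [] []"
            have "phase_run \<phi> j w w'" unfolding w by (rule phase_run.go[OF b r])
            moreover have "length w' \<le> length w" using l ln w by simp
            ultimately show ?thesis using s'' by blast
          qed
        qed
      qed
    next
      have "(9 * j + 32) * length y \<le> (9 * j + 32) * L"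
        by (rule mult_le_mono2) (use less.prems w in simp)
      then have "(9 * j + 32) * length y + 15 * j + 62 < ?K" by linarith
      moreover have e: "(length w + 1) * k = k + (length y + 2) * k" for k by (simp add: w)
      ultimately show "(9 * j + 32) * length y + 15 * j + 62 + (length y + 2) * ?K < (length w + 1) * ?K"
        unfolding e by (intro add_strict_right_mono)
    qed simp
  next
    case False
    let ?s = "work s [] (map bit_sym (drop 2 w)) [] [] []"
    have r: "phase_run \<phi> j w (drop 2 w)" by (rule phase_run.stop) (use False in blast)
    have t: "tl (tl (map bit_sym w)) = map bit_sym (drop 2 w)"
      by (simp add: map_tl drop_map[symmetric] tl_drop drop_Suc numeral_2_eq_2)
    have ab: "\<not> (hd0 (map bit_sym w) = 2 \<and> hd0 (tl (map bit_sym w)) = 2)"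
      using False by (cases w; cases "tl w") (auto simp: bit_sym_def split: if_splits)
    show ?thesis
    proof (rule ht_While_step'[where Q = "\<lambda>s'. s' = ?s" and t = 3 and u = 1])
      have "ht \<phi> (Pop rX (\<lambda>b. if hd0 (map bit_sym w) = 2 \<and> b = 2 then step_prog j else Skip))
          (work s [] (tl (map bit_sym w)) [] [] []) 2 (\<lambda>s'. s' = ?s)"
        by (rule ht_Pop'[where t = 1], simp only: work_simps ab if_False t)
          (simp_all add: ht_Skip)
      then have "ht \<phi> (phase_body j) (work s [] (map bit_sym w) [] [] []) 3 (\<lambda>s'. s' = ?s)"
        unfolding phase_body_def by - (rule ht_Pop'[where t = 2], simp_all only: work_simps, simp?)
      then show "ht \<phi> (phase_body j) ((work s [] (map bit_sym w) [] [] [1])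
            (rV := tl (work s [] (map bit_sym w) [] [] [1] rV))) 3 (\<lambda>s'. s' = ?s)"
        by simp
      fix s' assume s': "s' = ?s"
      have "?P w ?s" using r by (intro exI[of _ "drop 2 w"]) simp
      then show "ht \<phi> ?W s' 1 (?P w)"
        unfolding s' by (intro ht_While_end) (simp_all only: work_simps hd0_simps list.sel(2) zero_less_one)
    qed simp_all
  qed
qed

lemma ht_phase_prog:
  assumes ne: "\<And>x. \<phi> x \<noteq> {}" and j: "1 \<le> j" "j \<le> n" and c: "s rC = []" and w: "length w \<le> L"
  shows "ht \<phi> (phase_prog j) (work s [] (map bit_sym w) [] [] [])
    ((L + 1) * ((9 * n + 32) * L + 15 * n + 70) + 2)
    (\<lambda>s'. \<exists>w'. phase_run \<phi> j w w' \<and> length w' \<le> length w \<and> s' = work s [] (map bit_sym w') [] [] [])"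
proof -
  have p: "ht \<phi> (Push rV 1) (work s [] (map bit_sym w) [] [] []) 1 (\<lambda>s'. s' = work s [] (map bit_sym w) [] [] [1])"
    by (rule ht_Push) simp_all
  have "(length w + 1) * ((9 * j + 32) * L + 15 * j + 70) \<le> (L + 1) * ((9 * n + 32) * L + 15 * n + 70)"
    by (intro mult_le_mono add_mono) (use w j in simp_all)
  then show ?thesis
    unfolding phase_prog_def
    by (intro ht_Seq_det[OF p ht_phase_loop[of \<phi> j s w L, OF ne j(1) c w]]) simp
qed

definition final_query :: "nat \<Rightarrow> bool list \<Rightarrow> bool list" where
  "final_query n y = final_pre n @ y @ final_mid @ y"

lemma ht_final_prog:
  assumes ne: "\<And>x. \<phi> x \<noteq> {}"
  shows "ht \<phi> (final_prog n) (work s [] (map bit_sym w) [] [] []) (20 * length w + 15 * n + 160)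
    (\<lambda>s'. \<exists>v\<in>\<phi> (final_query n (drop 1 w)). s' = work s [] [] [] [] [bit_sym v])"
proof -
  let ?y = "drop 1 w" and ?q = "final_query n (drop 1 w)"
  let ?P = "\<lambda>s'. \<exists>v\<in>\<phi> ?q. s' = work s [] [] [] [] [bit_sym v]"
  have l: "length ?q \<le> 3 * n + 24 + 2 * length w"
    by (simp add: final_query_def final_pre_def final_mid_def length_hdr_ones)
  have lp: "length (final_pre n) = 3 * n + 11" "length final_mid = 13"
    by (simp_all add: final_pre_def final_mid_def length_hdr_ones)
  have 6: "ht \<phi> (Ask (\<lambda>b. Seq (drain 0) (Push rV (bit_sym b)))) (work s (map bit_sym ?q) [] [] [] [])
      (3 * (3 * n + 24 + 2 * length w) + 4) ?P"
  proof (rule ht_ask[OF ne])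
    fix b assume b: "b \<in> \<phi> ?q"
    have "?P (work s [] [] [] [] [bit_sym b])" by (rule bexI[OF refl b])
    then show "ht \<phi> (Push rV (bit_sym b)) (work s [] [] [] [] []) 1 ?P"
      by (intro ht_Push) (simp_all only: work_simps zero_less_one)
  qed (use l in simp)
  have q: "map bit_sym (final_pre n) @ map bit_sym ?y @ map bit_sym final_mid @ map bit_sym ?y @ [] = map bit_sym ?q"
    by (simp add: final_query_def)
  have 5: "ht \<phi> (pushes 0 (map bit_sym (rev (final_pre n))))
      (work s (map bit_sym ?y @ map bit_sym final_mid @ map bit_sym ?y @ []) [] [] [] [])
      (2 * length (final_pre n) + 1) (\<lambda>s'. s' = work s (map bit_sym ?q) [] [] [] [])"
    using ht_pushes_0[of \<phi> "final_pre n" s "map bit_sym ?y @ map bit_sym final_mid @ map bit_sym ?y @ []"]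
    unfolding q .
  have t: "tl (map bit_sym w) = map bit_sym ?y" by (cases w) simp_all
  show ?thesis
    unfolding final_prog_def
  proof (rule ht_Pop', unfold work_simps t)
    show "ht \<phi> (Seq (move rX [rA, rB]) (Seq (move rA [0])
     (Seq (pushes 0 (map bit_sym (rev final_mid))) (Seq (move rB [0])
     (Seq (pushes 0 (map bit_sym (rev (final_pre n))))
       (Ask (\<lambda>b. Seq (drain 0) (Push rV (bit_sym b)))))))))
       (work s [] (map bit_sym ?y) [] [] []) (20 * length w + 15 * n + 159) ?P"
      by (rule ht_Seq_det[OF ht_move_XAB ht_Seq_det[OF ht_move_A0 ht_Seq_det[OF ht_pushes_0
            ht_Seq_det[OF ht_move_B0 ht_Seq_det[OF 5 6 lessI] lessI] lessI] lessI]])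
        (simp add: lp)
  qed simp
qed

lemma ht_phases:
  assumes ne: "\<And>x. \<phi> x \<noteq> {}" and c: "s rC = []"
  shows "set js \<subseteq> {1..n} \<Longrightarrow> length w \<le> L \<Longrightarrow>
    ht \<phi> (foldr (\<lambda>j c. Seq (phase_prog j) c) js (final_prog n)) (work s [] (map bit_sym w) [] [] [])
      (length js * ((L + 1) * ((9 * n + 32) * L + 15 * n + 70) + 3) + 20 * L + 15 * n + 160)
      (\<lambda>s'. \<exists>w'. phases_run \<phi> js w w' \<and>
         (\<exists>v\<in>\<phi> (final_query n (drop 1 w')). s' = work s [] [] [] [] [bit_sym v]))"
proof (induction js arbitrary: w)
  case Nil
  show ?case
    unfolding foldr.simps id_apply
    by (rule ht_mono[OF ht_final_prog[of \<phi> n s w, OF ne]]) (use Nil in \<open>simp_all only: phases_run.simps, simp_all?\<close>)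
next
  case (Cons j js)
  let ?T = "(L + 1) * ((9 * n + 32) * L + 15 * n + 70)"
  let ?U = "length js * (?T + 3) + 20 * L + 15 * n + 160"
  let ?R = "\<lambda>js w s'. \<exists>w'. phases_run \<phi> js w w' \<and>
         (\<exists>v\<in>\<phi> (final_query n (drop 1 w')). s' = work s [] [] [] [] [bit_sym v])"
  have j: "1 \<le> j" "j \<le> n" using Cons.prems(1) by simp_all
  show ?case
    unfolding foldr.simps comp_apply
  proof (rule ht_Seq'[OF ht_phase_prog[of \<phi> j n s w L, OF ne j c Cons.prems(2)], where u = ?U], elim exE conjE)
    fix s' u assume u: "phase_run \<phi> j w u" "length u \<le> length w" "s' = work s [] (map bit_sym u) [] [] []"
    have "ht \<phi> (foldr (\<lambda>j c. Seq (phase_prog j) c) js (final_prog n)) s' ?U (?R js u)"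
      unfolding u(3) by (rule Cons.IH) (use Cons.prems u(2) in simp_all)
    then show "ht \<phi> (foldr (\<lambda>j c. Seq (phase_prog j) c) js (final_prog n)) s' ?U (?R (j # js) w)"
    proof (rule ht_mono)
      fix s'' assume "?R js u s''"
      then show "?R (j # js) w s''"
      proof (elim exE conjE)
        fix w' assume r: "phases_run \<phi> js u w'"
          and v: "\<exists>v\<in>\<phi> (final_query n (drop 1 w')). s'' = work s [] [] [] [] [bit_sym v]"
        have "phases_run \<phi> (j # js) w w'" using u(1) r by auto
        then show ?thesis using v by (intro exI[of _ w'] conjI)
      qed
    qed simp
  qed simp
qed

text \<open>The value \<open>r\<close> is the answer to be preserved. The head of \<open>ms\<close>
  is what remains of block \<open>j\<close>; it may be empty, so positivity is demanded of the tail
  only. In phase 1 uniqueness is recorded as well, for \<open>uval_first_block\<close>.\<close>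

definition phase_inv :: "nat \<Rightarrow> nat \<Rightarrow> bool \<Rightarrow> nat list \<Rightarrow> bform \<Rightarrow> bool" where
  "phase_inv n j r ms f \<longleftrightarrow> length ms + j = Suc n \<and> (\<forall>m\<in>set (tl ms). 0 < m) \<and>
     bvars f \<subseteq> {..<sum_list ms} \<and>
     (if j = 1 then card (witnesses ms (form_fun f)) \<le> 1 \<and> sat ms (form_fun f) = r
      else game_val j ms (form_fun f) = r)"

lemma map_form_BVar: "map_form (\<lambda>i. BVar i) f = f"
  by (induction f) simp_all

lemma shift_form_0: "shift_form 0 f = f"
proof -
  have "(\<lambda>i. if i = 0 then BVar 0 else BVar (i + 0)) = (\<lambda>i. BVar i)" by auto
  then show ?thesis unfolding shift_form_def by (simp only: map_form_BVar)
qed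

lemma enc_inst_Cons: "enc_inst (m # ms) f = True # unary m @ enc_inst ms f"
  by (simp add: enc_inst_hdr)

lemma phase_query_inst:
  "phase_query j (unary m @ enc_inst ms f) = enc_inst (replicate (j - 1) 1 @ Suc m # ms) (shift_form (j - 1) f)"
  unfolding phase_query_def phase_prefix_def One_nat_def trans_shift_inst
  by (simp add: enc_inst_hdr unary_simps)

lemma phase_next_inst:
  "phase_next j b (unary m @ enc_inst ms f) = enc_inst (m # ms) (subst_form (if odd j then b else \<not> b) f)"
  unfolding phase_next_def One_nat_def trans_subst_inst by (simp add: enc_inst_Cons)

lemma bvars_shift: "bvars f \<subseteq> {..<s} \<Longrightarrow> 0 < s \<Longrightarrow> bvars (shift_form k f) \<subseteq> {..<k + s}"
  by (fastforce simp: shift_form_def bvars_map_form split: if_splits)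

lemma bvars_subst: "bvars f \<subseteq> {..<Suc s} \<Longrightarrow> bvars (subst_form c f) \<subseteq> {..<s}"
  by (fastforce simp: subst_form_def bvars_map_form split: if_splits)

lemma phase_inv_step:
  assumes inv: "phase_inv n j r (Suc m # ms) f" and j: "1 \<le> j"
    and b: "b \<in> UVAL n (phase_query j (unary m @ enc_inst ms f))"
  shows "phase_inv n j r (m # ms) (subst_form (if odd j then b else \<not> b) f)"
proof -
  have i: "length ms + j = n" "\<forall>m\<in>set ms. 0 < m" "bvars f \<subseteq> {..<Suc m + sum_list ms}"
    using inv by (simp_all add: phase_inv_def)
  have "bvars (shift_form (j - 1) f) \<subseteq> {..<(j - 1) + (Suc m + sum_list ms)}"
    by (rule bvars_shift[OF i(3)]) simp
  then have "valid_inst n (replicate (j - 1) 1 @ Suc m # ms) (shift_form (j - 1) f)"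
    using i(1,2) j by (auto simp: valid_inst_def sum_list_replicate)
  then have b': "b \<in> uval_fun (replicate (j - 1) 1 @ Suc m # ms) (form_fun (shift_form (j - 1) f))"
    using b unfolding phase_query_inst by (simp only: UVAL_enc)
  have bv: "bvars (subst_form c f) \<subseteq> {..<m + sum_list ms}" for c
    by (rule bvars_subst) (use i(3) in simp)
  show ?thesis
  proof (cases "j = 1")
    case True
    then have "b \<in> uval_fun (Suc m # ms) (form_fun f)" using b' by (simp add: shift_form_0)
    moreover have "card (witnesses (Suc m # ms) (form_fun f)) \<le> 1" "sat (Suc m # ms) (form_fun f) = r"
      using inv True by (simp_all only: phase_inv_def if_True)
    ultimately show ?thesis
      using uval_first_block[of b m ms f] i bv True by (simp add: phase_inv_def)
  next
    case False
    then obtain k where k: "j = Suc (Suc k)" using j by (cases j; cases "j - 1") auto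
    have "game_val k (m # ms) (form_fun (subst_form (if odd k then b else \<not> b) f)) = game_val k (Suc m # ms) (form_fun f)"
      by (rule uval_later_block) (use b' k in simp)
    moreover have "game_val j = game_val k" by (simp add: k game_val_def fun_eq_iff)
    moreover have "game_val j (Suc m # ms) (form_fun f) = r" using inv False by (simp only: phase_inv_def if_False)
    ultimately show ?thesis using i bv False k by (simp add: phase_inv_def)
  qed
qed

lemma phase_inv_next:
  assumes inv: "phase_inv n j r (0 # ms) f" and j: "1 \<le> j"
  shows "phase_inv n (Suc j) r ms f"
proof -
  have "game_val j (0 # ms) (form_fun f) = r"
    using inv by (auto simp: phase_inv_def game_val_def split: if_splits)
  then have "game_val (Suc j) ms (form_fun f) = r" by (simp only: game_val_zero)
  moreover have "\<forall>m\<in>set (tl ms). 0 < m" using inv set_tl[of ms] by (auto simp: phase_inv_def)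
  ultimately show ?thesis using inv j by (simp add: phase_inv_def)
qed

lemma phase_run_correct:
  "phase_run (UVAL n) j w w' \<Longrightarrow> 1 \<le> j \<Longrightarrow> j \<le> n \<Longrightarrow> w = enc_inst ms f \<Longrightarrow> phase_inv n j r ms f \<Longrightarrow>
    \<exists>ms' f'. w' = enc_inst ms' f' \<and> phase_inv n (Suc j) r ms' f'"
proof (induction arbitrary: ms f rule: phase_run.induct)
  case (stop w)
  obtain m ms' where ms: "ms = m # ms'" using stop by (cases ms) (auto simp: phase_inv_def)
  \<comment> \<open>A nonempty first block would show two leading ones. The two dropped bits are
    therefore exactly the code of an empty block.\<close>
  have "m = 0" using stop(1,4) ms by (cases m) (auto simp: enc_inst_Cons unary_simps)
  then have "drop 2 w = enc_inst ms' f" using stop(4) ms by (simp add: enc_inst_Cons unary_simps)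
  moreover have "phase_inv n (Suc j) r ms' f"
    by (rule phase_inv_next) (use stop(2,5) ms \<open>m = 0\<close> in simp_all)
  ultimately show ?case by (intro exI conjI)
next
  case (go b y w')
  obtain m0 ms' where ms0: "ms = m0 # ms'" using go.prems by (cases ms) (auto simp: phase_inv_def)
  then obtain m where m: "m0 = Suc m" "y = unary m @ enc_inst ms' f"
    using go.prems(3) by (cases m0) (auto simp: enc_inst_Cons unary_simps)
  have "phase_inv n j r (m # ms') (subst_form (if odd j then b else \<not> b) f)"
    by (rule phase_inv_step) (use go.prems go.hyps(1) ms0 m in simp_all)
  then show ?case
    by (intro go.IH[OF go.prems(1,2)]) (simp_all only: m phase_next_inst)
qed

lemma phases_run_correct:
  "phases_run (UVAL n) [j..<Suc n] w w' \<Longrightarrow> 1 \<le> j \<Longrightarrow> j \<le> Suc n \<Longrightarrow> w = enc_inst ms f \<Longrightarrow>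
    phase_inv n j r ms f \<Longrightarrow> \<exists>f'. w' = enc_inst [] f' \<and> bvars f' = {} \<and> form_fun f' [] = r"
proof (induction "Suc n - j" arbitrary: j w ms f)
  case 0
  then have "j = Suc n" by simp
  then have "ms = []" "w' = w" "bvars f = {}" "n \<noteq> 0 \<Longrightarrow> form_fun f [] = r"
    "n = 0 \<Longrightarrow> form_fun f [] = r"
    using 0 by (auto simp: phase_inv_def game_val_def split: if_splits)
  then show ?case using 0 by blast
next
  case (Suc d)
  then have "[j..<Suc n] = j # [Suc j..<Suc n]" by (intro upt_conv_Cons) simp
  then obtain u where u: "phase_run (UVAL n) j w u" "phases_run (UVAL n) [Suc j..<Suc n] u w'"
    using Suc.prems(1) by auto
  have j: "j \<le> n" using Suc.hyps(2) by simp
  obtain ms' f' where "u = enc_inst ms' f'" "phase_inv n (Suc j) r ms' f'"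
    using phase_run_correct[OF u(1) Suc.prems(2) j Suc.prems(4,5)] by blast
  then show ?case by (intro Suc.hyps(1)[OF _ u(2)]) (use Suc.hyps(2) j in simp_all)
qed

text \<open>A word that is no instance and an instance with several witnesses admit both answers. In
  the remaining case the promise starts the invariant, which ends with a closed formula of the right
  value.\<close>

lemma game_correct:
  assumes n: "1 \<le> n" and run: "phases_run (UVAL n) [1..<Suc n] x w'"
    and v: "v \<in> UVAL n (final_query n (drop 1 w'))"
  shows "v \<in> USAT n x"
proof (cases "encodes_level n x")
  case False
  then show ?thesis by (simp add: USAT_def)
next
  case True
  then obtain ms f where x: "x = enc_inst ms f" and valid: "valid_inst n ms f"
    by (auto simp: encodes_level_def)
  show ?thesis
  proof (cases "card (witnesses ms (form_fun f)) \<le> 1")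
    case False
    then show ?thesis unfolding x USAT_enc[OF valid] by (simp add: usat_fun_def)
  next
    case card: True
    have inv: "phase_inv n 1 (sat ms (form_fun f)) ms f"
      using valid card set_tl[of ms] by (auto simp: phase_inv_def valid_inst_def)
    obtain f' where f': "w' = enc_inst [] f'" "bvars f' = {}" "form_fun f' [] = sat ms (form_fun f)"
      using phases_run_correct[OF run _ _ x inv] n by auto
    have q: "final_query n (drop 1 w') = enc_inst (replicate n 1) (iff_form f')"
      by (simp add: f' enc_inst_hdr final_query_def final_pre_def final_mid_def iff_form_def unary_simps)
    have "valid_inst n (replicate n 1) (iff_form f')"
      using f'(2) n by (simp add: valid_inst_def iff_form_def sum_list_replicate)
    then have "v \<in> uval_fun (replicate n 1) (form_fun (iff_form f'))"
      using v unfolding q by (simp only: UVAL_enc)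
    then have "v = sat ms (form_fun f)"
      using uval_closed[of v "n - 1" f'] n f'(2,3) by simp
    then show ?thesis unfolding x USAT_enc[OF valid] using card by (simp add: usat_fun_def)
  qed
qed

lemma game_prog_computes:
  assumes n: "1 \<le> n"
  shows "\<exists>T :: nat poly. computes (UVAL n) (game_prog n) (USAT n) (poly T)"
proof -
  define X :: "nat poly" where "X = [:0, 1:]"
  define T where "T = smult n ((X + 1) * (smult (9 * n + 32) X + [:15 * n + 70:]) + [:3:]) +
    smult 20 X + [:15 * n + 160:]"
  have T: "poly T l = n * ((l + 1) * ((9 * n + 32) * l + 15 * n + 70) + 3) + 20 * l + 15 * n + 160" for l
    by (simp add: T_def X_def algebra_simps)
  have "computes (UVAL n) (game_prog n) (USAT n) (poly T)"
    unfolding computes_def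
  proof (intro allI impI)
    fix s x assume x: "s rX = map bit_sym x" and r: "\<forall>r. r \<notin> {rL, rR, rS, rX} \<longrightarrow> s r = []"
    have c: "s = work s [] (map bit_sym x) [] [] []" "s rC = []"
      using clean_st[of s, OF x] r by blast+
    let ?Q = "\<lambda>s'. \<exists>w'. phases_run (UVAL n) [1..<Suc n] x w' \<and>
         (\<exists>v\<in>UVAL n (final_query n (drop 1 w')). s' = work s [] [] [] [] [bit_sym v])"
    have len: "length [1..<Suc n] = n" by simp
    have "ht (UVAL n) (game_prog n) (work s [] (map bit_sym x) [] [] []) (poly T (length x)) ?Q"
      using ht_phases[of "UVAL n" s "[1..<Suc n]" n x "length x", OF oracle_nonempty(2) c(2)]
      unfolding T game_prog_def len by (simp only: set_upt atLeastLessThanSuc_atLeastAtMost order_refl)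
    then have "ht (UVAL n) (game_prog n) s (poly T (length x)) ?Q" unfolding c(1)[symmetric] .
    then show "ht (UVAL n) (game_prog n) s (poly T (length x))
        (\<lambda>s'. \<exists>v\<in>USAT n x. s' = s(rX := [], rV := [bit_sym v]))"
    proof (rule ht_mono[OF _ order_refl], elim exE conjE bexE)
      fix s' w' v
      assume a: "phases_run (UVAL n) [1..<Suc n] x w'" "v \<in> UVAL n (final_query n (drop 1 w'))"
        and s': "s' = work s [] [] [] [] [bit_sym v]"
      show "\<exists>v\<in>USAT n x. s' = s(rX := [], rV := [bit_sym v])"
        unfolding s' by (rule bexI[OF result_st[OF c(1)] game_correct[OF n a]])
    qed
  qed
  then show ?thesis ..
qed

lemma wfc_game_prog:
  assumes A: "12 \<le> A"
  shows "wfc 10 A (game_prog n)"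
proof -
  have p: "wfc 10 A (pushes 0 (map bit_sym y))" for y
    using A by (auto simp: wfc_pushes bit_sym_def)
  have f: "wfc 10 A (transduce (shift_fst k) 1 rC rX rA)" "wfc 10 A (transduce (subst_fst d) 1 rC rX rA)" for k d
    by (rule wfc_fst[OF A]; simp add: shift_fst_def subst_fst_def)+
  have m: "wfc 10 A (move rX [rA, rB])" "wfc 10 A (move rA [rX])" "wfc 10 A (move rA [0])"
    "wfc 10 A (move rB [rX])" "wfc 10 A (move rB [0])"
    by (rule wfc_move; simp)+
  have "wfc 10 A (step_prog j)" for j
    unfolding step_prog_def wfc.simps drain_def using A p f m by simp
  then have b: "wfc 10 A (phase_prog j)" for j
    unfolding phase_prog_def phase_body_def wfc.simps using A by simp
  have "wfc 10 A (final_prog n)"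
    unfolding final_prog_def wfc.simps drain_def using A p m by (simp add: bit_sym_def)
  then have "wfc 10 A (foldr (\<lambda>j c. Seq (phase_prog j) c) js (final_prog n))" for js
    using b by (induction js) simp_all
  then show ?thesis by (simp add: game_prog_def)
qed

theorem theorem12:
  fixes n :: nat
  assumes "1 \<le> n"
  shows "hatP (UVAL n) = hatP (USAT n)"
proof -
  obtain T :: "nat poly" where T: "computes (UVAL n) (game_prog n) (USAT n) (poly T)"
    using game_prog_computes[OF assms] by blast
  have "computes (USAT n) insert_prog (UVAL n) (poly [:20, 80:])"
    by (rule insert_prog_computes[of "USAT n" "UVAL n", OF oracle_nonempty(1) usat_decides_uval[OF assms]])
  then have "\<psi> \<propto>\<^sub>T UVAL n \<Longrightarrow> \<psi> \<propto>\<^sub>T USAT n" for \<psi>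
    using reduces_transfer wfc_insert_prog by blast
  moreover have "\<psi> \<propto>\<^sub>T USAT n \<Longrightarrow> \<psi> \<propto>\<^sub>T UVAL n" for \<psi>
    using reduces_transfer T wfc_game_prog by blast
  ultimately show ?thesis unfolding hatP_def by blast
qed

end
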